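(* Let $k\ge2$ and let $F=F(a_1,\dots,a_k)$ be the free group with fixed free basis $\{a_1,\dots,a_k\}$. For $\phi\in\mathrm{Out}(F)$ let $$\lambda_0(\phi)=\inf_{w}\ \max\left\{\frac{\|\phi(w)\|}{\|w\|},\frac{\|\phi^{-1}(w)\|}{\|w\|}\right\},$$ the infimum being over all nontrivial cyclic words $w$. The following hold: (1) An outer automorphism $\phi\in\mathrm{Out}(F)$ is strictly hyperbolic if and only if $\lambda_0(\phi)>1$. (2) For any $\phi\in\mathrm{Out}(F)$ the number $\lambda_0(\phi)$ is rational. (3) There is an algorithm which, given an outer automorphism $\phi$ expressed (modulo inner automorphisms) as a product of $t$ Nielsen automorphisms, computes $\lambda_0(\phi)$ and decides whether $\phi$ is strictly hyperbolic, in time double exponential in $t$.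
   Context: A cyclic word is an equivalence class of cyclically reduced words in $\{a_1,\dots,a_k\}^{\pm1}$ up to cyclic permutation; nontrivial cyclic words correspond bijectively to nontrivial conjugacy classes of $F$, and $\mathrm{Out}(F)$ acts on them. $\|w\|$ is the length of a cyclic word $w$. An outer automorphism $\phi$ is strictly hyperbolic if there is $\lambda>1$ such that $\lambda\|w\|\le\max\{\|\phi(w)\|,\|\phi^{-1}(w)\|\}$ for every cyclic word $w$. A Nielsen automorphism of $F$ is an automorphism $\tau$ of one of the types: (i) for some $i$, $\tau(a_i)=a_i^{-1}$ and $\tau(a_j)=a_j$ for $j\ne i$; (ii) for some $i<j$, $\tau(a_i)=a_j$, $\tau(a_j)=a_i$ and $\tau(a_l)=a_l$ for $l\ne i,j$; (iii) for some $i<j$, $\tau(a_i)=a_ia_j$ and $\tau(a_l)=a_l$ for $l\ne i$. The rank $k$ is fixed. *)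

theory Defs
  imports Complex_Main "HOL-Algebra.Coset" "HOL-Algebra.Bij"
begin

section \<open>The free group on \<open>a\<^sub>0, \<dots>, a\<^bsub>k-1\<^esub>\<close>\<close>

text \<open>The letter \<open>(i, False)\<close> is the generator \<open>a\<^sub>i\<close> and \<open>(i, True)\<close> is its inverse; generators are
  indexed from 0. Elements of the free group are the reduced words.\<close>

type_synonym letter = "nat \<times> bool"
type_synonym word = "letter list"

definition inv_letter :: "letter \<Rightarrow> letter" where
  "inv_letter x = (fst x, \<not> snd x)"

definition reduced :: "word \<Rightarrow> bool" where
  "reduced w \<longleftrightarrow> successively (\<lambda>x y. y \<noteq> inv_letter x) w"

fun push_letter :: "letter \<Rightarrow> word \<Rightarrow> word" where
  "push_letter x [] = [x]"
| "push_letter x (y # ys) = (if y = inv_letter x then ys else x # y # ys)"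

definition reduce :: "word \<Rightarrow> word" where
  "reduce w = foldr push_letter w []"

definition free_group :: "nat \<Rightarrow> word monoid" where
  "free_group k =
    \<lparr>carrier = {w. reduced w \<and> fst ` set w \<subseteq> {..<k}},
     mult = (\<lambda>u v. reduce (u @ v)),
     one = []\<rparr>"

definition basis_elem :: "nat \<Rightarrow> word" where
  "basis_elem i = [(i, False)]"


section \<open>Outer automorphisms\<close>

definition Inn :: "('a, 'b) monoid_scheme \<Rightarrow> ('a \<Rightarrow> 'a) set" where
  "Inn G = {(\<lambda>x\<in>carrier G. g \<otimes>\<^bsub>G\<^esub> x \<otimes>\<^bsub>G\<^esub> inv\<^bsub>G\<^esub> g) | g. g \<in> carrier G}"

text \<open>An outer automorphism is a coset of \<open>Inn G\<close>, i.e. a set of automorphisms.\<close>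

definition Out :: "('a, 'b) monoid_scheme \<Rightarrow> ('a \<Rightarrow> 'a) set monoid" where
  "Out G = AutoGroup G Mod Inn G"

definition conjugate :: "('a, 'b) monoid_scheme \<Rightarrow> 'a \<Rightarrow> 'a \<Rightarrow> bool" where
  "conjugate G u v \<longleftrightarrow>
    u \<in> carrier G \<and> (\<exists>g\<in>carrier G. v = g \<otimes>\<^bsub>G\<^esub> u \<otimes>\<^bsub>G\<^esub> inv\<^bsub>G\<^esub> g)"


section \<open>Cyclic words and the action of outer automorphisms on them\<close>

definition cyclically_reduced :: "nat \<Rightarrow> word \<Rightarrow> bool" where
  "cyclically_reduced k w \<longleftrightarrow>
    w \<in> carrier (free_group k) \<and> (w \<noteq> [] \<longrightarrow> last w \<noteq> inv_letter (hd w))"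

definition cyclic_words :: "nat \<Rightarrow> word set set" where
  "cyclic_words k = {{rotate n w | n. True} | w. cyclically_reduced k w}"

definition nontrivial_cyclic_words :: "nat \<Rightarrow> word set set" where
  "nontrivial_cyclic_words k = cyclic_words k - {{[]}}"

definition cyclic_length :: "word set \<Rightarrow> nat" where
  "cyclic_length c = (THE n. \<forall>u\<in>c. length u = n)"

text \<open>The cyclic word corresponding to a conjugacy class is the set of cyclically reduced words
  lying in that class; \<open>\<phi>\<close> sends the class of \<open>u\<close> to the class of \<open>f u\<close>, for any automorphism
  \<open>f\<close> representing \<open>\<phi>\<close>.\<close>

definition out_act :: "nat \<Rightarrow> (word \<Rightarrow> word) set \<Rightarrow> word set \<Rightarrow> word set" where
  "out_act k \<phi> c =
    {v. cyclically_reduced k v \<and> (\<exists>f\<in>\<phi>. \<exists>u\<in>c. conjugate (free_group k) (f u) v)}"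

definition strictly_hyperbolic :: "nat \<Rightarrow> (word \<Rightarrow> word) set \<Rightarrow> bool" where
  "strictly_hyperbolic k \<phi> \<longleftrightarrow>
    (\<exists>l::real. l > 1 \<and> (\<forall>c\<in>cyclic_words k.
      l * real (cyclic_length c) \<le>
        max (real (cyclic_length (out_act k \<phi> c)))
            (real (cyclic_length (out_act k (inv\<^bsub>Out (free_group k)\<^esub> \<phi>) c)))))"

definition lambda0 :: "nat \<Rightarrow> (word \<Rightarrow> word) set \<Rightarrow> real" where
  "lambda0 k \<phi> =
    (INF c\<in>nontrivial_cyclic_words k.
      max (real (cyclic_length (out_act k \<phi> c)) / real (cyclic_length c))
          (real (cyclic_length (out_act k (inv\<^bsub>Out (free_group k)\<^esub> \<phi>) c)) / real (cyclic_length c)))"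


section \<open>Nielsen automorphisms\<close>

text \<open>The finite description of a Nielsen automorphism, and the automorphisms it describes.\<close>

datatype nielsen = Invert nat | Swap nat nat | Transvect nat nat

fun is_nielsen :: "nat \<Rightarrow> nielsen \<Rightarrow> (word \<Rightarrow> word) \<Rightarrow> bool" where
  "is_nielsen k (Invert i) \<tau> \<longleftrightarrow> \<tau> \<in> auto (free_group k) \<and> i < k \<and>
     \<tau> (basis_elem i) = inv\<^bsub>free_group k\<^esub> (basis_elem i) \<and>
     (\<forall>l<k. l \<noteq> i \<longrightarrow> \<tau> (basis_elem l) = basis_elem l)"
| "is_nielsen k (Swap i j) \<tau> \<longleftrightarrow> \<tau> \<in> auto (free_group k) \<and> i < j \<and> j < k \<and>
     \<tau> (basis_elem i) = basis_elem j \<and> \<tau> (basis_elem j) = basis_elem i \<and>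
     (\<forall>l<k. l \<noteq> i \<and> l \<noteq> j \<longrightarrow> \<tau> (basis_elem l) = basis_elem l)"
| "is_nielsen k (Transvect i j) \<tau> \<longleftrightarrow> \<tau> \<in> auto (free_group k) \<and> i < j \<and> j < k \<and>
     \<tau> (basis_elem i) = basis_elem i \<otimes>\<^bsub>free_group k\<^esub> basis_elem j \<and>
     (\<forall>l<k. l \<noteq> i \<longrightarrow> \<tau> (basis_elem l) = basis_elem l)"

definition aut_product :: "nat \<Rightarrow> (word \<Rightarrow> word) list \<Rightarrow> (word \<Rightarrow> word)" where
  "aut_product k \<tau>s =
    foldr (mult (AutoGroup (free_group k))) \<tau>s \<one>\<^bsub>AutoGroup (free_group k)\<^esub>"


section \<open>Algorithms and running time\<close>

text \<open>The machine model is a first-order, call-by-value Lisp over binary trees, with unit cost per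
  evaluated expression. A program is a list of function bodies; \<open>Call f es\<close> runs body number \<open>f\<close>
  in the environment formed by the values of \<open>es\<close>. With trees represented by pointers, each unit
  of cost is a bounded number of pointer operations, so this time measure is polynomially
  equivalent to Turing machine time; the class of doubly exponential bounds
  \<open>2 ^ 2 ^ O(t)\<close> is not affected by a polynomial change of the time measure.\<close>

datatype tree = Leaf | Node tree tree

datatype expr =
    Var nat
  | Nil_Exp
  | Cons_Exp expr expr
  | Fst_Exp expr
  | Snd_Exp expr
  | If_Leaf expr expr expr
  | Call nat "expr list"

type_synonym program = "expr list"

text \<open>\<open>eval P env e v n\<close>: the expression \<open>e\<close> evaluates to \<open>v\<close> at cost \<open>n\<close>. Evaluation gets stuck on
  undefined variables, undefined functions and components of a leaf.\<close>

inductive eval :: "program \<Rightarrow> tree list \<Rightarrow> expr \<Rightarrow> tree \<Rightarrow> nat \<Rightarrow> bool"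
  and evals :: "program \<Rightarrow> tree list \<Rightarrow> expr list \<Rightarrow> tree list \<Rightarrow> nat \<Rightarrow> bool"
  for P :: program where
  "i < length env \<Longrightarrow> eval P env (Var i) (env ! i) 1"
| "eval P env Nil_Exp Leaf 1"
| "eval P env e1 v1 n1 \<Longrightarrow> eval P env e2 v2 n2 \<Longrightarrow>
     eval P env (Cons_Exp e1 e2) (Node v1 v2) (n1 + n2 + 1)"
| "eval P env e (Node v1 v2) n \<Longrightarrow> eval P env (Fst_Exp e) v1 (n + 1)"
| "eval P env e (Node v1 v2) n \<Longrightarrow> eval P env (Snd_Exp e) v2 (n + 1)"
| "eval P env e Leaf n \<Longrightarrow> eval P env e1 v m \<Longrightarrow>
     eval P env (If_Leaf e e1 e2) v (n + m + 1)"
| "eval P env e (Node v1 v2) n \<Longrightarrow> eval P env e2 v m \<Longrightarrow>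
     eval P env (If_Leaf e e1 e2) v (n + m + 1)"
| "f < length P \<Longrightarrow> evals P env es vs n \<Longrightarrow> eval P vs (P ! f) v m \<Longrightarrow>
     eval P env (Call f es) v (n + m + 1)"
| "evals P env [] [] 0"
| "eval P env e v n \<Longrightarrow> evals P env es vs m \<Longrightarrow> evals P env (e # es) (v # vs) (n + m)"

text \<open>Function number 0 is the entry point.\<close>

definition computes :: "program \<Rightarrow> tree \<Rightarrow> tree \<Rightarrow> nat \<Rightarrow> bool" where
  "computes P x y n \<longleftrightarrow> eval P [x] (Call 0 [Var 0]) y n"

text \<open>Numbers are written in unary, which takes at least as much time to output as binary.\<close>

fun enc_nat :: "nat \<Rightarrow> tree" where
  "enc_nat 0 = Leaf"
| "enc_nat (Suc n) = Node Leaf (enc_nat n)"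

definition enc_bool :: "bool \<Rightarrow> tree" where
  "enc_bool b = (if b then Node Leaf Leaf else Leaf)"

fun enc_nielsen :: "nielsen \<Rightarrow> tree" where
  "enc_nielsen (Invert i) = Node (enc_nat 0) (enc_nat i)"
| "enc_nielsen (Swap i j) = Node (enc_nat 1) (Node (enc_nat i) (enc_nat j))"
| "enc_nielsen (Transvect i j) = Node (enc_nat 2) (Node (enc_nat i) (enc_nat j))"

fun enc_list :: "tree list \<Rightarrow> tree" where
  "enc_list [] = Leaf"
| "enc_list (x # xs) = Node x (enc_list xs)"

text \<open>The answer consists of the fraction \<open>p / q\<close> and a truth value.\<close>

definition enc_answer :: "nat \<Rightarrow> nat \<Rightarrow> bool \<Rightarrow> tree" where
  "enc_answer p q b = Node (Node (enc_nat p) (enc_nat q)) (enc_bool b)"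

end

theory Submission
  imports Defs
begin

text \<open>
Let \<open>f\<close> represent \<open>\<phi>\<close>, let \<open>g\<close> be its inverse, and let \<open>M\<close> bound the lengths of their images of
letters. The cyclic length of \<open>\<phi> w\<close> is the growth rate of the length of \<open>f (w ^ n)\<close>. If \<open>s\<close> is a
reduced word of length at least \<open>L = 2 * M * M\<close>, no extension of \<open>s\<close> on the right changes the first
\<open>M\<close> letters of \<open>f s\<close>; hence the change of the length of \<open>f s\<close> caused by prepending a letter depends
only on the first \<open>L\<close> letters of \<open>s\<close>. So the cyclic lengths of \<open>w\<close>, \<open>\<phi> w\<close> and the preimage of \<open>w\<close>
are additive weights \<open>(n, a, b)\<close> of closed walks in the de Bruijn graph of reduced words of length
\<open>L\<close>. Closed walks split into walks no longer than the number of vertices, and two closed walks can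
be iterated and joined at bounded cost. Therefore \<open>lambda0\<close> is the minimum of \<open>max a b / n\<close> over the
cone spanned by the finitely many short weights. As only two coordinates are compared, it is
attained at one weight or at a combination of two with \<open>a = b\<close>, so it is rational.

For a product of \<open>t\<close> Nielsen automorphisms \<open>M = 2 ^ t\<close> works, and the graph has doubly exponential
size in \<open>t\<close>. In that size, the weights of short closed walks take polynomially many values, found by
dynamic programming on unary numbers. Functions of polynomial cost are closed under composition and
under list recursion with bounded results, which yields the program without writing it down.
\<close>

section \<open>Reduction of words\<close>

text \<open>Maxima do not add up along walks, linear forms do. The lower bound therefore produces
  one weight \<open>s\<close> in the unit interval with
  \<open>\<mu> * n \<le> s * a + (1 - s) * b\<close> for all short closed walks, and only this
  linear bound is carried over to long ones. With two coordinates, the existence of \<open>s\<close>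
  depends on pairs of vectors only; this is why combinations of two suffice. Conversely, a
  combination of two weights need not belong to any closed walk. It is approached by words built
  from high powers, and rank at least 2 supplies the letters that connect the powers. The constant
  \<open>2 * M * M\<close> arises because the inverse obeys the same bound \<open>M\<close>: all
  words of at least this length have images of at least \<open>2 * M\<close> letters, and one more
  letter cancels at most the last \<open>M\<close> of them. The remaining \<open>M\<close> letters
  are as many as a prepended letter can cancel. Running times are compared with an arbitrary measure
  rather than the input size, as the whole program is polynomial only relative to the size of the
  graph.\<close>

lemma inv_letter_inv_letter [simp]: "inv_letter (inv_letter x) = x"
  by (simp add: inv_letter_def)

lemma inv_letter_neq [simp]: "inv_letter x \<noteq> x" "x \<noteq> inv_letter x"
  by (auto simp: inv_letter_def prod_eq_iff)

lemma inv_letter_eq_iff [simp]: "inv_letter x = inv_letter y \<longleftrightarrow> x = y"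
  by (metis inv_letter_inv_letter)

lemma fst_inv_letter [simp]: "fst (inv_letter x) = fst x"
  by (simp add: inv_letter_def)

lemma reduced_Nil [simp]: "reduced []"
  by (simp add: reduced_def)

lemma reduced_Cons: "reduced (x # w) \<longleftrightarrow> (w = [] \<or> hd w \<noteq> inv_letter x) \<and> reduced w"
  by (auto simp: reduced_def successively_Cons)

lemma reduced_append:
  "reduced (u @ v) \<longleftrightarrow>
    reduced u \<and> reduced v \<and> (u = [] \<or> v = [] \<or> hd v \<noteq> inv_letter (last u))"
  by (auto simp: reduced_def successively_append_iff)

lemma reduced_push_letter: "reduced w \<Longrightarrow> reduced (push_letter x w)"
  by (cases w) (auto simp: reduced_Cons)

lemma reduced_foldr_push: "reduced v \<Longrightarrow> reduced (foldr push_letter u v)"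
  by (induction u) (auto simp: reduced_push_letter)

lemma reduced_reduce [simp]: "reduced (reduce w)"
  by (simp add: reduce_def reduced_foldr_push)

lemma reduce_Nil [simp]: "reduce [] = []"
  by (simp add: reduce_def)

lemma reduce_reduced [simp]: "reduced w \<Longrightarrow> reduce w = w"
  unfolding reduce_def
proof (induction w)
  case (Cons x w)
  then show ?case by (cases w) (auto simp: reduced_Cons)
qed simp

lemma push_letter_inv: "reduced w \<Longrightarrow> push_letter (inv_letter x) (push_letter x w) = w"
proof (cases w)
  case (Cons y ys)
  assume "reduced w"
  with Cons show ?thesis by (cases ys) (auto simp: reduced_Cons)
qed simp

lemma reduce_append: "reduce (u @ v) = foldr push_letter u (reduce v)"
  by (simp add: reduce_def)

text \<open>If \<open>x\<close> meets its inverse at the head of \<open>u\<close>, the two pushes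
  undo each other on the reduced word below; otherwise nothing cancels. Associativity of the group
  product rests on this.\<close>

lemma foldr_push_push:
  assumes "reduced v"
  shows "foldr push_letter (push_letter x u) v = push_letter x (foldr push_letter u v)"
proof (cases u)
  case (Cons y ys)
  show ?thesis
  proof (cases "y = inv_letter x")
    case True
    have "push_letter x (push_letter (inv_letter x) (foldr push_letter ys v)) = foldr push_letter ys v"
      using push_letter_inv[of "foldr push_letter ys v" "inv_letter x"] assms
      by (simp add: reduced_foldr_push)
    with Cons True show ?thesis by simp
  qed (use Cons in simp)
qed simp

lemma foldr_push_reduce:
  "reduced v \<Longrightarrow> foldr push_letter (reduce u) v = foldr push_letter u v"
proof (induction u)
  case (Cons x u)
  have "reduce (x # u) = push_letter x (reduce u)" by (simp add: reduce_def)
  then show ?case using Cons by (simp add: foldr_push_push)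
qed simp

lemma reduce_reduce_left [simp]: "reduce (reduce u @ v) = reduce (u @ v)"
  by (simp add: reduce_append foldr_push_reduce)

lemma reduce_reduce_right [simp]: "reduce (u @ reduce v) = reduce (u @ v)"
  by (simp add: reduce_append)

lemma reduce_reduce_mid [simp]: "reduce (u @ reduce v @ w) = reduce (u @ v @ w)"
  by (metis reduce_reduce_left reduce_reduce_right)

lemma length_push_letter: "length (push_letter x w) \<le> Suc (length w)"
  "length w \<le> Suc (length (push_letter x w))"
  by (cases w; auto)+

lemma length_foldr_push:
  "length (foldr push_letter u w) \<le> length u + length w"
  "length w \<le> length u + length (foldr push_letter u w)"
proof (induction u)
  case (Cons x u)
  from Cons length_push_letter[where x = x and w = "foldr push_letter u w"]
  show "length (foldr push_letter (x # u) w) \<le> length (x # u) + length w"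
    "length w \<le> length (x # u) + length (foldr push_letter (x # u) w)"
    by auto
qed simp_all

lemma length_reduce_le: "length (reduce w) \<le> length w"
  using length_foldr_push(1)[of w "[]"] by (simp add: reduce_def)

lemma set_push_letter: "set (push_letter x w) \<subseteq> insert x (set w)"
  by (cases w) auto

lemma set_reduce: "set (reduce w) \<subseteq> set w"
  unfolding reduce_def
proof (induction w)
  case (Cons x w)
  then show ?case using set_push_letter[of x "foldr push_letter w []"] by auto
qed simp

text \<open>Each pushed letter removes at most one letter, so \<open>v\<close> outlasts the pushes
  and \<open>w\<close> is never reached. All locality statements go back to this.\<close>

lemma foldr_push_append_tail:
  "length u \<le> length v \<Longrightarrow> foldr push_letter u (v @ w) = foldr push_letter u v @ w"
proof (induction u)
  case (Cons x u)
  have "length v \<le> length u + length (foldr push_letter u v)" by (rule length_foldr_push)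
  with Cons have "foldr push_letter u v \<noteq> []" by auto
  with Cons show ?case by (cases "foldr push_letter u v") auto
qed simp

section \<open>Formal inverses and cancellation at the right end\<close>

definition word_inv :: "word \<Rightarrow> word" where
  "word_inv w = rev (map inv_letter w)"

lemma word_inv_word_inv [simp]: "word_inv (word_inv w) = w"
  by (simp add: word_inv_def rev_map o_def)

lemma length_word_inv [simp]: "length (word_inv w) = length w"
  by (simp add: word_inv_def)

lemma word_inv_append [simp]: "word_inv (u @ v) = word_inv v @ word_inv u"
  by (simp add: word_inv_def)

lemma word_inv_Nil [simp]: "word_inv [] = []"
  by (simp add: word_inv_def)

lemma fst_set_word_inv [simp]: "fst ` set (word_inv w) = fst ` set w"
  by (simp add: word_inv_def image_image)

lemma reduced_word_inv [simp]: "reduced (word_inv w) \<longleftrightarrow> reduced w"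
proof -
  have "reduced (word_inv w)" if "reduced w" for w
    using that
  proof (induction w)
    case (Cons x w)
    then have "hd w \<noteq> inv_letter x" if "w \<noteq> []" using that by (simp add: reduced_Cons)
    with Cons show ?case
      by (auto simp: word_inv_def reduced_append reduced_Cons last_rev hd_map)
  qed (simp add: word_inv_def)
  from this[of w] this[of "word_inv w"] show ?thesis by auto
qed

lemma reduce_word_inv_left [simp]: "reduce (word_inv w @ w) = []"
proof (induction w)
  case (Cons x w)
  have "reduce (word_inv (x # w) @ x # w)
      = foldr push_letter (word_inv w) (push_letter (inv_letter x) (push_letter x (reduce w)))"
    by (simp add: word_inv_def reduce_def)
  also have "\<dots> = reduce (word_inv w @ w)" by (simp add: push_letter_inv reduce_append)
  finally show ?case using Cons by simp
qed simp

lemma reduce_word_inv_right [simp]: "reduce (w @ word_inv w) = []"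
  using reduce_word_inv_left[of "word_inv w"] by simp

lemma reduce_cancel_left [simp]: "reduce (word_inv u @ u @ v) = reduce v"
  using reduce_reduce_left[of "word_inv u @ u" v] by simp

lemma reduce_cancel_right [simp]: "reduce (u @ word_inv u @ v) = reduce v"
  using reduce_reduce_left[of "u @ word_inv u" v] by simp

text \<open>Both sides are inverse to \<open>reduce w\<close>; the computation inserts a trivial
  product behind \<open>word_inv w\<close>.\<close>

lemma word_inv_reduce: "word_inv (reduce w) = reduce (word_inv w)"
proof -
  have "reduce (word_inv w) = reduce (word_inv w @ reduce (reduce w @ word_inv (reduce w)))"
    by (simp only: reduce_word_inv_right append_Nil2)
  also have "\<dots> = reduce (word_inv w @ w @ word_inv (reduce w))"
    by (metis reduce_reduce_left reduce_reduce_right)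
  also have "\<dots> = reduce (word_inv (reduce w))" by simp
  also have "\<dots> = word_inv (reduce w)" by simp
  finally show ?thesis ..
qed

text \<open>The mirror image of \<open>foldr_push_append_tail\<close>: inversion turns cancellation
  at the right end into cancellation at the left end.\<close>

lemma reduce_append_head:
  assumes "reduced (u @ v)" "length w \<le> length v"
  shows "reduce ((u @ v) @ w) = u @ reduce (v @ w)"
proof -
  have red: "reduced (word_inv v @ word_inv u)"
    using assms(1) by (metis reduced_word_inv word_inv_append)
  then have red': "reduced (word_inv v)" by (simp add: reduced_append)
  have "word_inv (reduce ((u @ v) @ w)) = reduce (word_inv w @ word_inv v @ word_inv u)"
    by (simp add: word_inv_reduce)
  also have "\<dots> = foldr push_letter (word_inv w) (word_inv v @ word_inv u)"
    using red by (simp only: reduce_append[of "word_inv w"] reduce_reduced)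
  also have "\<dots> = foldr push_letter (word_inv w) (word_inv v) @ word_inv u"
    using assms(2) by (simp add: foldr_push_append_tail)
  also have "\<dots> = word_inv (u @ reduce (v @ w))"
    using red' reduce_append[of "word_inv w" "word_inv v"] by (simp add: word_inv_reduce)
  finally show ?thesis by (metis word_inv_word_inv)
qed


section \<open>The free group\<close>

abbreviation words :: "nat \<Rightarrow> word set" where
  "words k \<equiv> carrier (free_group k)"

lemma words_def: "words k = {w. reduced w \<and> fst ` set w \<subseteq> {..<k}}"
  by (simp add: free_group_def)

lemma mult_free_group [simp]: "u \<otimes>\<^bsub>free_group k\<^esub> v = reduce (u @ v)"
  by (simp add: free_group_def)

lemma one_free_group [simp]: "\<one>\<^bsub>free_group k\<^esub> = []"
  by (simp add: free_group_def)

lemma reduced_if_words: "w \<in> words k \<Longrightarrow> reduced w"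
  by (simp add: words_def)

lemma reduce_in_words: "fst ` set w \<subseteq> {..<k} \<Longrightarrow> reduce w \<in> words k"
  using set_reduce[of w] by (auto simp: words_def)

lemma reduce_append_words: "u \<in> words k \<Longrightarrow> v \<in> words k \<Longrightarrow> reduce (u @ v) \<in> words k"
  by (rule reduce_in_words) (auto simp: words_def)

lemma word_inv_words: "w \<in> words k \<Longrightarrow> word_inv w \<in> words k"
  by (simp add: words_def)

lemma Nil_words [simp]: "[] \<in> words k"
  by (simp add: words_def)

lemma group_free_group: "group (free_group k)"
proof (rule groupI)
  fix x assume "x \<in> words k"
  then show "\<exists>y\<in>words k. y \<otimes>\<^bsub>free_group k\<^esub> x = \<one>\<^bsub>free_group k\<^esub>"
    by (intro bexI[of _ "word_inv x"]) (auto simp: word_inv_words)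
qed (auto simp: reduce_append_words dest: reduced_if_words)

lemma inv_free_group: "w \<in> words k \<Longrightarrow> inv\<^bsub>free_group k\<^esub> w = word_inv w"
  by (rule group.inv_equality[OF group_free_group]) (auto simp: word_inv_words)

lemma words_append_iff:
  "u @ v \<in> words k \<longleftrightarrow>
    u \<in> words k \<and> v \<in> words k \<and> (u = [] \<or> v = [] \<or> hd v \<noteq> inv_letter (last u))"
  by (auto simp: words_def reduced_append)

lemma words_appendD: "u @ v \<in> words k \<Longrightarrow> u \<in> words k" "u @ v \<in> words k \<Longrightarrow> v \<in> words k"
  by (auto simp: words_append_iff)

lemma words_Cons_iff:
  "x # w \<in> words k \<longleftrightarrow> fst x < k \<and> (w = [] \<or> hd w \<noteq> inv_letter x) \<and> w \<in> words k"
  by (auto simp: words_def reduced_Cons)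


section \<open>Growth of powers and cyclic length\<close>

definition word_pow :: "word \<Rightarrow> nat \<Rightarrow> word" where
  "word_pow w n = reduce (concat (replicate n w))"

lemma concat_replicate_snoc: "concat (replicate n w) @ w = w @ concat (replicate n w)"
  by (induction n) auto

lemma word_pow_0 [simp]: "word_pow w 0 = []"
  by (simp add: word_pow_def)

lemma word_pow_Suc: "word_pow w (Suc n) = reduce (w @ word_pow w n)"
  by (simp add: word_pow_def)

lemma word_pow_conj:
  "word_pow (reduce (g @ w @ word_inv g)) n = reduce (g @ word_pow w n @ word_inv g)"
proof (induction n)
  case (Suc n)
  have "word_pow (reduce (g @ w @ word_inv g)) (Suc n)
      = reduce ((g @ w @ word_inv g) @ (g @ word_pow w n @ word_inv g))"
    unfolding word_pow_Suc Suc by (simp del: append_assoc)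
  also have "\<dots> = reduce ((g @ w) @ reduce (word_inv g @ g @ word_pow w n @ word_inv g))"
    by (subst reduce_reduce_right) (simp only: append_assoc)
  also have "\<dots> = reduce (g @ w @ word_pow w n @ word_inv g)"
    using reduce_reduce_right[of "g @ w" "word_pow w n @ word_inv g"]
    by (simp only: reduce_cancel_left append_assoc)
  finally show ?case
    by (metis append.assoc reduce_reduce_mid word_pow_Suc)
qed simp

text \<open>The stable length of \<open>w\<close>, expressed by a bounded error instead of a limit.
  Being a conjugacy invariant that makes sense without cyclic reduction, it stands in for the cyclic
  length of images.\<close>

definition grows :: "word \<Rightarrow> real \<Rightarrow> bool" where
  "grows w l \<longleftrightarrow> (\<exists>C. \<forall>n. \<bar>real (length (word_pow w n)) - real n * l\<bar> \<le> C)"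

text \<open>This replaces limits: error terms that do not grow with \<open>n\<close> drop
  out.\<close>

lemma bounded_multiples_imp_zero:
  fixes d C :: real
  assumes "\<And>n::nat. real n * d \<le> C"
  shows "d \<le> 0"
proof (rule ccontr)
  assume "\<not> d \<le> 0"
  then obtain n :: nat where "real n * d > C" using reals_Archimedean3[of d] by auto
  with assms[of n] show False by simp
qed

lemma grows_unique:
  assumes "grows w l" "grows w l'"
  shows "l = l'"
proof -
  from assms obtain C C' where
    C: "\<And>n. \<bar>real (length (word_pow w n)) - real n * l\<bar> \<le> C"
    and C': "\<And>n. \<bar>real (length (word_pow w n)) - real n * l'\<bar> \<le> C'"
    by (auto simp: grows_def)
  have *: "real n * (l - l') \<le> C + C'" "real n * (l' - l) \<le> C + C'" for n
    using C[of n] C'[of n] by (simp_all add: algebra_simps)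
  show ?thesis
    using bounded_multiples_imp_zero[OF *(1)] bounded_multiples_imp_zero[OF *(2)] by simp
qed

lemma growsI:
  assumes "\<And>n. \<bar>real (length (word_pow w n)) - real n * l\<bar> \<le> C"
  shows "grows w l"
  using assms by (auto simp: grows_def)

lemma length_reduce_conj:
  "length (reduce (g @ w @ word_inv g)) \<le> length (reduce w) + 2 * length g"
proof -
  have "length (reduce (g @ reduce w @ word_inv g)) \<le> length (g @ reduce w @ word_inv g)"
    by (rule length_reduce_le)
  then show ?thesis by simp
qed

lemma length_conj_ge:
  assumes "reduced w"
  shows "length w \<le> length (reduce (g @ w @ word_inv g)) + 2 * length g"
proof -
  have "length (reduce (word_inv g @ reduce (g @ w @ word_inv g) @ g))
      \<le> length (word_inv g @ reduce (g @ w @ word_inv g) @ g)"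
    by (rule length_reduce_le)
  moreover have "reduce (word_inv g @ reduce (g @ w @ word_inv g) @ g) = w"
  proof -
    have "reduce (word_inv g @ reduce (g @ w @ word_inv g) @ g)
        = reduce (w @ reduce (word_inv g @ g))" by (simp del: reduce_word_inv_left)
    then show ?thesis using assms by simp
  qed
  ultimately show ?thesis by simp
qed

text \<open>The powers of a conjugate are the conjugates of the powers, so their lengths change by
  at most \<open>2 * length g\<close>, independently of \<open>n\<close>.\<close>

lemma grows_conj: "grows w l \<Longrightarrow> grows (reduce (g @ w @ word_inv g)) l"
proof -
  assume "grows w l"
  then obtain C where C: "\<And>n. \<bar>real (length (word_pow w n)) - real n * l\<bar> \<le> C"
    by (auto simp: grows_def)
  show ?thesis
  proof (rule growsI)
    fix n
    have "reduced (word_pow w n)" by (simp add: word_pow_def)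
    then show "\<bar>real (length (word_pow (reduce (g @ w @ word_inv g)) n)) - real n * l\<bar>
        \<le> C + 2 * real (length g)"
      using C[of n] length_reduce_conj[of g "word_pow w n"] length_conj_ge[of "word_pow w n" g]
      by (simp add: word_pow_conj)
  qed
qed

lemma concat_replicate_words:
  assumes "w \<in> words k" "w \<noteq> [] \<Longrightarrow> last w \<noteq> inv_letter (hd w)"
  shows "concat (replicate n w) \<in> words k"
proof (induction n)
  case (Suc n)
  show ?case
  proof (cases "w = [] \<or> n = 0")
    case False
    then have "hd (concat (replicate n w)) = hd w" by (cases n) auto
    moreover have "hd w \<noteq> inv_letter (last w)"
    proof
      assume "hd w = inv_letter (last w)"
      then have "last w = inv_letter (hd w)" by simp
      with assms(2) False show False by simp
    qed
    ultimately show ?thesis using Suc assms(1) by (auto simp: words_append_iff)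
  qed (use assms in auto)
qed simp

lemma length_concat_replicate: "length (concat (replicate n w)) = n * length w"
  by (induction n) auto

text \<open>Nothing cancels in a power of a cyclically reduced word, so the error is 0.\<close>

lemma grows_cyclically_reduced: "cyclically_reduced k w \<Longrightarrow> grows w (length w)"
  using reduced_if_words[OF concat_replicate_words[of w k]]
  by (auto simp: grows_def word_pow_def cyclically_reduced_def length_concat_replicate
      intro!: exI[of _ 0])

lemma grows_le:
  assumes "grows w l" "reduced w"
  shows "l \<le> real (length w)"
proof -
  obtain C where C: "\<And>n. \<bar>real (length (word_pow w n)) - real n * l\<bar> \<le> C"
    using assms by (auto simp: grows_def)
  have "length (word_pow w n) \<le> n * length w" for n
    by (metis length_reduce_le word_pow_def length_concat_replicate)
  then have le: "real (length (word_pow w n)) \<le> real n * real (length w)" for n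
    by (metis of_nat_le_iff of_nat_mult)
  have "real n * (l - real (length w)) \<le> C" for n
    using C[of n] le[of n] unfolding right_diff_distrib abs_le_iff by linarith
  from bounded_multiples_imp_zero[OF this] show ?thesis by simp
qed

lemma grows_nonneg: "grows w l \<Longrightarrow> 0 \<le> l"
proof -
  assume "grows w l"
  then obtain C where C: "\<And>n. \<bar>real (length (word_pow w n)) - real n * l\<bar> \<le> C"
    by (auto simp: grows_def)
  have "real n * (- l) \<le> C" for n using C[of n] by (simp add: abs_le_iff)
  from bounded_multiples_imp_zero[OF this] show ?thesis by simp
qed

text \<open>As long as the first and last letters are mutually inverse, conjugation strips both, and
  the length drops by 2.\<close>

lemma conjugate_cyclically_reduced_ex:
  assumes "w \<in> words k"
  shows "\<exists>v g. cyclically_reduced k v \<and> g \<in> words k \<and> v = reduce (g @ w @ word_inv g)"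
  using assms
proof (induction "length w" arbitrary: w rule: less_induct)
  case less
  show ?case
  proof (cases "cyclically_reduced k w")
    case True
    then show ?thesis using less.prems
      by (intro exI[of _ w] exI[of _ "[]"]) (auto simp: reduced_if_words)
  next
    case False
    then have ne: "w \<noteq> []" and lh: "last w = inv_letter (hd w)"
      using less.prems by (auto simp: cyclically_reduced_def)
    obtain x u where w: "w = x # u" using ne by (cases w) auto
    then have "u \<noteq> []" using lh by auto
    then obtain v where u: "u = v @ [inv_letter x]" using w lh by (metis append_butlast_last_id last_ConsR list.sel(1))
    have v: "v \<in> words k" using less.prems w u by (auto simp: words_Cons_iff words_append_iff)
    have x: "[inv_letter x] \<in> words k" using less.prems w by (auto simp: words_Cons_iff)
    have wi: "[x] = word_inv [inv_letter x]" by (simp add: word_inv_def)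
    obtain v' g where v': "cyclically_reduced k v'" "g \<in> words k" "v' = reduce (g @ v @ word_inv g)"
      using less.hyps[of v] v w u by auto
    have "v = reduce ([inv_letter x] @ w @ word_inv [inv_letter x])"
    proof -
      have "reduce ([inv_letter x] @ w @ word_inv [inv_letter x])
          = reduce (word_inv [x] @ [x] @ v @ word_inv [x] @ [x])"
        by (simp add: w u word_inv_def)
      also have "\<dots> = reduce (v @ word_inv [x] @ [x])" by (rule reduce_cancel_left)
      also have "\<dots> = reduce (v @ reduce (word_inv [x] @ [x]))"
        by (simp only: reduce_reduce_right)
      also have "\<dots> = v" using v by (simp add: reduced_if_words)
      finally show ?thesis ..
    qed
    then have "v' = reduce (reduce (g @ [inv_letter x]) @ w @ word_inv (reduce (g @ [inv_letter x])))"
      unfolding v'(3) word_inv_reduce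
      by (metis append.assoc reduce_reduce_left reduce_reduce_mid reduce_reduce_right word_inv_append)
    then show ?thesis using v' x reduce_append_words by blast
  qed
qed

lemma grows_conj_iff:
  assumes "reduced w"
  shows "grows (reduce (g @ w @ word_inv g)) l \<longleftrightarrow> grows w l"
proof
  assume "grows (reduce (g @ w @ word_inv g)) l"
  then have "grows (reduce (word_inv g @ reduce (g @ w @ word_inv g) @ word_inv (word_inv g))) l"
    by (rule grows_conj)
  moreover have "reduce (word_inv g @ reduce (g @ w @ word_inv g) @ word_inv (word_inv g))
      = reduce (w @ reduce (word_inv g @ g))"
    by (simp del: reduce_word_inv_left)
  ultimately show "grows w l" using assms by simp
qed (rule grows_conj)


section \<open>Representatives of outer automorphisms\<close>

lemma auto_mult:
  assumes "f \<in> auto G" "g \<in> auto G"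
  shows "f \<otimes>\<^bsub>AutoGroup G\<^esub> g = compose (carrier G) f g"
  using assms by (simp add: AutoGroup_def BijGroup_def auto_def)

lemma auto_one: "\<one>\<^bsub>AutoGroup G\<^esub> = (\<lambda>x\<in>carrier G. x)"
  by (simp add: AutoGroup_def BijGroup_def)

lemma carrier_AutoGroup: "carrier (AutoGroup G) = auto G"
  by (simp add: AutoGroup_def)

section \<open>Inner automorphisms and cosets of automorphisms\<close>

context group
begin

lemma auto_inv:
  assumes "f \<in> auto G"
  shows "inv\<^bsub>AutoGroup G\<^esub> f = (\<lambda>x\<in>carrier G. inv_into (carrier G) f x)"
proof -
  have "inv\<^bsub>AutoGroup G\<^esub> f = inv\<^bsub>BijGroup (carrier G)\<^esub> f"
    unfolding AutoGroup_def
    using group.m_inv_consistent[OF group_BijGroup subgroup_auto] assms by simp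
  then show ?thesis using assms by (simp add: inv_BijGroup auto_def)
qed

lemma auto_inv_cancel:
  assumes "f \<in> auto G" "x \<in> carrier G"
  shows "f ((inv\<^bsub>AutoGroup G\<^esub> f) x) = x" "(inv\<^bsub>AutoGroup G\<^esub> f) (f x) = x"
proof -
  from assms have bij: "bij_betw f (carrier G) (carrier G)" by (simp add: auto_def Bij_def)
  show "f ((inv\<^bsub>AutoGroup G\<^esub> f) x) = x"
    using assms bij by (simp add: auto_inv f_inv_into_f bij_betw_def)
  have "f x \<in> carrier G" using bij assms by (auto simp: bij_betw_def)
  then show "(inv\<^bsub>AutoGroup G\<^esub> f) (f x) = x"
    using assms bij by (simp add: auto_inv bij_betw_def)
qed

lemma auto_closed: "f \<in> auto G \<Longrightarrow> x \<in> carrier G \<Longrightarrow> f x \<in> carrier G"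
  by (auto simp: auto_def hom_def)

lemma auto_hom_mult:
  "f \<in> auto G \<Longrightarrow> x \<in> carrier G \<Longrightarrow> y \<in> carrier G \<Longrightarrow> f (x \<otimes> y) = f x \<otimes> f y"
  by (auto simp: auto_def hom_def)

lemma auto_hom_inv: "f \<in> auto G \<Longrightarrow> x \<in> carrier G \<Longrightarrow> f (inv x) = inv (f x)"
  by (rule group_hom.hom_inv) (auto simp: group_hom_def group_hom_axioms_def auto_def)

abbreviation conj_map :: "'a \<Rightarrow> 'a \<Rightarrow> 'a" where
  "conj_map g \<equiv> (\<lambda>x\<in>carrier G. g \<otimes> x \<otimes> inv g)"

lemma conj_conj:
  "g \<in> carrier G \<Longrightarrow> h \<in> carrier G \<Longrightarrow> x \<in> carrier G \<Longrightarrow>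
    g \<otimes> (h \<otimes> x \<otimes> inv h) \<otimes> inv g = (g \<otimes> h) \<otimes> x \<otimes> inv (g \<otimes> h)"
  by (simp add: inv_mult_group m_assoc)

lemma conj_map_auto: "g \<in> carrier G \<Longrightarrow> conj_map g \<in> auto G"
proof -
  assume g: "g \<in> carrier G"
  have "conj_map g \<in> hom G G"
    using g by (auto simp: hom_def m_assoc inv_solve_left)
  moreover have "inv g \<otimes> (g \<otimes> x \<otimes> inv g) \<otimes> g = x" "g \<otimes> (inv g \<otimes> x \<otimes> g) \<otimes> inv g = x"
    if "x \<in> carrier G" for x
    using conj_conj[of "inv g" g x] conj_conj[of g "inv g" x] that g by simp_all
  then have "bij_betw (conj_map g) (carrier G) (carrier G)"
    using g by (intro bij_betw_byWitness[where f' = "conj_map (inv g)"]) auto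
  ultimately show ?thesis by (simp add: auto_def Bij_def)
qed

text \<open>Normality makes \<open>Out G\<close> a group whose cosets can be inverted representative
  by representative. Conjugating the inner automorphism of \<open>g\<close> by \<open>x\<close>
  gives that of \<open>x g\<close>.\<close>

lemma normal_Inn: "Inn G \<lhd> AutoGroup G"
proof (rule group.normal_invI[OF AutoGroup])
  have mem: "conj_map g \<in> Inn G" if "g \<in> carrier G" for g
    using that by (auto simp: Inn_def)
  have comp: "conj_map g \<otimes>\<^bsub>AutoGroup G\<^esub> conj_map h = conj_map (g \<otimes> h)"
    if "g \<in> carrier G" "h \<in> carrier G" for g h
    using that by (auto simp: auto_mult conj_map_auto compose_def conj_conj intro!: ext)
  show "subgroup (Inn G) (AutoGroup G)"
  proof (rule group.subgroupI[OF AutoGroup])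
    show "Inn G \<subseteq> carrier (AutoGroup G)"
      by (auto simp: Inn_def carrier_AutoGroup conj_map_auto)
    show "Inn G \<noteq> {}" using mem[of \<one>] by auto
    show "inv\<^bsub>AutoGroup G\<^esub> a \<in> Inn G" if "a \<in> Inn G" for a
    proof -
      from that obtain g where g: "g \<in> carrier G" "a = conj_map g" by (auto simp: Inn_def)
      have "conj_map \<one> = \<one>\<^bsub>AutoGroup G\<^esub>" by (auto simp: auto_one intro!: ext)
      then have "inv\<^bsub>AutoGroup G\<^esub> a = conj_map (inv g)"
        using g comp[of "inv g" g] conj_map_auto[of "inv g"]
        by (intro group.inv_equality[OF AutoGroup]) (auto simp: carrier_AutoGroup conj_map_auto)
      then show ?thesis using mem[of "inv g"] g by simp
    qed
    show "a \<otimes>\<^bsub>AutoGroup G\<^esub> b \<in> Inn G" if "a \<in> Inn G" "b \<in> Inn G" for a b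
    proof -
      from that obtain g h where "g \<in> carrier G" "a = conj_map g" "h \<in> carrier G" "b = conj_map h"
        by (auto simp: Inn_def)
      then show ?thesis using comp[of g h] mem[of "g \<otimes> h"] by simp
    qed
  qed
  fix x h assume x: "x \<in> carrier (AutoGroup G)" and "h \<in> Inn G"
  then obtain g where g: "g \<in> carrier G" "h = conj_map g" by (auto simp: Inn_def)
  have xa: "x \<in> auto G" using x by (simp add: carrier_AutoGroup)
  have ixa: "inv\<^bsub>AutoGroup G\<^esub> x \<in> auto G"
    using group.inv_closed[OF AutoGroup x] by (simp add: carrier_AutoGroup)
  have xha: "x \<otimes>\<^bsub>AutoGroup G\<^esub> h \<in> auto G"
    using monoid.m_closed[OF group.is_monoid[OF AutoGroup], of x h] x g conj_map_auto
    by (simp add: carrier_AutoGroup)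
  have "(x \<otimes>\<^bsub>AutoGroup G\<^esub> h \<otimes>\<^bsub>AutoGroup G\<^esub> inv\<^bsub>AutoGroup G\<^esub> x) y = conj_map (x g) y" for y
  proof (cases "y \<in> carrier G")
    case True
    have z: "(inv\<^bsub>AutoGroup G\<^esub> x) y \<in> carrier G" using auto_closed[OF ixa True] .
    have "(x \<otimes>\<^bsub>AutoGroup G\<^esub> h \<otimes>\<^bsub>AutoGroup G\<^esub> inv\<^bsub>AutoGroup G\<^esub> x) y
        = x (g \<otimes> (inv\<^bsub>AutoGroup G\<^esub> x) y \<otimes> inv g)"
      using auto_mult[OF xha ixa] auto_mult[OF xa conj_map_auto[OF g(1)]] g True z
      by (simp add: compose_def)
    also have "\<dots> = x g \<otimes> y \<otimes> inv (x g)"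
      using xa g z True by (simp add: auto_hom_mult auto_hom_inv auto_inv_cancel(1))
    finally show ?thesis using True by simp
  qed (use auto_mult[OF xha ixa] in \<open>simp add: compose_def\<close>)
  then have "x \<otimes>\<^bsub>AutoGroup G\<^esub> h \<otimes>\<^bsub>AutoGroup G\<^esub> inv\<^bsub>AutoGroup G\<^esub> x = conj_map (x g)" by (rule ext)
  then show "x \<otimes>\<^bsub>AutoGroup G\<^esub> h \<otimes>\<^bsub>AutoGroup G\<^esub> inv\<^bsub>AutoGroup G\<^esub> x \<in> Inn G"
    using mem[OF auto_closed[OF xa g(1)]] by (simp only:)
qed

text \<open>Reduces statements about a coset to one automorphism \<open>f\<close> and its inverse;
  whatever is invariant under conjugation does not see the choice of \<open>f\<close>.\<close>

lemma Out_elem: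
  assumes "\<phi> \<in> carrier (Out G)" "f \<in> \<phi>"
  shows "f \<in> auto G"
    and "\<And>f'. f' \<in> \<phi> \<Longrightarrow> \<exists>g\<in>carrier G. \<forall>x\<in>carrier G. f' x = g \<otimes> f x \<otimes> inv g"
    and "inv\<^bsub>AutoGroup G\<^esub> f \<in> inv\<^bsub>Out G\<^esub> \<phi>"
    and "inv\<^bsub>Out G\<^esub> \<phi> \<in> carrier (Out G)"
proof -
  interpret A: group "AutoGroup G" by (rule AutoGroup)
  interpret N: normal "Inn G" "AutoGroup G" by (rule normal_Inn)
  from assms(1) obtain a where a: "a \<in> auto G" "\<phi> = Inn G #>\<^bsub>AutoGroup G\<^esub> a"
    by (auto simp: Out_def carrier_FactGroup carrier_AutoGroup)
  from assms(2) a obtain h where h: "h \<in> Inn G" "f = h \<otimes>\<^bsub>AutoGroup G\<^esub> a"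
    by (auto simp: r_coset_def)
  have aA: "a \<in> carrier (AutoGroup G)" using a by (simp add: carrier_AutoGroup)
  have fA: "f \<in> carrier (AutoGroup G)" using h aA N.subset by auto
  then show f: "f \<in> auto G" by (simp add: carrier_AutoGroup)
  have \<phi>: "\<phi> = Inn G #>\<^bsub>AutoGroup G\<^esub> f"
    using A.repr_independence[of f "Inn G" a] assms(2) a aA N.is_subgroup by simp
  show "\<exists>g\<in>carrier G. \<forall>x\<in>carrier G. f' x = g \<otimes> f x \<otimes> inv g" if "f' \<in> \<phi>" for f'
  proof -
    from that \<phi> obtain h' where h': "h' \<in> Inn G" "f' = h' \<otimes>\<^bsub>AutoGroup G\<^esub> f"
      by (auto simp: r_coset_def)
    then obtain g where g: "g \<in> carrier G" "h' = conj_map g" by (auto simp: Inn_def)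
    have "f' x = g \<otimes> f x \<otimes> inv g" if "x \<in> carrier G" for x
      using h' g f that auto_closed[OF f that] by (simp add: auto_mult conj_map_auto compose_def)
    then show ?thesis using g by blast
  qed
  have "inv\<^bsub>Out G\<^esub> \<phi> = set_inv\<^bsub>AutoGroup G\<^esub> \<phi>"
    unfolding Out_def using assms(1) by (intro N.inv_FactGroup) (simp add: Out_def)
  then show "inv\<^bsub>AutoGroup G\<^esub> f \<in> inv\<^bsub>Out G\<^esub> \<phi>"
    using assms(2) by (auto simp: SET_INV_def)
  show "inv\<^bsub>Out G\<^esub> \<phi> \<in> carrier (Out G)"
    using group.inv_closed[OF N.factorgroup_is_group, of \<phi>] assms(1) by (simp add: Out_def)
qed

end


section \<open>Cyclic length as growth\<close>

text \<open>Rotation is conjugation by the prefix that moves to the end. The rotated word is reduced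
  because it is a factor of the reduced word \<open>w @ w\<close>.\<close>

lemma rotate_words:
  assumes "cyclically_reduced k w"
  shows "rotate n w \<in> words k"
    and "\<exists>h\<in>words k. rotate n w = reduce (word_inv h @ w @ h)"
proof -
  define m where "m = n mod length w"
  have w: "w \<in> words k" and lh: "w \<noteq> [] \<Longrightarrow> last w \<noteq> inv_letter (hd w)"
    using assms by (auto simp: cyclically_reduced_def)
  have rot: "rotate n w = drop m w @ take m w" by (simp add: m_def rotate_drop_take)
  have "concat (replicate 2 w) \<in> words k" using w lh by (rule concat_replicate_words)
  then have "w @ w \<in> words k" by (simp add: numeral_2_eq_2)
  moreover have "take m w @ (drop m w @ take m w) @ drop m w = w @ w"
    by (metis append.assoc append_take_drop_id)
  ultimately have "take m w @ (drop m w @ take m w) @ drop m w \<in> words k" by (simp only:)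
  then show rw: "rotate n w \<in> words k" unfolding rot using words_appendD by blast
  have "reduce (word_inv (take m w) @ w @ take m w)
      = reduce (word_inv (take m w) @ take m w @ drop m w @ take m w)"
    by (metis append.assoc append_take_drop_id)
  also have "\<dots> = rotate n w" using rw rot by (simp add: reduced_if_words)
  finally have "rotate n w = reduce (word_inv (take m w) @ w @ take m w)" ..
  moreover have "take m w \<in> words k" using w by (metis append_take_drop_id words_appendD(1))
  ultimately show "\<exists>h\<in>words k. rotate n w = reduce (word_inv h @ w @ h)" by blast
qed

definition rotations :: "word \<Rightarrow> word set" where
  "rotations w = {rotate n w | n. True}"

lemma rotations_self: "w \<in> rotations w"
  unfolding rotations_def by (metis (mono_tags, lifting) mem_Collect_eq rotate0 id_apply)

lemma cyclic_length_rotations: "cyclic_length (rotations w) = length w"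
  unfolding cyclic_length_def
proof (rule the_equality)
  fix n assume "\<forall>u\<in>rotations w. length u = n"
  from bspec[OF this rotations_self] show "n = length w" by simp
qed (auto simp: rotations_def)

lemma conjugate_free_group:
  "conjugate (free_group k) u v \<longleftrightarrow>
    u \<in> words k \<and> (\<exists>g\<in>words k. v = reduce (g @ u @ word_inv g))"
  by (auto simp: conjugate_def inv_free_group)

definition growth :: "word \<Rightarrow> real" where
  "growth w = (THE l. grows w l)"

lemma growth_eq: "grows w l \<Longrightarrow> growth w = l"
  unfolding growth_def using grows_unique by blast

lemma auto_free_group:
  assumes "f \<in> auto (free_group k)"
  shows "w \<in> words k \<Longrightarrow> f w \<in> words k"
    and "u \<in> words k \<Longrightarrow> v \<in> words k \<Longrightarrow> f (reduce (u @ v)) = reduce (f u @ f v)"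
    and "w \<in> words k \<Longrightarrow> f (word_inv w) = word_inv (f w)"
    and "f [] = []"
proof -
  interpret group "free_group k" by (rule group_free_group)
  show *: "w \<in> words k \<Longrightarrow> f w \<in> words k" for w using auto_closed[OF assms] .
  show "u \<in> words k \<Longrightarrow> v \<in> words k \<Longrightarrow> f (reduce (u @ v)) = reduce (f u @ f v)"
    using auto_hom_mult[OF assms, of u v] by simp
  show "w \<in> words k \<Longrightarrow> f (word_inv w) = word_inv (f w)"
    using auto_hom_inv[OF assms, of w] * by (simp add: inv_free_group)
  have "group_hom (free_group k) (free_group k) f"
    using assms by (auto simp: group_hom_def group_hom_axioms_def auto_def is_group)
  then show "f [] = []" using group_hom.hom_one by fastforce
qed

text \<open>Whichever representative, rotation and conjugating element produce a member of the
  image, it is conjugate to \<open>f w\<close>, so its length is the growth of \<open>f w\<close>.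
  Uniqueness of growth makes the description in \<open>cyclic_length\<close> well defined, and a
  cyclically reduced conjugate of \<open>f w\<close> shows that the image is not empty.\<close>

lemma cyclic_length_out_act:
  assumes \<phi>: "\<phi> \<in> carrier (Out (free_group k))" "f \<in> \<phi>" and w: "cyclically_reduced k w"
  shows "real (cyclic_length (out_act k \<phi> (rotations w))) = growth (f w)"
    and "grows (f w) (growth (f w))"
proof -
  interpret group "free_group k" by (rule group_free_group)
  note f = Out_elem(1)[OF \<phi>]
  have ww: "w \<in> words k" using w by (simp add: cyclically_reduced_def)
  have fw: "f w \<in> words k" using auto_free_group(1)[OF f ww] .
  have len: "grows (f w) (length v)" if v: "v \<in> out_act k \<phi> (rotations w)" for v
  proof -
    from v obtain f' n g where v': "cyclically_reduced k v" "f' \<in> \<phi>" "g \<in> words k"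
      "v = reduce (g @ f' (rotate n w) @ word_inv g)"
      by (auto simp: out_act_def conjugate_free_group rotations_def)
    obtain g' where g': "g' \<in> words k" "\<forall>x\<in>words k. f' x = reduce (g' @ f x @ word_inv g')"
      using Out_elem(2)[OF \<phi> v'(2)] by (auto simp: inv_free_group)
    obtain h where h: "h \<in> words k" "rotate n w = reduce (word_inv h @ w @ h)"
      using rotate_words(2)[OF w] by blast
    have "f (rotate n w) = reduce (word_inv (f h) @ reduce (f w @ f h))"
      unfolding h(2) using auto_free_group[OF f] h(1) ww
        auto_free_group(2)[OF f, of "word_inv h" "reduce (w @ h)"]
      by (simp add: word_inv_words reduce_append_words)
    then have fr: "f (rotate n w) = reduce (word_inv (f h) @ f w @ word_inv (word_inv (f h)))"
      by simp
    have red: "reduced (f' (rotate n w))" "reduced (f (rotate n w))" "reduced (f w)"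
      using fr fw g' rotate_words(1)[OF w, of n] by (auto simp: reduced_if_words)
    have "grows v (length v)" using v'(1) by (rule grows_cyclically_reduced)
    then have "grows (f' (rotate n w)) (length v)"
      using red v'(4) by (simp only: grows_conj_iff)
    then have "grows (f (rotate n w)) (length v)"
      using red rotate_words(1)[OF w, of n] g'(2) by (simp only: grows_conj_iff)
    then show ?thesis using red unfolding fr by (simp only: grows_conj_iff)
  qed
  obtain v g where v: "cyclically_reduced k v" "g \<in> words k" "v = reduce (g @ f w @ word_inv g)"
    using conjugate_cyclically_reduced_ex[OF fw] by blast
  then have "conjugate (free_group k) (f w) v" using fw by (auto simp: conjugate_free_group)
  then have mem: "v \<in> out_act k \<phi> (rotations w)"
    using \<phi>(2) v(1) rotations_self[of w] unfolding out_act_def by blast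
  have "length u = length v" if "u \<in> out_act k \<phi> (rotations w)" for u
    using grows_unique[OF len[OF that] len[OF mem]] by simp
  then have "cyclic_length (out_act k \<phi> (rotations w)) = length v"
    unfolding cyclic_length_def using mem by - (rule the_equality; metis)
  moreover have "growth (f w) = length v" using len[OF mem] by (rule growth_eq)
  ultimately show "real (cyclic_length (out_act k \<phi> (rotations w))) = growth (f w)"
    "grows (f w) (growth (f w))" using len[OF mem] by auto
qed

lemma nontrivial_cyclic_words_eq:
  "nontrivial_cyclic_words k = rotations ` {w. cyclically_reduced k w \<and> w \<noteq> []}"
proof -
  have "rotations w = {[]} \<longleftrightarrow> w = []" for w :: word
    using rotations_self[of w] by (auto simp: rotations_def)
  moreover have "cyclic_words k = rotations ` {w. cyclically_reduced k w}"
    unfolding cyclic_words_def rotations_def by (rule setcompr_eq_image)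
  ultimately show ?thesis by (auto simp: nontrivial_cyclic_words_def)
qed

lemma lambda0_eq:
  assumes \<phi>: "\<phi> \<in> carrier (Out (free_group k))" "f \<in> \<phi>"
    and g: "g \<in> inv\<^bsub>Out (free_group k)\<^esub> \<phi>"
  shows "lambda0 k \<phi> = (INF w\<in>{w. cyclically_reduced k w \<and> w \<noteq> []}.
      max (growth (f w)) (growth (g w)) / real (length w))"
proof -
  interpret group "free_group k" by (rule group_free_group)
  note i = Out_elem(4)[OF \<phi>]
  show ?thesis
    unfolding lambda0_def nontrivial_cyclic_words_eq image_image
    by (intro arg_cong[where f = Inf] image_cong refl)
      (simp add: cyclic_length_out_act(1)[OF \<phi>] cyclic_length_out_act(1)[OF i g]
        cyclic_length_rotations max_divide_distrib_right)
qed

lemma cyclically_reduced_ex: "k \<ge> 1 \<Longrightarrow> cyclically_reduced k [(0, False)]"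
  by (simp add: cyclically_reduced_def words_def reduced_def)

lemma strictly_hyperbolic_iff:
  assumes k: "k \<ge> 1" and \<phi>: "\<phi> \<in> carrier (Out (free_group k))"
  shows "strictly_hyperbolic k \<phi> \<longleftrightarrow> lambda0 k \<phi> > 1"
proof -
  define m where "m c = max (real (cyclic_length (out_act k \<phi> c)))
    (real (cyclic_length (out_act k (inv\<^bsub>Out (free_group k)\<^esub> \<phi>) c)))" for c
  have m0: "m c \<ge> 0" for c by (simp add: m_def)
  have l: "lambda0 k \<phi> = (INF c\<in>nontrivial_cyclic_words k. m c / real (cyclic_length c))"
    unfolding lambda0_def m_def by (simp add: max_divide_distrib_right)
  have pos: "cyclic_length c > 0" if "c \<in> nontrivial_cyclic_words k" for c
    using that by (auto simp: nontrivial_cyclic_words_eq cyclic_length_rotations)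
  have ne: "nontrivial_cyclic_words k \<noteq> {}"
    using cyclically_reduced_ex[OF k] by (auto simp: nontrivial_cyclic_words_eq)
  have sh: "strictly_hyperbolic k \<phi> \<longleftrightarrow>
      (\<exists>l>1. \<forall>c\<in>cyclic_words k. l * real (cyclic_length c) \<le> m c)"
    by (simp add: strictly_hyperbolic_def m_def)
  show ?thesis
  proof
    assume "strictly_hyperbolic k \<phi>"
    then obtain b where b: "b > 1" "\<And>c. c \<in> cyclic_words k \<Longrightarrow> b * real (cyclic_length c) \<le> m c"
      using sh by auto
    have "b \<le> lambda0 k \<phi>"
      unfolding l using ne b(2) pos
      by (intro cINF_greatest) (auto simp: pos_le_divide_eq nontrivial_cyclic_words_def)
    with b(1) show "lambda0 k \<phi> > 1" by simp
  next
    assume gt: "lambda0 k \<phi> > 1"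
    \<comment> \<open>The infimum itself serves as the constant. The trivial cyclic word lies
      outside the infimum and is treated apart; its length is 0.\<close>
    have "lambda0 k \<phi> * real (cyclic_length c) \<le> m c" if c: "c \<in> cyclic_words k" for c
    proof (cases "c = {[]}")
      case True
      have "cyclic_length {[] :: letter list} = 0"
        by (simp add: cyclic_length_def)
      then show ?thesis using True m0 by simp
    next
      case False
      then have c': "c \<in> nontrivial_cyclic_words k" using c by (simp add: nontrivial_cyclic_words_def)
      have "lambda0 k \<phi> \<le> m c / real (cyclic_length c)"
        unfolding l using m0 c' by (intro cINF_lower bdd_belowI[of _ 0]) auto
      then show ?thesis using pos[OF c'] by (simp add: pos_le_divide_eq)
    qed
    with gt sh show "strictly_hyperbolic k \<phi>" by auto
  qed
qed

section \<open>Locality of the length of images\<close>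

text \<open>The two maps play symmetric roles; through \<open>swapped\<close>, each statement about
  \<open>f\<close> also holds for \<open>g\<close>.\<close>

locale aut_pair =
  fixes k M :: nat and f g :: "word \<Rightarrow> word"
  assumes f_words: "w \<in> words k \<Longrightarrow> f w \<in> words k"
    and g_words: "w \<in> words k \<Longrightarrow> g w \<in> words k"
    and f_mult: "u \<in> words k \<Longrightarrow> v \<in> words k \<Longrightarrow> f (reduce (u @ v)) = reduce (f u @ f v)"
    and g_mult: "u \<in> words k \<Longrightarrow> v \<in> words k \<Longrightarrow> g (reduce (u @ v)) = reduce (g u @ g v)"
    and g_f: "w \<in> words k \<Longrightarrow> g (f w) = w"
    and f_g: "w \<in> words k \<Longrightarrow> f (g w) = w"
    and f_letter: "fst x < k \<Longrightarrow> length (f [x]) \<le> M"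
    and g_letter: "fst x < k \<Longrightarrow> length (g [x]) \<le> M"
begin

lemma swapped: "aut_pair k M g f"
  by unfold_locales (fact f_words g_words f_mult g_mult g_f f_g f_letter g_letter)+

lemma f_append: "u @ v \<in> words k \<Longrightarrow> f (u @ v) = reduce (f u @ f v)"
  using f_mult[of u v] words_appendD[of u v] by (simp add: reduced_if_words)

lemma f_Nil: "f [] = []"
proof -
  have "reduce (f [] @ f []) = reduce (f [])"
    using f_append[of "[]" "[]"] f_words[of "[]"] by (simp add: reduced_if_words)
  then have "reduce (word_inv (f []) @ reduce (f [] @ f [])) = reduce (word_inv (f []) @ f [])"
    by simp
  then show ?thesis using f_words[of "[]"] by (simp add: reduced_if_words)
qed

lemma f_Cons: "x # w \<in> words k \<Longrightarrow> f (x # w) = reduce (f [x] @ f w)"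
  using f_append[of "[x]" w] by simp

lemma length_f: "w \<in> words k \<Longrightarrow> length (f w) \<le> M * length w"
proof (induction w)
  case (Cons x w)
  have "length (f (x # w)) \<le> length (f [x]) + length (f w)"
    using f_Cons[OF Cons.prems] length_reduce_le[of "f [x] @ f w"] by simp
  also have "\<dots> \<le> M + M * length w"
    using Cons f_letter[of x] by (intro add_mono) (auto simp: words_Cons_iff)
  finally show ?case by simp
qed (simp add: f_Nil)

lemma length_f_append:
  "u @ v \<in> words k \<Longrightarrow> length (f (u @ v)) \<le> length (f u) + length (f v)"
  using f_append[of u v] length_reduce_le[of "f u @ f v"] by simp

text \<open>Since \<open>g\<close> recovers \<open>w\<close> and expands by a factor of at most
  \<open>M\<close>, the map \<open>f\<close> contracts by at most \<open>M\<close>.\<close>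

lemma length_le_f: "w \<in> words k \<Longrightarrow> length w \<le> M * length (f w)"
  using aut_pair.length_f[OF swapped, of "f w"] by (simp add: f_words g_f)

lemma length_f_suffix: "u @ v \<in> words k \<Longrightarrow> length (f v) \<le> length (f u) + length (f (u @ v))"
proof -
  assume uv: "u @ v \<in> words k"
  then have u: "u \<in> words k" and v: "v \<in> words k" by (auto dest: words_appendD)
  have "f v = reduce (word_inv (f u) @ f (u @ v))"
    using f_append[OF uv] f_words[OF v] by (simp add: reduced_if_words)
  then show ?thesis using length_reduce_le[of "word_inv (f u) @ f (u @ v)"] by simp
qed

text \<open>Once the image is longer than \<open>2 * M\<close>, appending a letter only changes its last
  \<open>M\<close> letters, so its first \<open>M\<close> letters are frozen.\<close>

lemma take_f_append:
  assumes "s @ p \<in> words k" "2 * M * M \<le> length s"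
  shows "take M (f (s @ p)) = take M (f s)"
  using assms(1)
proof (induction p rule: rev_induct)
  case (snoc y p)
  have sp: "s @ p \<in> words k" using snoc.prems words_appendD(1)[of "s @ p" "[y]"] by simp
  have y: "fst y < k" using snoc.prems by (auto simp: words_append_iff words_Cons_iff)
  have *: "take M (f ((s @ p) @ [y])) = take M (f (s @ p))"
  proof (cases "M = 0")
    case False
    have "2 * M * M \<le> M * length (f (s @ p))"
      using length_le_f[OF sp] assms(2) unfolding length_append by linarith
    then have "M * (2 * M) \<le> M * length (f (s @ p))" by (simp only: ac_simps)
    then have len: "2 * M \<le> length (f (s @ p))" using False by simp
    have red: "reduced (take M (f (s @ p)) @ drop M (f (s @ p)))"
      using f_words[OF sp] by (simp add: reduced_if_words)
    have "f ((s @ p) @ [y]) = reduce ((take M (f (s @ p)) @ drop M (f (s @ p))) @ f [y])"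
      using f_append[of "s @ p" "[y]"] snoc.prems by simp
    also have "\<dots> = take M (f (s @ p)) @ reduce (drop M (f (s @ p)) @ f [y])"
      using red f_letter[OF y] len by (intro reduce_append_head) auto
    finally show ?thesis using len by simp
  qed simp
  with snoc.IH[OF sp] show ?case by simp
qed simp

text \<open>The images of \<open>s\<close> and \<open>s @ p\<close> begin with the same
  \<open>M\<close> letters \<open>E\<close>, and \<open>f [x]\<close> is too short to cancel beyond
  \<open>E\<close>. So prepending \<open>x\<close> changes both lengths by the same amount.\<close>

lemma local_Cons:
  assumes "x # s @ p \<in> words k" "2 * M * M \<le> length s"
  shows "length (f (x # s @ p)) + length (f s) = length (f (s @ p)) + length (f (x # s))"
proof (cases "M = 0")
  case True
  \<comment> \<open>For \<open>M = 0\<close> a letter would have an empty image, from which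
    \<open>g\<close> could not recover it.\<close>
  have "[x] \<in> words k" using assms(1) by (simp add: words_Cons_iff)
  then show ?thesis using length_le_f[of "[x]"] True by simp
next
  case False
  have x: "fst x < k" and sp: "s @ p \<in> words k" and s: "s \<in> words k" and xs: "x # s \<in> words k"
    using assms(1) words_appendD[of s p k] words_appendD[of "x # s" p k] by (auto simp: words_Cons_iff)
  define E where "E = take M (f s)"
  have ge: "2 * M \<le> length (f u)" if "u \<in> words k" "2 * M * M \<le> length u" for u
  proof -
    have "2 * M * M \<le> M * length (f u)"
      using length_le_f[OF that(1)] that(2) by linarith
    then have "M * (2 * M) \<le> M * length (f u)" by (simp only: ac_simps)
    then show ?thesis using False by simp
  qed
  have lE: "length (f [x]) \<le> length E"
    using f_letter[OF x] ge[OF s assms(2)] by (simp add: E_def)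
  have fs: "f s = E @ drop M (f s)" by (simp add: E_def)
  have fsp: "f (s @ p) = E @ drop M (f (s @ p))"
    unfolding E_def take_f_append[OF sp assms(2), symmetric] by simp
  have 1: "f (x # s) = foldr push_letter (f [x]) E @ drop M (f s)"
  proof -
    have "f (x # s) = foldr push_letter (f [x]) (f s)"
      using f_Cons[OF xs] f_words[OF s] by (simp add: reduce_append reduced_if_words)
    then show ?thesis using foldr_push_append_tail[OF lE, of "drop M (f s)"] fs by simp
  qed
  have 2: "f (x # s @ p) = foldr push_letter (f [x]) E @ drop M (f (s @ p))"
  proof -
    have "f (x # s @ p) = foldr push_letter (f [x]) (f (s @ p))"
      using f_Cons[OF assms(1)] f_words[OF sp] by (simp add: reduce_append reduced_if_words)
    then show ?thesis using foldr_push_append_tail[OF lE, of "drop M (f (s @ p))"] fsp by simp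
  qed
  have 3: "length (f s) = length E + length (drop M (f s))"
    "length (f (s @ p)) = length E + length (drop M (f (s @ p)))"
    using arg_cong[OF fs, of length] arg_cong[OF fsp, of length] by (simp_all del: length_drop)
  show ?thesis unfolding 1 2 3 by (simp del: length_drop)
qed

lemma local_append:
  assumes "v @ s @ p \<in> words k" "2 * M * M \<le> length s"
  shows "length (f (v @ s @ p)) + length (f s) = length (f (s @ p)) + length (f (v @ s))"
  using assms(1)
proof (induction v)
  case (Cons x v)
  have "v @ s @ p \<in> words k" using Cons.prems by (simp add: words_Cons_iff)
  from Cons.IH[OF this] local_Cons[of x "v @ s" p] Cons.prems assms(2)
  show ?case by simp
qed simp

end


section \<open>Closed walks\<close>

text \<open>A pair \<open>(y, u)\<close> stands for the walk that starts at the vertex \<open>u\<close> of the de Bruijn graph of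
  reduced words of length \<open>L\<close> and reads the letters of \<open>y\<close> from right to left.\<close>

definition closed_walk :: "nat \<Rightarrow> nat \<Rightarrow> word \<Rightarrow> word \<Rightarrow> bool" where
  "closed_walk k L y u \<longleftrightarrow> y \<noteq> [] \<and> length u = L \<and> y @ u \<in> words k \<and> take L (y @ u) = u"

text \<open>The summand \<open>M * length y\<close> keeps the truncated subtraction from truncating.\<close>

definition gain :: "(word \<Rightarrow> word) \<Rightarrow> nat \<Rightarrow> word \<Rightarrow> word \<Rightarrow> nat" where
  "gain f M y u = length (f (y @ u)) + M * length y - length (f u)"

text \<open>Reducedness is decided at the junctions, and both junctions already occur in the
  hypotheses.\<close>

lemma words_overlap:
  assumes "y @ s \<in> words k" "s @ p \<in> words k" "s \<noteq> []"
  shows "y @ s @ p \<in> words k"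
  using assms by (auto simp: words_append_iff)

lemma words_replace_tail:
  assumes "y @ u \<in> words k" "v \<in> words k" "take L u = take L v" "L \<ge> 1" "u \<noteq> []" "v \<noteq> []"
  shows "y @ v \<in> words k"
proof -
  have "hd u = hd v" using assms(3-6) by (cases u; cases v; cases L) auto
  then show ?thesis using assms by (auto simp: words_append_iff)
qed

lemma (in aut_pair) gain_eq:
  assumes "y @ u \<in> words k"
  shows "gain f M y u + length (f u) = length (f (y @ u)) + M * length y"
  using length_f_suffix[OF assms] length_f[of y] words_appendD(1)[OF assms]
  by (simp add: gain_def)

text \<open>Additivity of weights along a walk: after reading \<open>y2\<close> the walk stands at
  \<open>take L (y2 @ u)\<close>, and by \<open>local_append\<close> the letters behind this window
  do not affect what \<open>y1\<close> adds.\<close>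

lemma (in aut_pair) gain_append:
  assumes "y1 @ y2 @ u \<in> words k" "2 * M * M \<le> L" "length u = L"
  shows "gain f M (y1 @ y2) u = gain f M y1 (take L (y2 @ u)) + gain f M y2 u"
proof -
  define s p where "s = take L (y2 @ u)" and "p = drop L (y2 @ u)"
  have sp: "y2 @ u = s @ p" by (simp only: s_def p_def append_take_drop_id)
  have ls: "length s = L" using assms(3) by (simp add: s_def)
  have w: "y1 @ s @ p \<in> words k" using assms(1) by (simp add: sp)
  then have w': "y1 @ s \<in> words k" using words_appendD(1)[of "y1 @ s" p] by simp
  have yu: "y2 @ u \<in> words k" using assms(1) by (rule words_appendD(2))
  have "gain f M (y1 @ y2) u + length (f u) = length (f (y1 @ s @ p)) + M * length (y1 @ y2)"
    using gain_eq[of "y1 @ y2" u] assms(1) by (simp add: sp)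
  moreover have "gain f M y1 s + length (f s) = length (f (y1 @ s)) + M * length y1"
    by (rule gain_eq[OF w'])
  moreover have "gain f M y2 u + length (f u) = length (f (s @ p)) + M * length y2"
    using gain_eq[OF yu] by (simp add: sp)
  moreover have "length (f (y1 @ s @ p)) + length (f s) = length (f (s @ p)) + length (f (y1 @ s))"
    using local_append[OF w] ls assms(2) by simp
  ultimately show ?thesis unfolding s_def[symmetric] by (simp add: algebra_simps)
qed

lemma closed_walk_cyclically_reduced:
  assumes "closed_walk k L y u" "L \<ge> 1"
  shows "cyclically_reduced k y"
proof -
  have *: "y \<noteq> []" "length u = L" "y @ u \<in> words k" "take L (y @ u) = u"
    using assms(1) by (auto simp: closed_walk_def)
  have u: "u \<noteq> []" using *(2) assms(2) by auto
  have "hd u = hd y"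
    using arg_cong[OF *(4), of hd] *(1) assms(2) by (simp add: hd_take)
  moreover have "hd u \<noteq> inv_letter (last y)" using *(1,3) u by (simp add: words_append_iff)
  ultimately have "last y \<noteq> inv_letter (hd y)" by auto
  then show ?thesis using words_appendD(1)[OF *(3)] by (simp add: cyclically_reduced_def)
qed

text \<open>The vertex consists of the first \<open>L\<close> letters of the periodic word
  \<open>y y y ...\<close>, which reproduces itself when \<open>y\<close> is put in front.\<close>

lemma closed_walk_ex:
  assumes "cyclically_reduced k y" "y \<noteq> []"
  shows "\<exists>u. closed_walk k L y u"
proof -
  let ?Y = "concat (replicate L y)"
  have y: "y \<in> words k" "last y \<noteq> inv_letter (hd y)"
    using assms by (auto simp: cyclically_reduced_def)
  have len: "L \<le> length ?Y" using assms(2) by (cases y) (auto simp: length_concat_replicate)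
  have "concat (replicate (Suc L) y) \<in> words k" using y by (intro concat_replicate_words) auto
  then have "(y @ take L ?Y) @ drop L ?Y \<in> words k" by simp
  then have "y @ take L ?Y \<in> words k" by (rule words_appendD(1))
  moreover have "take L (y @ take L ?Y) = take L ?Y"
  proof -
    have "take L (y @ take L ?Y) = take L (y @ ?Y)" by (simp add: min_def)
    also have "\<dots> = take L (?Y @ y)" by (simp add: concat_replicate_snoc)
    also have "\<dots> = take L ?Y" using len by simp
    finally show ?thesis .
  qed
  ultimately have "closed_walk k L y (take L ?Y)"
    using assms(2) len by (simp add: closed_walk_def)
  then show ?thesis ..
qed

text \<open>Each turn prepends \<open>y\<close> to a word that starts with \<open>u\<close>, so the
  length of the image changes by the same \<open>d\<close> every time. Removing the final
  \<open>u\<close> costs at most \<open>length (f u)\<close>. The deviation bound, uniform in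
  \<open>n\<close>, is what the joining of powers needs.\<close>

lemma (in aut_pair) growth_closed_walk:
  assumes cw: "closed_walk k L y u" and L: "2 * M * M \<le> L" "L \<ge> 1"
  shows "growth (f y) = real (gain f M y u) - real (M * length y)"
    and "\<bar>real (length (f (concat (replicate n y)))) - real n * growth (f y)\<bar> \<le> 2 * real (length (f u))"
    and "grows (f y) (growth (f y))"
proof -
  have *: "y \<noteq> []" "length u = L" "y @ u \<in> words k" "take L (y @ u) = u"
    using cw by (auto simp: closed_walk_def)
  have u: "u \<noteq> []" "u \<in> words k" using *(2,3) L(2) by (auto dest: words_appendD)
  define d where "d = real (length (f (y @ u))) - real (length (f u))"
  define Y where "Y n = concat (replicate n y)" for n
  have YS: "Y (Suc n) = y @ Y n" for n by (simp add: Y_def)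
  have main: "Y n @ u \<in> words k \<and> take L (Y n @ u) = u \<and>
      real (length (f (Y n @ u))) = real (length (f u)) + real n * d" for n
  proof (induction n)
    case 0
    then show ?case using u *(2) by (simp add: Y_def)
  next
    case (Suc n)
    define p where "p = drop L (Y n @ u)"
    have p: "Y n @ u = u @ p" using Suc.IH by (metis append_take_drop_id p_def)
    have w: "y @ u @ p \<in> words k"
      using words_overlap[OF *(3) _ u(1), of p] Suc.IH p by simp
    have "take L (Y (Suc n) @ u) = take L ((y @ u) @ p)" by (simp add: YS p)
    also have "\<dots> = take L (y @ u)" using *(2) by simp
    finally have "take L (Y (Suc n) @ u) = u" using *(4) by simp
    moreover have "length (f (y @ u @ p)) + length (f u) = length (f (u @ p)) + length (f (y @ u))"
      using local_append[OF w] *(2) L(1) by simp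
    ultimately show ?case using Suc.IH w
      by (simp add: YS p d_def algebra_simps flip: of_nat_add)
  qed
  have dev: "\<bar>real (length (f (Y n))) - real n * d\<bar> \<le> 2 * real (length (f u))" for n
  proof -
    have w: "Y n @ u \<in> words k" using main[of n] by simp
    have "length (f (Y n @ u)) \<le> length (f (Y n)) + length (f u)"
      using w by (rule length_f_append)
    moreover have "length (f (Y n)) \<le> length (f (Y n @ u)) + length (f u)"
    proof -
      have "f (Y n) = reduce (f (Y n @ u) @ word_inv (f u))"
      proof -
        have "reduce (f (Y n @ u) @ word_inv (f u)) = reduce (f (Y n) @ reduce (f u @ word_inv (f u)))"
          using f_append[OF w] by (simp del: reduce_word_inv_right)
        then show ?thesis using f_words[OF words_appendD(1)[OF w]] by (simp add: reduced_if_words)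
      qed
      then show ?thesis using length_reduce_le[of "f (Y n @ u) @ word_inv (f u)"] by simp
    qed
    ultimately show ?thesis using main[of n] by linarith
  qed
  have pow: "word_pow (f y) n = f (Y n)" for n
  proof (induction n)
    case 0
    then show ?case by (simp add: Y_def f_Nil)
  next
    case (Suc n)
    have "Y (Suc n) \<in> words k" using main[of "Suc n"] words_appendD by blast
    then show ?case using Suc f_append[of y "Y n"] by (simp add: word_pow_Suc YS)
  qed
  have "grows (f y) d"
    by (rule growsI[where C = "2 * real (length (f u))"]) (use dev in \<open>simp add: pow\<close>)
  then have gd: "growth (f y) = d" and "grows (f y) (growth (f y))"
    by (simp_all add: growth_eq)
  then show "grows (f y) (growth (f y))" by simp
  from gd show "growth (f y) = real (gain f M y u) - real (M * length y)"
    using gain_eq[OF *(3)] unfolding d_def by linarith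
  show "\<bar>real (length (f (concat (replicate n y)))) - real n * growth (f y)\<bar> \<le> 2 * real (length (f u))"
    using dev[of n] gd by (simp add: Y_def)
qed

section \<open>Splitting closed walks at a repeated vertex\<close>

lemma card_lists_letters:
  "card {w. set w \<subseteq> {x :: letter. fst x < k} \<and> length w = n} = (2 * k) ^ n"
  and finite_lists_letters: "finite {w. set w \<subseteq> {x :: letter. fst x < k} \<and> length w = n}"
proof -
  have eq: "{x :: letter. fst x < k} = {..<k} \<times> UNIV" by auto
  have "finite {x :: letter. fst x < k}" unfolding eq by simp
  moreover have "card {x :: letter. fst x < k} = 2 * k" unfolding eq by (simp add: card_cartesian_product)
  ultimately show "card {w. set w \<subseteq> {x :: letter. fst x < k} \<and> length w = n} = (2 * k) ^ n"
    "finite {w. set w \<subseteq> {x :: letter. fst x < k} \<and> length w = n}"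
    by (simp_all add: card_lists_length_eq finite_lists_length_eq)
qed

lemma words_subset_lists: "words k \<inter> {w. length w = n} \<subseteq> {w. set w \<subseteq> {x :: letter. fst x < k} \<and> length w = n}"
  by (auto simp: words_def)

text \<open>A closed walk longer than the number of vertices revisits a vertex and splits there.\<close>

lemma closed_walk_split:
  assumes cw: "closed_walk k L y u" and L: "L \<ge> 1" and long: "(2 * k) ^ L < length y"
  obtains y1 y2 y3 s where "y = y1 @ y2 @ y3" "s = take L (y3 @ u)" "s = take L (y2 @ s)"
    "closed_walk k L y2 s" "closed_walk k L (y1 @ y3) u" "y3 \<noteq> []"
proof -
  have *: "y \<noteq> []" "length u = L" "y @ u \<in> words k" "take L (y @ u) = u"
    using cw by (auto simp: closed_walk_def)
  \<comment> \<open>\<open>win i\<close> is the vertex reached when all but the first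
    \<open>i\<close> letters of \<open>y\<close> have been read; reading starts at the right
    end.\<close>
  define win where "win i = take L (drop i y @ u)" for i
  have suf: "drop i y @ u \<in> words k" for i
    using *(3) words_appendD(2)[of "take i y" "drop i y @ u"] by (metis append.assoc append_take_drop_id)
  have win: "win i \<in> words k \<inter> {w. length w = L}" for i
  proof -
    have "win i @ drop L (drop i y @ u) \<in> words k"
      unfolding win_def append_take_drop_id by (rule suf)
    then have "win i \<in> words k" by (rule words_appendD(1))
    moreover have "length (win i) = L" using *(2) by (simp add: win_def)
    ultimately show ?thesis by simp
  qed
  have "win ` {..<length y} \<subseteq> {w. set w \<subseteq> {x :: letter. fst x < k} \<and> length w = L}"
    using win words_subset_lists by blast
  then have "card (win ` {..<length y}) \<le> (2 * k) ^ L"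
    using card_mono[OF finite_lists_letters] by (simp add: card_lists_letters)
  then have "\<not> inj_on win {..<length y}" using long by (auto dest: card_image)
  then obtain i j where ij: "i < length y" "j < length y" "i \<noteq> j" "win i = win j"
    by (auto simp: inj_on_def)
  then obtain i j where ij: "i < j" "j < length y" "win i = win j"
    by (metis nat_neq_iff)
  define y1 y2 y3 where "y1 = take i y" and "y2 = take (j - i) (drop i y)" and "y3 = drop j y"
  have y23: "drop i y = y2 @ y3"
    using ij(1) append_take_drop_id[of "j - i" "drop i y"] by (simp add: y2_def y3_def)
  have y: "y = y1 @ y2 @ y3" using append_take_drop_id[of i y] y23 by (simp add: y1_def)
  \<comment> \<open>Nonempty \<open>y3\<close> makes \<open>y2\<close> shorter than
    \<open>y\<close>, and nonempty \<open>y2\<close> makes \<open>y1 @ y3\<close> shorter; the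
    induction on lengths depends on both.\<close>
  have ne: "y2 \<noteq> []" "y3 \<noteq> []" using ij by (auto simp: y2_def y3_def)
  define s where "s = take L (y3 @ u)"
  have s: "s = win j" by (simp add: s_def win_def y3_def)
  have ls: "length s = L" using *(2) by (simp add: s_def)
  have s2: "s = take L (y2 @ s)"
  proof -
    have "take L (y2 @ s) = take L (y2 @ y3 @ u)" by (simp add: s_def min_def)
    also have "\<dots> = win i" by (simp add: win_def y23)
    finally show ?thesis using ij(3) s by simp
  qed
  have w: "y1 @ y2 @ y3 @ u \<in> words k" using *(3) y by simp
  have w23: "y2 @ y3 @ u \<in> words k" using w by (rule words_appendD(2))
  have "(y2 @ s) @ drop L (y3 @ u) \<in> words k"
    using w23 unfolding s_def by (simp only: append_assoc append_take_drop_id)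
  then have "y2 @ s \<in> words k" by (rule words_appendD(1))
  then have c2: "closed_walk k L y2 s" using ne ls s2 by (simp add: closed_walk_def)
  have pre: "take L (y3 @ u) = take L (y2 @ y3 @ u)" using ij(3) by (simp add: win_def y23 y3_def)
  have "y1 @ y3 @ u \<in> words k"
    using words_replace_tail[OF w words_appendD(2)[OF w23] pre[symmetric] L] ne by simp
  moreover have "take L (y1 @ y3 @ u) = u"
  proof -
    have "take L (y1 @ y3 @ u) = take L (y1 @ take L (y3 @ u))" by (simp add: min_def)
    also have "\<dots> = take L (y1 @ y2 @ y3 @ u)" unfolding pre by (simp add: min_def)
    finally show ?thesis using *(4) y by simp
  qed
  ultimately have "closed_walk k L (y1 @ y3) u" using ne *(2) by (simp add: closed_walk_def)
  with c2 y s2 ne s_def show thesis using that by blast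
qed

text \<open>The loop \<open>y2\<close> returns to \<open>s\<close>, so cutting it out leaves the
  window in front of \<open>y1\<close> unchanged.\<close>

lemma (in aut_pair) gain_split:
  assumes "y = y1 @ y2 @ y3" "s = take L (y3 @ u)" "s = take L (y2 @ s)"
    and "closed_walk k L y u" "closed_walk k L (y1 @ y3) u" "2 * M * M \<le> L"
  shows "gain f M y u = gain f M y2 s + gain f M (y1 @ y3) u"
proof -
  have *: "length u = L" "y1 @ y2 @ y3 @ u \<in> words k" "y1 @ y3 @ u \<in> words k"
    using assms by (auto simp: closed_walk_def)
  have w23: "y2 @ y3 @ u \<in> words k" using *(2) by (rule words_appendD(2))
  have pre: "take L (y2 @ y3 @ u) = s" using assms(2,3) by (simp add: min_def)
  show ?thesis
    using gain_append[of y1 "y2 @ y3" u L] gain_append[of y2 y3 u L] gain_append[of y1 y3 u L]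
      * w23 pre assms by simp
qed

section \<open>The infimum as a minimum over short closed walks\<close>

type_synonym vec = "nat \<times> nat \<times> nat"

definition abs_diff :: "nat \<Rightarrow> nat \<Rightarrow> nat" where
  "abs_diff a b = (a - b) + (b - a)"

text \<open>The multipliers are chosen so that the last two components of the result agree whenever
  the differences of those components have opposite signs.\<close>

definition balance :: "vec \<Rightarrow> vec \<Rightarrow> vec" where
  "balance = (\<lambda>(n, a, b) (n', a', b').
    (abs_diff a' b' * n + abs_diff a b * n',
     abs_diff a' b' * a + abs_diff a b * a',
     abs_diff a' b' * b + abs_diff a b * b'))"

text \<open>The condition on the first component removes the zero vector, which
  \<open>balance\<close> yields when each argument has equal last components.\<close>

definition candidates :: "vec set \<Rightarrow> vec set" where
  "candidates S = {v \<in> S \<union> {balance p q | p q. p \<in> S \<and> q \<in> S}. fst v > 0}"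

definition ratio :: "vec \<Rightarrow> real" where
  "ratio = (\<lambda>(n, a, b). real (max a b) / real n)"

text \<open>Both gains carry the offset \<open>M * length y\<close>, so the ratios of these vectors
  exceed the desired ones by exactly \<open>M\<close>.\<close>

definition walk_vec :: "(word \<Rightarrow> word) \<Rightarrow> (word \<Rightarrow> word) \<Rightarrow> nat \<Rightarrow> word \<Rightarrow> word \<Rightarrow> vec" where
  "walk_vec f g M y u = (length y, gain f M y u, gain g M y u)"

definition closed_vecs :: "nat \<Rightarrow> nat \<Rightarrow> nat \<Rightarrow> (word \<Rightarrow> word) \<Rightarrow> (word \<Rightarrow> word) \<Rightarrow> nat \<Rightarrow> vec set" where
  "closed_vecs k L N f g M =
    {walk_vec f g M y u | y u. closed_walk k L y u \<and> length y \<le> N}"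

lemma abs_diff_real: "real (abs_diff a b) = \<bar>real a - real b\<bar>"
  by (auto simp: abs_diff_def of_nat_diff)

text \<open>Each vector confines the parameter \<open>s\<close> to an interval; intervals that meet pairwise have a
  common point.\<close>

lemma common_weight:
  fixes S :: "(real \<times> real) set"
  assumes fin: "finite S"
    and single: "\<And>a b. (a, b) \<in> S \<Longrightarrow> a \<ge> 0 \<or> b \<ge> 0"
    and pair: "\<And>a b a' b'. (a, b) \<in> S \<Longrightarrow> (a', b') \<in> S \<Longrightarrow> a \<ge> 0 \<Longrightarrow> b < 0 \<Longrightarrow> a' < 0 \<Longrightarrow> b' \<ge> 0
      \<Longrightarrow> b * a' \<le> b' * a"
  obtains s where "0 \<le> s" "s \<le> 1" "\<And>a b. (a, b) \<in> S \<Longrightarrow> 0 \<le> s * a + (1 - s) * b"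
proof -
  \<comment> \<open>A vector with \<open>b < 0\<close> requires \<open>s\<close> to be at least
    \<open>- b / (a - b)\<close>, the zero of \<open>s * a + (1 - s) * b\<close>. The largest of
    these bounds and 0 is chosen.\<close>
  define low where "low = (\<lambda>(a, b). - b / (a - b)) ` {(a, b) \<in> S. b < 0}"
  define s where "s = Max (insert (0 :: real) low)"
  have "finite {(a, b) \<in> S. b < 0}" by (rule finite_subset[OF _ fin]) auto
  then have fl: "finite (insert 0 low)" unfolding low_def by (simp only: finite_insert finite_imageI)
  have s0: "0 \<le> s" using fl by (simp add: s_def)
  have "s \<in> insert 0 low" unfolding s_def using fl by (intro Max_in) auto
  then consider "s = 0" | a b where "(a, b) \<in> S" "b < 0" "s = - b / (a - b)"
    by (auto simp: low_def)
  note cases = this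
  have s1: "s \<le> 1"
  proof (cases rule: cases)
    case (2 a b)
    have "a \<ge> 0" using single[OF 2(1)] 2(2) by simp
    then show ?thesis unfolding 2(3) using 2(2) by (subst divide_le_eq_1_pos) auto
  qed simp
  have "0 \<le> s * a + (1 - s) * b" if ab: "(a, b) \<in> S" for a b
  proof (cases "b < 0")
    case True
    then have a: "a \<ge> 0" using single[OF ab] by simp
    have "- b / (a - b) \<in> low"
      unfolding low_def using ab True by (intro image_eqI[where x = "(a, b)"]) auto
    then have "- b / (a - b) \<le> s" unfolding s_def using fl by (intro Max_ge) auto
    moreover have "a - b > 0" using a True by simp
    ultimately have "- b \<le> s * (a - b)" by (simp only: pos_divide_le_eq)
    then show ?thesis by (simp add: algebra_simps)
  next
    case b: False
    show ?thesis
    proof (cases "a \<ge> 0")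
      case True
      then show ?thesis using b s0 s1 by simp
    next
      case False
      from cases show ?thesis
      proof cases
        case 1
        then show ?thesis using b by simp
      next
        case (2 c d)
        have c: "c \<ge> 0" using single[OF 2(1)] 2(2) by simp
        \<comment> \<open>Here \<open>s\<close> is the lower bound imposed by \<open>(c, d)\<close>;
          the pair condition says that it does not exceed the upper bound \<open>b / (b - a)\<close>
          imposed by \<open>(a, b)\<close>.\<close>
        have "d * a \<le> b * c" using pair[OF 2(1) ab] c 2(2) False b by simp
        then have "0 \<le> (- d * a + c * b) / (c - d)"
          using c 2(2) by (simp add: algebra_simps)
        also have "\<dots> = s * a + c / (c - d) * b"
          unfolding 2(3) by (simp add: diff_divide_distrib)
        also have "c / (c - d) = 1 - s" using c 2(2) by (simp add: 2(3) field_simps)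
        finally show ?thesis .
      qed
    qed
  qed
  with s0 s1 that show thesis by blast
qed

context aut_pair
begin

lemma growth_le_length:
  assumes "cyclically_reduced k w" "w \<noteq> []" "M \<ge> 1"
  shows "growth (f w) \<le> real (length (f w))"
proof -
  obtain u where u: "closed_walk k (2 * M * M) w u" using closed_walk_ex[OF assms(1,2)] by blast
  have "grows (f w) (growth (f w))" using growth_closed_walk(3)[OF u] assms(3) by simp
  moreover have "w \<in> words k" using assms(1) by (simp add: cyclically_reduced_def)
  ultimately show ?thesis using grows_le reduced_if_words[OF f_words] by blast
qed

text \<open>A linear inequality survives addition and so passes from the two parts of a split walk
  to the whole. A maximum has no such additivity, hence the fixed coefficients \<open>c\<close> and
  \<open>d\<close>.\<close>

lemma closed_vecs_bound:
  fixes c d \<mu> :: real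
  assumes M: "M \<ge> 1" and L: "2 * M * M \<le> L" and N: "(2 * k) ^ L \<le> N"
    and short: "\<And>n a b. (n, a, b) \<in> closed_vecs k L N f g M \<Longrightarrow> \<mu> * real n \<le> c * real a + d * real b"
    and cw: "closed_walk k L y u"
  shows "\<mu> * real (length y) \<le> c * real (gain f M y u) + d * real (gain g M y u)"
  using cw
proof (induction "length y" arbitrary: y u rule: less_induct)
  case less
  have L1: "L \<ge> 1" using M L by (metis le_trans mult_le_mono mult_1 one_le_numeral)
  show ?case
  proof (cases "length y \<le> N")
    case True
    then have "walk_vec f g M y u \<in> closed_vecs k L N f g M"
      using less.prems by (auto simp: closed_vecs_def)
    then show ?thesis using short by (simp add: walk_vec_def)
  next
    case False
    then have "(2 * k) ^ L < length y" using N by simp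
    from closed_walk_split[OF less.prems L1 this] obtain y1 y2 y3 s where
      sp: "y = y1 @ y2 @ y3" "s = take L (y3 @ u)" "s = take L (y2 @ s)"
      "closed_walk k L y2 s" "closed_walk k L (y1 @ y3) u" "y3 \<noteq> []" by blast
    have ne: "y2 \<noteq> []" using sp(4) by (simp add: closed_walk_def)
    have f: "gain f M y u = gain f M y2 s + gain f M (y1 @ y3) u"
      using gain_split[OF sp(1-3) less.prems sp(5) L] .
    have g: "gain g M y u = gain g M y2 s + gain g M (y1 @ y3) u"
      using aut_pair.gain_split[OF swapped sp(1-3) less.prems sp(5) L] .
    have "\<mu> * real (length y2) \<le> c * real (gain f M y2 s) + d * real (gain g M y2 s)"
      using less.hyps[of y2 s] sp by (cases y3) auto
    moreover have "\<mu> * real (length (y1 @ y3)) \<le>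
        c * real (gain f M (y1 @ y3) u) + d * real (gain g M (y1 @ y3) u)"
      using less.hyps[of "y1 @ y3" u] sp ne by (cases y2) auto
    ultimately show ?thesis unfolding f g by (simp add: sp(1) algebra_simps)
  qed
qed

text \<open>Convex duality in two coordinates: if no candidate has a ratio below
  \<open>\<mu>\<close>, one weight \<open>s\<close> serves all short closed walks at once. The
  resulting linear bound extends to all closed walks and a convex combination lies below the
  maximum.\<close>

lemma closed_vecs_lower:
  fixes \<mu> :: real
  assumes M: "M \<ge> 1" and L: "2 * M * M \<le> L" and N: "(2 * k) ^ L \<le> N"
    and fin: "finite (closed_vecs k L N f g M)"
    and cand: "\<And>v. v \<in> candidates (closed_vecs k L N f g M) \<Longrightarrow> \<mu> \<le> ratio v"
    and cw: "closed_walk k L y u"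
  shows "\<mu> * real (length y) \<le> max (real (gain f M y u)) (real (gain g M y u))"
proof -
  define S where "S = closed_vecs k L N f g M"
  \<comment> \<open>After subtraction of \<open>\<mu> * n\<close> only signs matter: members of
    \<open>S\<close> give the condition on single vectors, balanced combinations the condition on
    pairs.\<close>
  define T where "T = (\<lambda>(n, a, b). (real a - \<mu> * real n, real b - \<mu> * real n)) ` S"
  have cand': "\<mu> * real n \<le> real (max a b)"
    if "(n, a, b) \<in> S \<or> (\<exists>p\<in>S. \<exists>q\<in>S. (n, a, b) = balance p q)" for n a b
  proof (cases "n = 0")
    case False
    then have "(n, a, b) \<in> candidates S" using that by (auto simp: candidates_def)
    from cand[OF this[unfolded S_def]] False show ?thesis by (simp add: ratio_def pos_le_divide_eq)
  qed simp
  obtain s where s: "0 \<le> s" "s \<le> 1" "\<And>a b. (a, b) \<in> T \<Longrightarrow> 0 \<le> s * a + (1 - s) * b"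
  proof (rule common_weight[of T])
    show "finite T" using fin by (simp add: T_def S_def)
    show "a \<ge> 0 \<or> b \<ge> 0" if "(a, b) \<in> T" for a b
      using that cand' by (fastforce simp: T_def max_def split: if_splits)
    fix a b a' b' assume "(a, b) \<in> T" "(a', b') \<in> T" and sg: "a \<ge> 0" "b < 0" "a' < 0" "b' \<ge> 0"
    then obtain n x y n' x' y' where v: "(n, x, y) \<in> S" "(n', x', y') \<in> S"
      and a: "a = real x - \<mu> * real n" "b = real y - \<mu> * real n"
      and a': "a' = real x' - \<mu> * real n'" "b' = real y' - \<mu> * real n'"
      by (auto simp: T_def)
    have d: "real (abs_diff x' y') = b' - a'" "real (abs_diff x y) = a - b"
      using a a' sg by (auto simp: abs_diff_real)
    obtain m p q where bal: "balance (n, x, y) (n', x', y') = (m, p, q)" by (metis prod_cases3)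
    then have m: "real m = (b' - a') * real n + (a - b) * real n'"
      and p: "real p = (b' - a') * real x + (a - b) * real x'"
      and q: "real q = (b' - a') * real y + (a - b) * real y'"
      by (auto simp: balance_def d simp flip: d)
    \<comment> \<open>The last two components of the combination agree, so the maximum disappears
      and the bound becomes linear.\<close>
    have "real p = real q" unfolding p q a a' by (simp add: algebra_simps)
    moreover have "\<mu> * real m \<le> real (max p q)" using cand'[of m p q] bal v by metis
    ultimately have "\<mu> * real m \<le> real p" by (simp add: max_def split: if_splits)
    then have "0 \<le> (b' - a') * (real x - \<mu> * real n) + (a - b) * (real x' - \<mu> * real n')"
      unfolding m p by (simp add: algebra_simps)
    then show "b * a' \<le> b' * a" unfolding a(1)[symmetric] a'(1)[symmetric]
      by (simp add: algebra_simps)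
  qed (use that in blast)
  have "\<mu> * real n \<le> s * real a + (1 - s) * real b" if "(n, a, b) \<in> closed_vecs k L N f g M" for n a b
  proof -
    have "(real a - \<mu> * real n, real b - \<mu> * real n) \<in> T"
      unfolding T_def S_def using that by (intro image_eqI[where x = "(n, a, b)"]) auto
    from s(3)[OF this] show ?thesis by (simp add: algebra_simps)
  qed
  from closed_vecs_bound[OF M L N this cw]
  have "\<mu> * real (length y) \<le> s * real (gain f M y u) + (1 - s) * real (gain g M y u)" .
  also have "\<dots> \<le> s * max (real (gain f M y u)) (real (gain g M y u))
      + (1 - s) * max (real (gain f M y u)) (real (gain g M y u))"
    using s by (intro add_mono mult_left_mono) auto
  finally show ?thesis by (simp add: algebra_simps)
qed

text \<open>The connecting letters cost at most \<open>M\<close> each, and each power deviates from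
  linear growth by a bounded amount; so the error does not depend on \<open>n1\<close> and
  \<open>n2\<close>.\<close>

lemma length_f_two_powers:
  fixes F1 F2 :: real
  assumes M: "M \<ge> 1" and L: "2 * M * M \<le> L"
    and cw: "closed_walk k L y1 u1" "closed_walk k L y2 u2"
    and W: "W = concat (replicate n1 y1) @ [c] @ concat (replicate n2 y2) @ [d]"
      "cyclically_reduced k W"
  shows "growth (f W) \<le> real n1 * growth (f y1) + real n2 * growth (f y2)
    + (2 * real M + 2 * real (length (f u1)) + 2 * real (length (f u2)))"
proof -
  let ?Y = "concat (replicate n1 y1)" and ?Z = "concat (replicate n2 y2)"
  have L1: "L \<ge> 1" using M L by (metis le_trans mult_le_mono mult_1 one_le_numeral)
  have w: "?Y @ [c] @ ?Z @ [d] \<in> words k" using W by (simp add: cyclically_reduced_def)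
  have w2: "[c] @ ?Z @ [d] \<in> words k" and w3: "?Z @ [d] \<in> words k" and w4: "[d] \<in> words k"
    using words_appendD(2)[OF w] words_appendD(2) by blast+
  have c: "fst c < k" "fst d < k" using w2 w4 by (auto simp: words_Cons_iff)
  have "growth (f W) \<le> real (length (f W))"
    using W M by (intro growth_le_length) auto
  also have "length (f W) \<le> length (f ?Y) + (length (f [c]) + (length (f ?Z) + length (f [d])))"
    unfolding W(1)
    using length_f_append[OF w] length_f_append[OF w2] length_f_append[OF w3] by linarith
  also have "\<dots> \<le> length (f ?Y) + (M + (length (f ?Z) + M))"
    using f_letter c by (intro add_mono) auto
  finally have "growth (f W) \<le> real (length (f ?Y)) + real (length (f ?Z)) + 2 * real M" by simp
  moreover have "\<bar>real (length (f ?Y)) - real n1 * growth (f y1)\<bar> \<le> 2 * real (length (f u1))"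
    "\<bar>real (length (f ?Z)) - real n2 * growth (f y2)\<bar> \<le> 2 * real (length (f u2))"
    using growth_closed_walk(2)[OF cw(1) L L1] growth_closed_walk(2)[OF cw(2) L L1] by blast+
  ultimately show ?thesis by linarith
qed

end

section \<open>Joining powers of two cyclically reduced words\<close>

lemma letter_avoiding_two:
  assumes "k \<ge> 2"
  obtains c :: letter where "fst c < k" "c \<noteq> x" "c \<noteq> z"
proof -
  have "card {x, z} < card {(0 :: nat, False), (0, True), (1, False)}"
    by (cases "x = z") auto
  then have "\<not> {(0, False), (0, True), (1, False)} \<subseteq> {x, z}"
    using card_mono[of "{x, z}"] by (metis finite.emptyI finite.insertI not_less)
  then obtain c where "c \<in> {(0, False), (0, True), (1, False)}" "c \<noteq> x" "c \<noteq> z" by blast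
  then show thesis using that[of c] assms by auto
qed

lemma concat_replicate_ends:
  assumes "y \<noteq> []"
  shows "hd (concat (replicate (Suc n) y)) = hd y" "last (concat (replicate (Suc n) y)) = last y"
proof -
  show "hd (concat (replicate (Suc n) y)) = hd y" using assms by simp
  have "concat (replicate (Suc n) y) = concat (replicate n y) @ y"
    by (simp add: concat_replicate_snoc)
  then show "last (concat (replicate (Suc n) y)) = last y" using assms by simp
qed

text \<open>The letter \<open>c\<close> must not cancel against the end of \<open>y1\<close> or the
  start of \<open>y2\<close>, and \<open>d\<close> not against the end of \<open>y2\<close> or the
  start of \<open>y1\<close>. Each time only two letters are forbidden.\<close>

lemma join_powers:
  assumes k: "k \<ge> 2" and y1: "cyclically_reduced k y1" "y1 \<noteq> []"
    and y2: "cyclically_reduced k y2" "y2 \<noteq> []"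
  obtains c d where "cyclically_reduced k
    (concat (replicate (Suc n1) y1) @ [c] @ concat (replicate (Suc n2) y2) @ [d])"
proof -
  let ?Y = "concat (replicate (Suc n1) y1)" and ?Z = "concat (replicate (Suc n2) y2)"
  obtain c where c: "fst c < k" "c \<noteq> inv_letter (last y1)" "c \<noteq> inv_letter (hd y2)"
    using letter_avoiding_two[OF k] by blast
  obtain d where d: "fst d < k" "d \<noteq> inv_letter (last y2)" "d \<noteq> inv_letter (hd y1)"
    using letter_avoiding_two[OF k] by blast
  have YZ: "?Y \<in> words k" "?Z \<in> words k"
    using y1 y2 concat_replicate_words unfolding cyclically_reduced_def by blast+
  have ne: "?Y \<noteq> []" "?Z \<noteq> []" using y1 y2 by auto
  have hz: "hd y2 \<noteq> inv_letter c" using c(3) by auto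
  have "?Z @ [d] \<in> words k"
    using YZ(2) ne d y2 concat_replicate_ends(2)[OF y2(2), of n2]
    unfolding words_append_iff by (simp add: words_Cons_iff)
  moreover have "hd (?Z @ [d]) \<noteq> inv_letter c"
    using hz ne(2) concat_replicate_ends(1)[OF y2(2), of n2] by (metis hd_append2)
  ultimately have "[c] @ ?Z @ [d] \<in> words k" using c(1) by (simp add: words_Cons_iff)
  then have "?Y @ [c] @ ?Z @ [d] \<in> words k"
    using YZ(1) c(2) concat_replicate_ends(2)[OF y1(2), of n1]
    unfolding words_append_iff[of ?Y] by simp
  moreover have "hd (?Y @ [c] @ ?Z @ [d]) = hd y1"
    using ne(1) concat_replicate_ends(1)[OF y1(2), of n1] by (metis hd_append2)
  moreover have "last (?Y @ [c] @ ?Z @ [d]) = d" by simp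
  ultimately have "cyclically_reduced k (?Y @ [c] @ ?Z @ [d])"
    using d(3) by (simp only: cyclically_reduced_def simp_thms)
  then show thesis by (rule that)
qed

section \<open>The infimum is attained at a candidate\<close>

locale out_pair = aut_pair +
  fixes \<phi> :: "(word \<Rightarrow> word) set"
  assumes k2: "k \<ge> 2" and M1: "M \<ge> 1"
    and Out: "\<phi> \<in> carrier (Out (free_group k))"
    and f_in: "f \<in> \<phi>" and g_in: "g \<in> inv\<^bsub>Out (free_group k)\<^esub> \<phi>"
begin

lemma M_square: "2 * M * M \<ge> 1"
  using M1 by simp

lemma growth_nonneg: "cyclically_reduced k w \<Longrightarrow> growth (f w) \<ge> 0"
  using cyclic_length_out_act(2)[OF Out f_in] grows_nonneg by blast

lemma lambda0_le:
  assumes "cyclically_reduced k w" "w \<noteq> []"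
  shows "lambda0 k \<phi> * real (length w) \<le> max (growth (f w)) (growth (g w))"
proof -
  have "lambda0 k \<phi> \<le> max (growth (f w)) (growth (g w)) / real (length w)"
    unfolding lambda0_eq[OF Out f_in g_in]
    using assms growth_nonneg
    by (intro cINF_lower bdd_belowI[of _ 0]) (auto simp: le_max_iff_disj intro!: divide_nonneg_nonneg)
  then show ?thesis using assms(2) by (simp add: pos_le_divide_eq)
qed

lemma lambda0_nonneg: "lambda0 k \<phi> \<ge> 0"
  unfolding lambda0_eq[OF Out f_in g_in]
  using cyclically_reduced_ex[of k] k2 growth_nonneg
  by (intro cINF_greatest) (auto simp: le_max_iff_disj intro!: divide_nonneg_nonneg)

text \<open>The two walks may lie at different vertices, so their weights cannot simply be added in
  the graph. Joined powers with multiplicities about \<open>m * \<alpha>\<close> and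
  \<open>m * \<beta>\<close> realise \<open>m\<close> times the combination up to an error
  independent of \<open>m\<close>.\<close>

lemma lambda0_le_combination:
  assumes L: "2 * M * M \<le> L" and cw: "closed_walk k L y1 u1" "closed_walk k L y2 u2"
  shows "(lambda0 k \<phi> + real M) * real (\<alpha> * length y1 + \<beta> * length y2)
    \<le> real (max (\<alpha> * gain f M y1 u1 + \<beta> * gain f M y2 u2) (\<alpha> * gain g M y1 u1 + \<beta> * gain g M y2 u2))"
proof -
  have L1: "L \<ge> 1" using M_square L by linarith
  interpret s: aut_pair k M g f by (rule swapped)
  have y1: "cyclically_reduced k y1" "y1 \<noteq> []" and y2: "cyclically_reduced k y2" "y2 \<noteq> []"
    using closed_walk_cyclically_reduced[OF _ L1] cw by (auto simp: closed_walk_def)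
  define F where "F = real \<alpha> * growth (f y1) + real \<beta> * growth (f y2)"
  define G where "G = real \<alpha> * growth (g y1) + real \<beta> * growth (g y2)"
  define n where "n = real (\<alpha> * length y1 + \<beta> * length y2)"
  define Cf where "Cf = growth (f y1) + growth (f y2)
    + (2 * real M + 2 * real (length (f u1)) + 2 * real (length (f u2)))"
  define Cg where "Cg = growth (g y1) + growth (g y2)
    + (2 * real M + 2 * real (length (g u1)) + 2 * real (length (g u2)))"
  have "real m * (lambda0 k \<phi> * n - max F G) \<le> max Cf Cg" for m
  proof -
    \<comment> \<open>One extra copy keeps both powers nonempty even for a zero multiplier; its
      growth is absorbed in \<open>Cf\<close> and \<open>Cg\<close>.\<close>
    obtain c d where W: "cyclically_reduced k
      (concat (replicate (Suc (m * \<alpha>)) y1) @ [c] @ concat (replicate (Suc (m * \<beta>)) y2) @ [d])"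
      (is "cyclically_reduced k ?W")
      using join_powers[OF k2 y1 y2] by blast
    have f: "growth (f ?W) \<le> real m * F + Cf"
      using length_f_two_powers[OF M1 L cw refl W]
      by (simp add: F_def Cf_def algebra_simps)
    have g: "growth (g ?W) \<le> real m * G + Cg"
      using s.length_f_two_powers[OF M1 L cw refl W]
      by (simp add: G_def Cg_def algebra_simps)
    have "real m * n \<le> real (length ?W)"
      unfolding length_append length_concat_replicate n_def
      by (simp add: algebra_simps flip: of_nat_mult of_nat_add)
    then have "lambda0 k \<phi> * (real m * n) \<le> lambda0 k \<phi> * real (length ?W)"
      using lambda0_nonneg by (rule mult_left_mono)
    also have "\<dots> \<le> max (growth (f ?W)) (growth (g ?W))"
      using W by (intro lambda0_le) auto
    also have "\<dots> \<le> max (real m * F + Cf) (real m * G + Cg)" using f g by linarith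
    also have "\<dots> \<le> real m * max F G + max Cf Cg"
      by (intro max.boundedI add_mono mult_left_mono) auto
    finally show ?thesis by (simp add: algebra_simps)
  qed
  then have "lambda0 k \<phi> * n \<le> max F G" using bounded_multiples_imp_zero by fastforce
  moreover have "F = real (\<alpha> * gain f M y1 u1 + \<beta> * gain f M y2 u2) - real M * n"
    unfolding F_def growth_closed_walk(1)[OF cw(1) L L1] growth_closed_walk(1)[OF cw(2) L L1] n_def
    by (simp add: algebra_simps)
  moreover have "G = real (\<alpha> * gain g M y1 u1 + \<beta> * gain g M y2 u2) - real M * n"
    unfolding G_def s.growth_closed_walk(1)[OF cw(1) L L1] s.growth_closed_walk(1)[OF cw(2) L L1] n_def
    by (simp add: algebra_simps)
  ultimately show ?thesis by (simp add: n_def algebra_simps of_nat_max)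
qed

text \<open>A vector of the set itself is the combination with multipliers 1 and 0; a balanced
  vector has the differences as multipliers.\<close>

lemma lambda0_le_candidate:
  assumes L: "2 * M * M \<le> L" and v: "v \<in> candidates (closed_vecs k L N f g M)"
  shows "lambda0 k \<phi> + real M \<le> ratio v"
proof -
  obtain n a b where nab: "v = (n, a, b)" by (metis prod_cases3)
  have n: "n > 0" using v nab by (simp add: candidates_def)
  have "(lambda0 k \<phi> + real M) * real n \<le> real (max a b)"
  proof (cases "v \<in> closed_vecs k L N f g M")
    case True
    then obtain y u where y: "closed_walk k L y u" "v = walk_vec f g M y u"
      by (auto simp: closed_vecs_def)
    from lambda0_le_combination[OF L y(1) y(1), of 1 0] y(2) nab show ?thesis
      by (simp add: walk_vec_def)
  next
    case False
    then obtain y1 u1 y2 u2 where cw: "closed_walk k L y1 u1" "closed_walk k L y2 u2"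
      and bal: "v = balance (walk_vec f g M y1 u1) (walk_vec f g M y2 u2)"
      using v by (auto simp: candidates_def closed_vecs_def)
    from lambda0_le_combination[OF L cw] bal nab show ?thesis
      by (simp add: walk_vec_def balance_def)
  qed
  then show ?thesis using n by (simp add: nab ratio_def pos_le_divide_eq)
qed

text \<open>By \<open>closed_vecs_lower\<close> the least ratio bounds all ratios from below, and by
  \<open>lambda0_le_candidate\<close> no candidate lies below the infimum; the two agree up to the
  offset \<open>M\<close>.\<close>

lemma lambda0_eq_candidate:
  assumes L: "2 * M * M \<le> L" and N: "(2 * k) ^ L \<le> N"
    and fin: "finite (closed_vecs k L N f g M)"
  shows "\<exists>v\<in>candidates (closed_vecs k L N f g M). lambda0 k \<phi> + real M = ratio v"
proof -
  let ?S = "closed_vecs k L N f g M"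
  let ?K = "candidates ?S"
  have L1: "L \<ge> 1" using M_square L by linarith
  have "finite {balance p q | p q. p \<in> ?S \<and> q \<in> ?S}" using fin by (intro finite_image_set2) auto
  with fin have "finite (?S \<union> {balance p q | p q. p \<in> ?S \<and> q \<in> ?S})" by (rule finite_UnI)
  then have finK: "finite ?K" unfolding candidates_def by (rule rev_finite_subset) blast
  \<comment> \<open>A closed walk of one letter is always short enough, so the minimum
    exists.\<close>
  have neK: "?K \<noteq> {}"
  proof -
    have a: "cyclically_reduced k [(0, False)]" using cyclically_reduced_ex k2 by simp
    from closed_walk_ex[OF a] obtain u where "closed_walk k L [(0, False)] u" by blast
    moreover have "1 \<le> N" using N k2 by (metis le_trans one_le_power mult_le_mono one_le_numeral mult_1)
    ultimately have "walk_vec f g M [(0, False)] u \<in> ?S"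
      unfolding closed_vecs_def by (intro CollectI exI[of _ "[(0, False)]"] exI[of _ u]) simp
    then have "walk_vec f g M [(0, False)] u \<in> ?K"
      unfolding candidates_def by (simp add: walk_vec_def)
    then show ?thesis by blast
  qed
  define \<mu> where "\<mu> = Min (ratio ` ?K)"
  have le: "\<mu> \<le> ratio v" if "v \<in> ?K" for v unfolding \<mu>_def using finK that by simp
  have "\<mu> \<in> ratio ` ?K" unfolding \<mu>_def using finK neK by (intro Min_in) auto
  then obtain v where v: "v \<in> ?K" "\<mu> = ratio v" by blast
  have "\<mu> - real M \<le> lambda0 k \<phi>"
    unfolding lambda0_eq[OF Out f_in g_in]
  proof (rule cINF_greatest)
    show "{w. cyclically_reduced k w \<and> w \<noteq> []} \<noteq> {}" using cyclically_reduced_ex[of k] k2 by auto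
    fix w assume "w \<in> {w. cyclically_reduced k w \<and> w \<noteq> []}"
    then have w: "cyclically_reduced k w" "w \<noteq> []" by auto
    then obtain u where cw: "closed_walk k L w u" using closed_walk_ex by blast
    have "\<mu> * real (length w) \<le> max (real (gain f M w u)) (real (gain g M w u))"
      using closed_vecs_lower[OF M1 L N fin le cw] .
    then have "(\<mu> - real M) * real (length w) \<le> max (growth (f w)) (growth (g w))"
      unfolding growth_closed_walk(1)[OF cw L L1] aut_pair.growth_closed_walk(1)[OF swapped cw L L1]
      by (simp add: algebra_simps)
    then show "\<mu> - real M \<le> max (growth (f w)) (growth (g w)) / real (length w)"
      using w(2) by (simp add: pos_le_divide_eq)
  qed
  with lambda0_le_candidate[OF L v(1)] v show ?thesis by (intro bexI[of _ v]) auto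
qed

end

lemma finite_closed_vecs: "finite (closed_vecs k L N f g M)"
proof -
  let ?X = "{x :: letter. fst x < k}"
  have "?X = {..<k} \<times> UNIV" by auto
  then have X: "finite ?X" by simp
  have "closed_vecs k L N f g M \<subseteq> (\<lambda>(y, u). walk_vec f g M y u) `
      ({w. set w \<subseteq> ?X \<and> length w \<le> N} \<times> {w. set w \<subseteq> ?X \<and> length w \<le> L})"
    by (fastforce simp: closed_vecs_def closed_walk_def words_def)
  moreover have "finite {w. set w \<subseteq> ?X \<and> length w \<le> n}" for n
    using X by (rule finite_lists_length_le)
  ultimately show ?thesis by (meson finite_SigmaI finite_imageI finite_subset)
qed

lemma out_pair_inverse:
  assumes "k \<ge> 2" "M \<ge> 1" "\<phi> \<in> carrier (Out (free_group k))" "f \<in> \<phi>"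
    and "\<And>x. fst x < k \<Longrightarrow> length (f [x]) \<le> M"
    and "\<And>x. fst x < k \<Longrightarrow> length ((inv\<^bsub>AutoGroup (free_group k)\<^esub> f) [x]) \<le> M"
  shows "out_pair k M f (inv\<^bsub>AutoGroup (free_group k)\<^esub> f) \<phi>"
proof -
  interpret group "free_group k" by (rule group_free_group)
  note f = Out_elem[OF assms(3,4)]
  have g: "inv\<^bsub>AutoGroup (free_group k)\<^esub> f \<in> auto (free_group k)"
    using Out_elem(1)[OF f(4,3)] .
  have letter: "[x] \<in> words k" if "fst x < k" for x using that by (simp add: words_Cons_iff)
  show ?thesis
    using assms f(3) auto_free_group[OF f(1)] auto_free_group[OF g] auto_inv_cancel[OF f(1)] letter
    by unfold_locales auto
qed

lemma lambda0_rational: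
  assumes k: "k \<ge> 2" and \<phi>: "\<phi> \<in> carrier (Out (free_group k))"
  shows "lambda0 k \<phi> \<in> \<rat>"
proof -
  interpret group "free_group k" by (rule group_free_group)
  interpret N: normal "Inn (free_group k)" "AutoGroup (free_group k)" by (rule normal_Inn)
  obtain f where f: "f \<in> \<phi>"
    using \<phi> N.subgroup_axioms
    by (auto simp: Out_def carrier_FactGroup r_coset_def dest: subgroup.one_closed)
  let ?g = "inv\<^bsub>AutoGroup (free_group k)\<^esub> f"
  let ?X = "{..<k} \<times> (UNIV :: bool set)"
  \<comment> \<open>Any common bound on the images of letters will do; the successor makes it
    positive.\<close>
  define M where "M = Suc (\<Sum>x\<in>?X. length (f [x]) + length (?g [x]))"
  have M: "length (f [x]) + length (?g [x]) \<le> M" if "fst x < k" for x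
  proof -
    have "length (f [x]) + length (?g [x]) \<le> (\<Sum>x\<in>?X. length (f [x]) + length (?g [x]))"
      using that by (intro member_le_sum) (auto simp: mem_Times_iff)
    then show ?thesis by (simp add: M_def)
  qed
  have "out_pair k M f ?g \<phi>"
  proof (rule out_pair_inverse[OF k _ \<phi> f])
    fix x :: letter assume "fst x < k"
    from M[OF this] show "length (f [x]) \<le> M" "length (?g [x]) \<le> M" by simp_all
  qed (simp add: M_def)
  then interpret out_pair k M f ?g \<phi> .
  obtain n a b where "lambda0 k \<phi> + real M = ratio (n, a, b)"
    using lambda0_eq_candidate[OF order_refl order_refl finite_closed_vecs] by (metis prod_cases3)
  then have "lambda0 k \<phi> = real (max a b) / real n - real M" by (simp add: ratio_def)
  then show ?thesis by simp
qed

section \<open>Polynomially bounded computations\<close>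

text \<open>Injectivity lets equality of values be decided by comparing trees, as in
  \<open>feas_eq\<close>.\<close>

class encodable =
  fixes enc :: "'a \<Rightarrow> tree"
  assumes enc_inj: "enc x = enc y \<Longrightarrow> x = y"

lemma enc_eq_iff: "enc x = enc y \<longleftrightarrow> x = y"
  using enc_inj by blast

instantiation bool :: encodable
begin
definition enc_bool_eq: "enc = enc_bool"
instance by standard (auto simp: enc_bool_eq enc_bool_def split: if_splits)
end

lemma enc_nat_eq_iff: "enc_nat m = enc_nat n \<longleftrightarrow> m = n"
  by (induction m arbitrary: n; case_tac n) auto

instantiation nat :: encodable
begin
definition enc_nat_eq: "enc = enc_nat"
instance by standard (simp add: enc_nat_eq enc_nat_eq_iff)
end

instantiation prod :: (encodable, encodable) encodable
begin
definition enc_prod_def: "enc p = Node (enc (fst p)) (enc (snd p))"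
instance by standard (auto simp: enc_prod_def enc_eq_iff prod_eq_iff)
end

lemma enc_list_eq_iff: "enc_list xs = enc_list ys \<longleftrightarrow> xs = ys"
  by (induction xs arbitrary: ys; case_tac ys) auto

instantiation list :: (encodable) encodable
begin
definition enc_list_def: "enc xs = enc_list (map enc xs)"
instance
  by standard (auto simp: enc_list_def enc_list_eq_iff enc_eq_iff dest!: map_injective intro: injI)
end

instantiation nielsen :: encodable
begin
definition enc_nielsen_def: "enc = enc_nielsen"
instance
proof
  fix x y :: nielsen assume "enc x = enc y"
  then show "x = y"
    by (cases x; cases y) (auto simp: enc_nielsen_def enc_nat_eq_iff numeral_2_eq_2)
qed
end

lemma enc_simps [simp]:
  "enc True = Node Leaf Leaf" "enc False = Leaf"
  "enc (0 :: nat) = Leaf" "enc (Suc n) = Node Leaf (enc n)"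
  "enc (a, b) = Node (enc a) (enc b)"
  "enc [] = Leaf" "enc (x # xs) = Node (enc x) (enc xs)"
  by (simp_all add: enc_bool_eq enc_bool_def enc_nat_eq enc_prod_def enc_list_def)

text \<open>Powers of the offset size \<open>sz\<close>, which is at least 2, absorb constants and sums.\<close>

definition sz :: "'a::encodable \<Rightarrow> nat" where
  "sz x = size (enc x) + 2"

lemma sz_ge: "2 \<le> sz x"
  by (simp add: sz_def)

lemma sz_pair: "sz (a, b) \<le> sz a + sz b"
  by (simp add: sz_def)

lemma sz_append: "sz (xs @ ys) \<le> sz xs + sz ys"
  by (induction xs) (auto simp: sz_def)

lemma sz_concat_map: "sz (concat (map f xs)) \<le> 2 + (\<Sum>x\<leftarrow>xs. sz (f x))"
proof (induction xs)
  case (Cons x xs)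
  have "sz (f x @ concat (map f xs)) \<le> sz (f x) + sz (concat (map f xs))" by (rule sz_append)
  with Cons show ?case by simp
qed (simp add: sz_def)

lemma sz_list: "sz xs = 2 + length xs + (\<Sum>x\<leftarrow>xs. size (enc x))"
  by (induction xs) (auto simp: sz_def)

lemma sz_member: "x \<in> set xs \<Longrightarrow> sz x \<le> sz xs"
  using member_le_sum_list[of "size (enc x)" "map (\<lambda>x. size (enc x)) xs"]
  by (auto simp: sz_list sz_def[of x])

lemma length_le_sz: "length xs \<le> sz xs"
  by (simp add: sz_list)

lemma sz_suffix: "sz zs \<le> sz (ys @ zs)"
  by (simp add: sz_list)

lemma sz_nat: "sz (n :: nat) = n + 2"
  by (induction n) (auto simp: sz_def)

lemma sz_bool: "sz (b :: bool) \<le> 3"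
  by (cases b) (auto simp: sz_def)

text \<open>The measure \<open>m\<close> need not be the input size; the final program uses one that
  is doubly exponential in the number of Nielsen automorphisms. A pure power suffices as the bound
  because \<open>m\<close> is at least 2.\<close>

definition poly_bd :: "('a \<Rightarrow> nat) \<Rightarrow> ('a \<Rightarrow> nat) \<Rightarrow> bool" where
  "poly_bd m h \<longleftrightarrow> (\<forall>x. 2 \<le> m x) \<and> (\<exists>c. \<forall>x. h x \<le> m x ^ c)"

lemma poly_bd_mono: "poly_bd m h' \<Longrightarrow> (\<And>x. h x \<le> h' x) \<Longrightarrow> poly_bd m h"
  unfolding poly_bd_def using le_trans by blast

lemma poly_bd_ge: "poly_bd m h \<Longrightarrow> 2 \<le> m x"
  by (simp add: poly_bd_def)

lemma poly_bd_const: "poly_bd m h \<Longrightarrow> poly_bd m (\<lambda>x. c)"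
proof -
  assume m: "poly_bd m h"
  have "c \<le> m x ^ c" for x
  proof -
    have "c \<le> 2 ^ c" by (rule less_imp_le[OF less_exp])
    also have "\<dots> \<le> m x ^ c" using poly_bd_ge[OF m, of x] by (intro power_mono) auto
    finally show ?thesis .
  qed
  with m show ?thesis unfolding poly_bd_def by blast
qed

lemma poly_bd_mult:
  assumes "poly_bd m h" "poly_bd m h'"
  shows "poly_bd m (\<lambda>x. h x * h' x)"
proof -
  obtain c c' where c: "\<And>x. h x \<le> m x ^ c" "\<And>x. h' x \<le> m x ^ c'" using assms by (auto simp: poly_bd_def)
  have "h x * h' x \<le> m x ^ (c + c')" for x
    unfolding power_add using c by (intro mult_le_mono)
  with assms show ?thesis by (auto simp: poly_bd_def)
qed

text \<open>A sum is at most the product of the successors, and a successor costs one more power of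
  \<open>m\<close>.\<close>

lemma poly_bd_add:
  assumes "poly_bd m h" "poly_bd m h'"
  shows "poly_bd m (\<lambda>x. h x + h' x)"
proof (rule poly_bd_mono)
  show "poly_bd m (\<lambda>x. (h x + 1) * (h' x + 1))"
  proof (rule poly_bd_mult)
    have "poly_bd m (\<lambda>x. h x + 1)" if h: "poly_bd m h" for h
    proof -
      obtain c where c: "\<And>x. h x \<le> m x ^ c" using h by (auto simp: poly_bd_def)
      have "h x + 1 \<le> m x ^ Suc c" for x
      proof -
        have "m x ^ c \<ge> 1" using poly_bd_ge[OF h, of x] by simp
        then have "h x + 1 \<le> 2 * m x ^ c" using c[of x] by linarith
        also have "\<dots> \<le> m x * m x ^ c" using poly_bd_ge[OF h, of x] by (intro mult_le_mono) auto
        finally show ?thesis by simp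
      qed
      with h show ?thesis unfolding poly_bd_def by blast
    qed
    with assms show "poly_bd m (\<lambda>x. h x + 1)" "poly_bd m (\<lambda>x. h' x + 1)" by blast+
  qed
qed simp

lemma poly_bd_power: "poly_bd m h \<Longrightarrow> poly_bd m (\<lambda>x. h x ^ c)"
  by (induction c) (auto intro: poly_bd_const poly_bd_mult)

lemma poly_bd_compose:
  assumes "poly_bd m' t" "poly_bd m (\<lambda>x. m' (f x))"
  shows "poly_bd m (\<lambda>x. t (f x))"
proof -
  obtain c where c: "\<And>y. t y \<le> m' y ^ c" using assms(1) by (auto simp: poly_bd_def)
  from poly_bd_power[OF assms(2), of c] show ?thesis by (rule poly_bd_mono) (rule c)
qed

lemma poly_bd_sz: "poly_bd sz sz"
  unfolding poly_bd_def by (auto simp: sz_ge intro: exI[of _ 1])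


subsection \<open>Linking programs\<close>

text \<open>Functions are called by position, so placing a program behind \<open>d\<close> other
  functions requires its calls to be renumbered.\<close>

fun shift_calls :: "nat \<Rightarrow> expr \<Rightarrow> expr" where
  "shift_calls d (Var i) = Var i"
| "shift_calls d Nil_Exp = Nil_Exp"
| "shift_calls d (Cons_Exp a b) = Cons_Exp (shift_calls d a) (shift_calls d b)"
| "shift_calls d (Fst_Exp a) = Fst_Exp (shift_calls d a)"
| "shift_calls d (Snd_Exp a) = Snd_Exp (shift_calls d a)"
| "shift_calls d (If_Leaf a b c) = If_Leaf (shift_calls d a) (shift_calls d b) (shift_calls d c)"
| "shift_calls d (Call f es) = Call (d + f) (map (shift_calls d) es)"

lemma eval_link:
  "eval P env e v n \<Longrightarrow>
    eval (Q @ map (shift_calls (length Q)) P @ R) env (shift_calls (length Q) e) v n"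
  and evals_link: "evals P env es vs n \<Longrightarrow>
    evals (Q @ map (shift_calls (length Q)) P @ R) env (map (shift_calls (length Q)) es) vs n"
proof (induction rule: eval_evals.inducts)
  case (8 f env es vs n v m)
  then show ?case
    using eval_evals.intros(8)[of "length Q + f" "Q @ map (shift_calls (length Q)) P @ R" env
        "map (shift_calls (length Q)) es" vs n v m]
    by (auto simp: nth_append)
qed (auto intro: eval_evals.intros[simplified])

lemma eval_extend: "eval P env e v n \<Longrightarrow> eval (P @ R) env e v n"
  and evals_extend: "evals P env es vs n \<Longrightarrow> evals (P @ R) env es vs n"
proof (induction rule: eval_evals.inducts)
  case (8 f env es vs n v m)
  then show ?case
    using eval_evals.intros(8)[of f "P @ R" env es vs n v m] by (auto simp: nth_append)
qed (auto intro: eval_evals.intros[simplified])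

definition runs :: "program \<Rightarrow> tree list \<Rightarrow> expr \<Rightarrow> tree \<Rightarrow> nat \<Rightarrow> bool" where
  "runs P env e v N \<longleftrightarrow> (\<exists>n\<le>N. eval P env e v n)"

definition impl :: "program \<Rightarrow> expr \<Rightarrow> ('a::encodable \<Rightarrow> 'b::encodable) \<Rightarrow> ('a \<Rightarrow> nat) \<Rightarrow> bool" where
  "impl P e f t \<longleftrightarrow> (\<forall>x. runs P [enc x] e (enc (f x)) (t x))"

lemma implD: "impl P e f t \<Longrightarrow> runs P [enc x] e (enc (f x)) (t x)"
  by (simp add: impl_def)

lemma runs_mono: "runs P env e v N \<Longrightarrow> N \<le> N' \<Longrightarrow> runs P env e v N'"
  unfolding runs_def by (meson le_trans)

lemma runs_extend: "runs P env e v N \<Longrightarrow> runs (P @ R) env e v N"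
  unfolding runs_def using eval_extend by blast

lemma impl_extend: "impl P e f t \<Longrightarrow> impl (P @ R) e f t"
  unfolding impl_def using runs_extend by blast

lemma impl_append: "impl P e f t \<Longrightarrow> \<exists>R e'. impl (Q @ R) e' f t"
proof -
  assume "impl P e f t"
  then have "impl (Q @ map (shift_calls (length Q)) P) (shift_calls (length Q) e) f t"
    unfolding impl_def runs_def using eval_link[of P _ _ _ _ Q "[]"] by auto metis
  then show ?thesis by blast
qed

lemma runs_Var: "i < length env \<Longrightarrow> v = env ! i \<Longrightarrow> runs P env (Var i) v 1"
  unfolding runs_def by (metis eval_evals.intros(1) order_refl)

lemma runs_Nil: "runs P env Nil_Exp Leaf 1"
  unfolding runs_def by (metis eval_evals.intros(2) order_refl)

lemma runs_Cons:
  "runs P env a v n \<Longrightarrow> runs P env b w m \<Longrightarrow> runs P env (Cons_Exp a b) (Node v w) (n + m + 1)"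
  unfolding runs_def by (meson add_le_mono eval_evals.intros(3) order_refl)

lemma runs_Fst: "runs P env a (Node v w) n \<Longrightarrow> runs P env (Fst_Exp a) v (n + 1)"
  unfolding runs_def by (meson add_le_mono eval_evals.intros(4) order_refl)

lemma runs_Snd: "runs P env a (Node v w) n \<Longrightarrow> runs P env (Snd_Exp a) w (n + 1)"
  unfolding runs_def by (meson add_le_mono eval_evals.intros(5) order_refl)

lemma runs_If_Leaf:
  "runs P env a Leaf n \<Longrightarrow> runs P env b v m \<Longrightarrow> runs P env (If_Leaf a b c) v (n + m + 1)"
  unfolding runs_def by (meson add_le_mono eval_evals.intros(6) order_refl)

lemma runs_If_Node:
  "runs P env a (Node u w) n \<Longrightarrow> runs P env c v m \<Longrightarrow> runs P env (If_Leaf a b c) v (n + m + 1)"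
  unfolding runs_def by (meson add_le_mono eval_evals.intros(7) order_refl)

definition runs_list :: "program \<Rightarrow> tree list \<Rightarrow> expr list \<Rightarrow> tree list \<Rightarrow> nat \<Rightarrow> bool" where
  "runs_list P env es vs N \<longleftrightarrow> (\<exists>n\<le>N. evals P env es vs n)"

lemma runs_list_Nil: "runs_list P env [] [] 0"
  unfolding runs_list_def by (metis eval_evals.intros(9) order_refl)

lemma runs_list_Cons:
  "runs P env e v n \<Longrightarrow> runs_list P env es vs m \<Longrightarrow> runs_list P env (e # es) (v # vs) (n + m)"
  unfolding runs_def runs_list_def by (meson add_le_mono eval_evals.intros(10))

lemma runs_Call:
  "f < length P \<Longrightarrow> runs_list P env es vs n \<Longrightarrow> runs P vs (P ! f) v m \<Longrightarrow>
    runs P env (Call f es) v (n + m + 1)"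
  unfolding runs_def runs_list_def by (meson add_le_mono eval_evals.intros(8) order_refl)

lemmas runs_Call1 = runs_Call[OF _ runs_list_Cons[OF _ runs_list_Nil], unfolded add_0_right]
lemmas runs_Call2 =
  runs_Call[OF _ runs_list_Cons[OF _ runs_list_Cons[OF _ runs_list_Nil]], unfolded add_0_right]
lemmas runs_Call3 =
  runs_Call[OF _ runs_list_Cons[OF _ runs_list_Cons[OF _ runs_list_Cons[OF _ runs_list_Nil]]],
    unfolded add_0_right add.assoc[symmetric]]


subsection \<open>Feasible functions\<close>

text \<open>The size of the result is bounded separately because cheap computations can produce
  large trees: consing a value with itself doubles its size at constant cost.\<close>

definition feas :: "('a::encodable \<Rightarrow> nat) \<Rightarrow> ('a \<Rightarrow> 'b::encodable) \<Rightarrow> bool" where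
  "feas m f \<longleftrightarrow> poly_bd m (\<lambda>x. sz (f x)) \<and> (\<exists>P e t. impl P e f t \<and> poly_bd m t)"

abbreviation ptime :: "('a::encodable \<Rightarrow> 'b::encodable) \<Rightarrow> bool" where
  "ptime \<equiv> feas sz"

lemma feasI: "impl P e f t \<Longrightarrow> poly_bd m (\<lambda>x. sz (f x)) \<Longrightarrow> poly_bd m t \<Longrightarrow> feas m f"
  unfolding feas_def by blast

lemma feas_size: "feas m f \<Longrightarrow> poly_bd m (\<lambda>x. sz (f x))"
  by (simp add: feas_def)

lemma feas_cong: "feas m f \<Longrightarrow> (\<And>x. f x = g x) \<Longrightarrow> feas m g"
  by (metis ext)

lemma feas_join2:
  assumes "feas m f" "feas m' g"
  obtains P e e' t t' where "impl P e f t" "poly_bd m t" "impl P e' g t'" "poly_bd m' t'"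
proof -
  obtain P e t where f: "impl P e f t" "poly_bd m t" using assms(1) unfolding feas_def by blast
  obtain Q e' t' where g: "impl Q e' g t'" "poly_bd m' t'" using assms(2) unfolding feas_def by blast
  obtain R e'' where h: "impl (P @ R) e'' g t'" using impl_append[OF g(1)] by blast
  show thesis by (rule that[OF impl_extend[OF f(1)] f(2) h g(2)])
qed

lemma feas_join3:
  assumes "feas m f" "feas m' g" "feas m'' h"
  obtains P e e' e'' t t' t'' where "impl P e f t" "poly_bd m t" "impl P e' g t'" "poly_bd m' t'"
    "impl P e'' h t''" "poly_bd m'' t''"
proof -
  obtain P e e' t t' where f: "impl P e f t" "poly_bd m t" "impl P e' g t'" "poly_bd m' t'"
    by (rule feas_join2[OF assms(1,2)])
  obtain Q e'' t'' where g: "impl Q e'' h t''" "poly_bd m'' t''" using assms(3) unfolding feas_def by blast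
  obtain R e''' where h: "impl (P @ R) e''' h t''" using impl_append[OF g(1)] by blast
  show thesis
    by (rule that[OF impl_extend[OF f(1)] f(2) impl_extend[OF f(3)] f(4) h g(2)])
qed

lemma feas_id:
  assumes "poly_bd m sz"
  shows "feas m (\<lambda>x. x)"
proof (rule feasI)
  show "impl [] (Var 0) (\<lambda>x :: 'a. x) (\<lambda>x. 1)"
    unfolding impl_def by (intro allI runs_Var) simp_all
qed (rule assms poly_bd_const[OF assms])+

lemma ptime_id: "ptime (\<lambda>x. x)"
  by (rule feas_id[OF poly_bd_sz])

fun quote_tree :: "tree \<Rightarrow> expr" where
  "quote_tree Leaf = Nil_Exp"
| "quote_tree (Node a b) = Cons_Exp (quote_tree a) (quote_tree b)"

lemma runs_quote: "\<exists>n. \<forall>env. runs P env (quote_tree t) t n"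
proof (induction t)
  case Leaf
  then show ?case using runs_Nil by auto
next
  case (Node a b)
  then show ?case using runs_Cons by fastforce
qed

lemma feas_const: "feas m g \<Longrightarrow> feas m (\<lambda>x. c)"
proof -
  assume "feas m g"
  note m = feas_size[OF this]
  obtain n where n: "\<forall>env. runs [] env (quote_tree (enc c)) (enc c) n" using runs_quote by blast
  show ?thesis
    by (rule feasI[where P = "[]" and e = "quote_tree (enc c)" and t = "\<lambda>x. n"])
      (use m n in \<open>auto simp: impl_def intro: poly_bd_const\<close>)
qed

lemma feas_pair:
  assumes "feas m f" "feas m g"
  shows "feas m (\<lambda>x. (f x, g x))"
proof -
  obtain P e e' t t' where i: "impl P e f t" "poly_bd m t" "impl P e' g t'" "poly_bd m t'"
    by (rule feas_join2[OF assms])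
  have "impl P (Cons_Exp e e') (\<lambda>x. (f x, g x)) (\<lambda>x. t x + t' x + 1)"
    unfolding impl_def enc_simps by (intro allI runs_Cons implD[OF i(1)] implD[OF i(3)])
  moreover have "poly_bd m (\<lambda>x. sz (f x, g x))"
    using poly_bd_add[OF assms[THEN feas_size]] by (rule poly_bd_mono) (rule sz_pair)
  ultimately show ?thesis
    using poly_bd_add[OF poly_bd_add[OF i(2,4)] poly_bd_const[OF i(2), of 1]] by (rule feasI)
qed

lemma feas_fst: "feas m f \<Longrightarrow> feas m (\<lambda>x. fst (f x))"
proof -
  assume f: "feas m f"
  then obtain P e t where i: "impl P e f t" "poly_bd m t" unfolding feas_def by blast
  have "runs P [enc x] (Fst_Exp e) (enc (fst (f x))) (t x + 1)" for x
    using implD[OF i(1), of x] unfolding enc_prod_def[of "f x"] by (rule runs_Fst)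
  then have "impl P (Fst_Exp e) (\<lambda>x. fst (f x)) (\<lambda>x. t x + 1)" unfolding impl_def by blast
  moreover have "poly_bd m (\<lambda>x. sz (fst (f x)))"
    using feas_size[OF f] by (rule poly_bd_mono) (simp add: sz_def enc_prod_def)
  ultimately show ?thesis
    using poly_bd_add[OF i(2) poly_bd_const[OF i(2), of 1]] by (rule feasI)
qed

lemma feas_snd: "feas m f \<Longrightarrow> feas m (\<lambda>x. snd (f x))"
proof -
  assume f: "feas m f"
  then obtain P e t where i: "impl P e f t" "poly_bd m t" unfolding feas_def by blast
  have "runs P [enc x] (Snd_Exp e) (enc (snd (f x))) (t x + 1)" for x
    using implD[OF i(1), of x] unfolding enc_prod_def[of "f x"] by (rule runs_Snd)
  then have "impl P (Snd_Exp e) (\<lambda>x. snd (f x)) (\<lambda>x. t x + 1)" unfolding impl_def by blast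
  moreover have "poly_bd m (\<lambda>x. sz (snd (f x)))"
    using feas_size[OF f] by (rule poly_bd_mono) (simp add: sz_def enc_prod_def)
  ultimately show ?thesis
    using poly_bd_add[OF i(2) poly_bd_const[OF i(2), of 1]] by (rule feasI)
qed

lemma feas_if:
  assumes "feas m b" "feas m f" "feas m g"
  shows "feas m (\<lambda>x. if b x then f x else g x)"
proof -
  obtain P e0 e e' t0 t t' where i: "impl P e0 b t0" "poly_bd m t0" "impl P e f t" "poly_bd m t"
      "impl P e' g t'" "poly_bd m t'"
    by (rule feas_join3[OF assms])
  have "runs P [enc x] (If_Leaf e0 e' e) (enc (if b x then f x else g x)) (t0 x + (t x + t' x) + 1)"
    for x
  proof (cases "b x")
    case True
    then have "runs P [enc x] (If_Leaf e0 e' e) (enc (f x)) (t0 x + t x + 1)"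
      using implD[OF i(1), of x] implD[OF i(3), of x] by (intro runs_If_Node) auto
    then show ?thesis using True by (auto intro: runs_mono)
  next
    case False
    then have "runs P [enc x] (If_Leaf e0 e' e) (enc (g x)) (t0 x + t' x + 1)"
      using implD[OF i(1), of x] implD[OF i(5), of x] by (intro runs_If_Leaf) auto
    then show ?thesis using False by (auto intro: runs_mono)
  qed
  then have "impl P (If_Leaf e0 e' e) (\<lambda>x. if b x then f x else g x) (\<lambda>x. t0 x + (t x + t' x) + 1)"
    by (simp add: impl_def)
  moreover have "poly_bd m (\<lambda>x. sz (if b x then f x else g x))"
    using poly_bd_add[OF assms(2,3)[THEN feas_size]] by (rule poly_bd_mono) auto
  ultimately show ?thesis
    using poly_bd_add[OF poly_bd_add[OF i(2) poly_bd_add[OF i(4,6)]] poly_bd_const[OF i(2), of 1]]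
    by (rule feasI)
qed

text \<open>The expression for \<open>g\<close> expects its argument as the only variable. It is
  made a function body, and the call installs the new environment.\<close>

lemma feas_compose_measure:
  assumes "feas m' g" "feas m f" "poly_bd m (\<lambda>x. m' (f x))"
  shows "feas m (\<lambda>x. g (f x))"
proof -
  obtain P e e' t t' where i: "impl P e g t" "poly_bd m' t" "impl P e' f t'" "poly_bd m t'"
    by (rule feas_join2[OF assms(1,2)])
  have "runs (P @ [e]) [enc x] (Call (length P) [e']) (enc (g (f x))) (t' x + t (f x) + 1)" for x
    by (rule runs_Call1) (use implD[OF i(1), of "f x"] implD[OF i(3), of x] in
      \<open>auto intro: runs_extend\<close>)
  then have "impl (P @ [e]) (Call (length P) [e']) (\<lambda>x. g (f x)) (\<lambda>x. t' x + t (f x) + 1)"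
    by (simp add: impl_def)
  moreover have "poly_bd m (\<lambda>x. sz (g (f x)))"
    using poly_bd_compose[OF feas_size[OF assms(1)] assms(3)] .
  moreover have "poly_bd m (\<lambda>x. t' x + t (f x) + 1)"
    using poly_bd_add[OF poly_bd_add[OF i(4) poly_bd_compose[OF i(2) assms(3)]]
        poly_bd_const[OF i(4), of 1]] .
  ultimately show ?thesis by (rule feasI)
qed

lemma feas_compose: "ptime g \<Longrightarrow> feas m f \<Longrightarrow> feas m (\<lambda>x. g (f x))"
  using feas_compose_measure feas_size by blast

lemma feas_compose2:
  "ptime (\<lambda>p. h (fst p) (snd p)) \<Longrightarrow> feas m f \<Longrightarrow> feas m g \<Longrightarrow> feas m (\<lambda>x. h (f x) (g x))"
  using feas_compose[of "\<lambda>p. h (fst p) (snd p)" m "\<lambda>x. (f x, g x)"] feas_pair[of m f g] by simp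

lemma feas_compose3:
  "ptime (\<lambda>p. h (fst p) (fst (snd p)) (snd (snd p))) \<Longrightarrow> feas m f \<Longrightarrow> feas m g \<Longrightarrow> feas m i \<Longrightarrow>
    feas m (\<lambda>x. h (f x) (g x) (i x))"
  using feas_compose[of "\<lambda>p. h (fst p) (fst (snd p)) (snd (snd p))" m "\<lambda>x. (f x, g x, i x)"]
    feas_pair[of m f "\<lambda>x. (g x, i x)"] feas_pair[of m g i] by simp

text \<open>The scheme behind all loops over lists and unary numbers. The intermediate accumulators
  are the folds over suffixes of the list, hence the form of the bounds: \<open>bd\<close> limits
  the sizes of these folds, \<open>bd'\<close> the measure of the argument of each step.\<close>

lemma feas_foldr_measure:
  assumes "feas m (\<lambda>x. x)" "feas m xs" "feas m a"
    and "feas m' (\<lambda>p. h (fst p) (fst (snd p)) (snd (snd p)))"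
    and bd: "poly_bd m bd"
    and le: "\<And>x ys zs. xs x = ys @ zs \<Longrightarrow> sz (foldr (\<lambda>z acc. h z acc x) zs (a x)) \<le> bd x"
    and bd': "poly_bd m bd'"
    and le': "\<And>x ys z zs. xs x = ys @ z # zs \<Longrightarrow>
      m' (z, foldr (\<lambda>z acc. h z acc x) zs (a x), x) \<le> bd' x"
  shows "feas m (\<lambda>x. foldr (\<lambda>z acc. h z acc x) (xs x) (a x))"
proof -
  obtain P e e' e'' t t' t'' where i: "impl P e xs t" "poly_bd m t" "impl P e' a t'" "poly_bd m t'"
      "impl P e'' (\<lambda>p. h (fst p) (fst (snd p)) (snd (snd p))) t''" "poly_bd m' t''"
    by (rule feas_join3[OF assms(2-4)])
  obtain c where c: "\<And>y. t'' y \<le> m' y ^ c" using i(6) unfolding poly_bd_def by blast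
  \<comment> \<open>The parameters are the remaining list, the start value and \<open>x\<close>.
    Function number \<open>length P\<close> is the step, the next one is this loop.\<close>
  define body where "body = If_Leaf (Var 0) (Var 1) (Call (length P) [Cons_Exp (Fst_Exp (Var 0))
    (Cons_Exp (Call (Suc (length P)) [Snd_Exp (Var 0), Var 1, Var 2]) (Var 2))])"
  define Q where "Q = P @ [e'', body]"
  define B where "B x = bd' x ^ c" for x
  have Q: "Q ! length P = e''" "Q ! Suc (length P) = body" "Suc (length P) < length Q"
    "length P < length Q"
    by (auto simp: Q_def nth_append)
  \<comment> \<open>The empty list costs 3; each element adds 13 on top of the cost of the
    step.\<close>
  have loop: "runs Q [enc zs, enc (a x), enc x] body (enc (foldr (\<lambda>z acc. h z acc x) zs (a x)))
      (3 + length zs * (B x + 13))" if "\<exists>ys. xs x = ys @ zs" for x zs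
    using that
  proof (induction zs)
    case Nil
    have "runs Q [enc ([] :: 'b list), enc (a x), enc x] body (enc (a x)) (1 + 1 + 1)"
      unfolding body_def by (rule runs_If_Leaf; rule runs_Var) auto
    then show ?case by (auto intro: runs_mono)
  next
    case (Cons z zs)
    then obtain ys where ys: "xs x = ys @ z # zs" by blast
    then have ys': "xs x = (ys @ [z]) @ zs" by simp
    define acc where "acc = foldr (\<lambda>z acc. h z acc x) zs (a x)"
    define T where "T = 3 + length zs * (B x + 13)"
    let ?env = "[enc (z # zs), enc (a x), enc x]"
    have IH: "runs Q [enc zs, enc (a x), enc x] body (enc acc) T"
      unfolding acc_def T_def using Cons.IH ys' by blast
    have v0: "runs Q ?env (Var 0) (Node (enc z) (enc zs)) 1" by (rule runs_Var) auto
    have v1: "runs Q ?env (Var 1) (enc (a x)) 1" by (rule runs_Var) auto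
    have v2: "runs Q ?env (Var 2) (enc x) 1" by (rule runs_Var) auto
    have rec: "runs Q ?env (Call (Suc (length P)) [Snd_Exp (Var 0), Var 1, Var 2]) (enc acc)
        ((1 + 1) + 1 + 1 + T + 1)"
      by (rule runs_Call3[OF Q(3) runs_Snd[OF v0] v1 v2]) (simp add: Q IH)
    have args: "runs Q ?env (Cons_Exp (Fst_Exp (Var 0))
        (Cons_Exp (Call (Suc (length P)) [Snd_Exp (Var 0), Var 1, Var 2]) (Var 2)))
        (enc (z, acc, x)) ((1 + 1) + (((1 + 1) + 1 + 1 + T + 1) + 1 + 1) + 1)"
      unfolding enc_simps(5) by (rule runs_Cons[OF runs_Fst[OF v0] runs_Cons[OF rec v2]])
    have "runs Q [enc (z, acc, x)] e'' (enc (h z acc x)) (t'' (z, acc, x))"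
      using runs_extend[OF implD[OF i(5), of "(z, acc, x)"], of "[e'', body]"] by (simp add: Q_def)
    then have "runs Q [enc (z, acc, x)] (Q ! length P) (enc (h z acc x)) (t'' (z, acc, x))"
      by (simp add: Q)
    from runs_If_Node[OF v0 runs_Call1[OF Q(4) args this]]
    have *: "runs Q ?env body (enc (h z acc x))
      (1 + ((1 + 1) + (((1 + 1) + 1 + 1 + T + 1) + 1 + 1) + 1 + t'' (z, acc, x) + 1) + 1)"
      by (simp only: body_def)
    have "t'' (z, acc, x) \<le> m' (z, acc, x) ^ c" by (rule c)
    also have "\<dots> \<le> B x" unfolding B_def acc_def by (rule power_mono[OF le'[OF ys]]) simp
    finally have "(1 + ((1 + 1) + (((1 + 1) + 1 + 1 + T + 1) + 1 + 1) + 1 + t'' (z, acc, x) + 1) + 1)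
        \<le> 3 + length (z # zs) * (B x + 13)"
      by (simp add: T_def)
    from runs_mono[OF * this] show ?case by (simp add: acc_def)
  qed
  have "runs Q [enc x] (Call (Suc (length P)) [e, e', Var 0])
      (enc (foldr (\<lambda>z acc. h z acc x) (xs x) (a x)))
      (t x + t' x + 1 + (3 + sz (xs x) * (B x + 13)) + 1)" for x
  proof (rule runs_Call3[OF Q(3)])
    show "runs Q [enc x] e (enc (xs x)) (t x)" "runs Q [enc x] e' (enc (a x)) (t' x)"
      unfolding Q_def using runs_extend implD[OF i(1)] implD[OF i(3)] by blast+
    show "runs Q [enc x] (Var 0) (enc x) 1" by (rule runs_Var) auto
    have "runs Q [enc (xs x), enc (a x), enc x] body (enc (foldr (\<lambda>z acc. h z acc x) (xs x) (a x)))
      (3 + length (xs x) * (B x + 13))" by (rule loop) auto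
    then show "runs Q [enc (xs x), enc (a x), enc x] (Q ! Suc (length P))
        (enc (foldr (\<lambda>z acc. h z acc x) (xs x) (a x))) (3 + sz (xs x) * (B x + 13))"
      unfolding Q by (rule runs_mono) (simp add: length_le_sz)
  qed
  then have "impl Q (Call (Suc (length P)) [e, e', Var 0])
      (\<lambda>x. foldr (\<lambda>z acc. h z acc x) (xs x) (a x))
      (\<lambda>x. t x + t' x + 1 + (3 + sz (xs x) * (B x + 13)) + 1)"
    by (simp add: impl_def)
  moreover have "poly_bd m (\<lambda>x. sz (foldr (\<lambda>z acc. h z acc x) (xs x) (a x)))"
    using bd by (rule poly_bd_mono) (rule le[of _ "[]"], simp)
  moreover have "poly_bd m B"
    unfolding B_def by (rule poly_bd_power[OF bd'])
  then have "poly_bd m (\<lambda>x. t x + t' x + 1 + (3 + sz (xs x) * (B x + 13)) + 1)"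
    by (intro poly_bd_add poly_bd_mult i(2,4) feas_size[OF assms(2)] poly_bd_const[OF i(2)])
  ultimately show ?thesis by (rule feasI)
qed

lemma feas_foldr:
  assumes "feas m (\<lambda>x. x)" "feas m xs" "feas m a"
    and "ptime (\<lambda>p. h (fst p) (fst (snd p)) (snd (snd p)))"
    and "poly_bd m bd"
    and le: "\<And>x ys zs. xs x = ys @ zs \<Longrightarrow> sz (foldr (\<lambda>z acc. h z acc x) zs (a x)) \<le> bd x"
  shows "feas m (\<lambda>x. foldr (\<lambda>z acc. h z acc x) (xs x) (a x))"
proof (rule feas_foldr_measure[OF assms(1-5) le])
  show "poly_bd m (\<lambda>x. sz (xs x) + (bd x + sz x))"
    by (intro poly_bd_add assms(5) feas_size[OF assms(1)] feas_size[OF assms(2)])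
  fix x ys z zs assume ys: "xs x = ys @ z # zs"
  let ?acc = "foldr (\<lambda>z acc. h z acc x) zs (a x)"
  have "sz z \<le> sz (xs x)" by (rule sz_member) (simp add: ys)
  moreover have "sz ?acc \<le> bd x" using ys by (intro le[of x "ys @ [z]"]) simp
  ultimately show "sz (z, ?acc, x) \<le> sz (xs x) + (bd x + sz x)"
    using sz_pair[of z "(?acc, x)"] sz_pair[of ?acc x] by linarith
qed

text \<open>Changing the type costs nothing when the encodings agree, since programs see only
  trees.\<close>

lemma feas_recode: "feas m f \<Longrightarrow> (\<And>x. enc (g x) = enc (f x)) \<Longrightarrow> feas m g"
  by (simp add: feas_def impl_def sz_def)

text \<open>The two trees are descended in parallel, so the cost is linear in the size of the first
  alone.\<close>

lemma feas_eq:
  assumes "feas m f" "feas m g"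
  shows "feas m (\<lambda>x. f x = g x)"
proof -
  obtain P e e' t t' where i: "impl P e f t" "poly_bd m t" "impl P e' g t'" "poly_bd m t'"
    by (rule feas_join2[OF assms])
  define ff tt where "ff = Nil_Exp" and "tt = Cons_Exp Nil_Exp Nil_Exp"
  define body where "body = If_Leaf (Var 0) (If_Leaf (Var 1) tt ff) (If_Leaf (Var 1) ff
    (If_Leaf (Call (length P) [Fst_Exp (Var 0), Fst_Exp (Var 1)]) ff
      (Call (length P) [Snd_Exp (Var 0), Snd_Exp (Var 1)])))"
  define Q where "Q = P @ [body]"
  have Q: "length P < length Q" "Q ! length P = body" by (simp_all add: Q_def)
  have ff: "runs Q env ff (enc False) 1" and tt: "runs Q env tt (enc True) 3" for env
    using runs_Nil[of Q env] runs_Cons[OF runs_Nil[of Q env] runs_Nil[of Q env]]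
    by (simp_all add: ff_def tt_def numeral_3_eq_3)
  have loop: "runs Q [a, b] body (enc (a = b)) (40 * size a + 10)" for a b
  proof (induction a arbitrary: b)
    case Leaf
    have v0: "runs Q [Leaf, b] (Var 0) Leaf 1" by (rule runs_Var) auto
    show ?case
    proof (cases b)
      case Leaf
      have v1: "runs Q [tree.Leaf, tree.Leaf] (Var 1) tree.Leaf 1" by (rule runs_Var) auto
      have eq: "(tree.Leaf = tree.Leaf) = True" by simp
      show ?thesis unfolding body_def Leaf eq
        by (rule runs_mono[OF runs_If_Leaf[OF v0[unfolded Leaf] runs_If_Leaf[OF v1 tt]]]) simp
    next
      case (Node b1 b2)
      have v1: "runs Q [Leaf, Node b1 b2] (Var 1) (Node b1 b2) 1" by (rule runs_Var) auto
      have eq: "(Leaf = Node b1 b2) = False" by simp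
      show ?thesis unfolding body_def Node eq
        by (rule runs_mono[OF runs_If_Leaf[OF v0[unfolded Node] runs_If_Node[OF v1 ff]]]) simp
    qed
  next
    case (Node a1 a2)
    have v0: "runs Q [Node a1 a2, b] (Var 0) (Node a1 a2) 1" by (rule runs_Var) auto
    show ?case
    proof (cases b)
      case Leaf
      have v1: "runs Q [Node a1 a2, Leaf] (Var 1) Leaf 1" by (rule runs_Var) auto
      have eq: "(Node a1 a2 = Leaf) = False" by simp
      show ?thesis unfolding body_def Leaf eq
        by (rule runs_mono[OF runs_If_Node[OF v0[unfolded Leaf] runs_If_Leaf[OF v1 ff]]]) simp
    next
      case b: (Node b1 b2)
      have v1: "runs Q [Node a1 a2, Node b1 b2] (Var 1) (Node b1 b2) 1" by (rule runs_Var) auto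
      note v0 = v0[unfolded b]
      have c1: "runs Q [Node a1 a2, Node b1 b2] (Call (length P) [Fst_Exp (Var 0), Fst_Exp (Var 1)])
          (enc (a1 = b1)) ((1 + 1) + (1 + 1) + (40 * size a1 + 10) + 1)"
        by (rule runs_Call2[OF Q(1) runs_Fst[OF v0] runs_Fst[OF v1]]) (simp add: Q Node.IH)
      have c2: "runs Q [Node a1 a2, Node b1 b2] (Call (length P) [Snd_Exp (Var 0), Snd_Exp (Var 1)])
          (enc (a2 = b2)) ((1 + 1) + (1 + 1) + (40 * size a2 + 10) + 1)"
        by (rule runs_Call2[OF Q(1) runs_Snd[OF v0] runs_Snd[OF v1]]) (simp add: Q Node.IH)
      show ?thesis
      proof (cases "a1 = b1")
        case True
        with c1 have c1: "runs Q [Node a1 a2, Node b1 b2]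
            (Call (length P) [Fst_Exp (Var 0), Fst_Exp (Var 1)]) (Node Leaf Leaf)
            ((1 + 1) + (1 + 1) + (40 * size a1 + 10) + 1)" by simp
        have eq: "(Node a1 a2 = Node b1 b2) = (a2 = b2)" using True by simp
        show ?thesis unfolding body_def b eq
          by (rule runs_mono[OF runs_If_Node[OF v0 runs_If_Node[OF v1 runs_If_Node[OF c1 c2]]]]) simp
      next
        case False
        with c1 have c1: "runs Q [Node a1 a2, Node b1 b2]
            (Call (length P) [Fst_Exp (Var 0), Fst_Exp (Var 1)]) Leaf
            ((1 + 1) + (1 + 1) + (40 * size a1 + 10) + 1)" by simp
        have eq: "(Node a1 a2 = Node b1 b2) = False" using False by simp
        show ?thesis unfolding body_def b eq
          by (rule runs_mono[OF runs_If_Node[OF v0 runs_If_Node[OF v1 runs_If_Leaf[OF c1 ff]]]]) simp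
      qed
    qed
  qed
  have "runs Q [enc x] (Call (length P) [e, e']) (enc (f x = g x))
      (t x + t' x + (40 * sz (f x) + 10) + 1)" for x
  proof (rule runs_Call2[OF Q(1)])
    show "runs Q [enc x] e (enc (f x)) (t x)" "runs Q [enc x] e' (enc (g x)) (t' x)"
      unfolding Q_def using runs_extend implD[OF i(1)] implD[OF i(3)] by blast+
    show "runs Q [enc (f x), enc (g x)] (Q ! length P) (enc (f x = g x)) (40 * sz (f x) + 10)"
      using loop[of "enc (f x)" "enc (g x)"] unfolding Q enc_eq_iff
      by (rule runs_mono) (simp add: sz_def)
  qed
  then have "impl Q (Call (length P) [e, e']) (\<lambda>x. f x = g x)
      (\<lambda>x. t x + t' x + (40 * sz (f x) + 10) + 1)"
    unfolding impl_def by blast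
  moreover have "poly_bd m (\<lambda>x. sz (f x = g x))"
    using poly_bd_const[OF i(2), of 3] by (rule poly_bd_mono) (rule sz_bool)
  moreover have "poly_bd m (\<lambda>x. t x + t' x + (40 * sz (f x) + 10) + 1)"
    by (intro poly_bd_add poly_bd_mult i(2,4) feas_size[OF assms(1)] poly_bd_const[OF i(2)])
  ultimately show ?thesis by (rule feasI)
qed

text \<open>The entry point must be function 0, so the expression is placed in front and the program
  is shifted by one.\<close>

lemma feas_computes:
  assumes "feas m f"
  shows "\<exists>P c. \<forall>x. \<exists>n\<le>m x ^ c. computes P (enc x) (enc (f x)) n"
proof -
  obtain P e t where i: "impl P e f t" "poly_bd m t" using assms unfolding feas_def by blast
  obtain c where c: "\<And>x. t x + 2 \<le> m x ^ c"
    using poly_bd_add[OF i(2) poly_bd_const[OF i(2), of 2]] by (auto simp: poly_bd_def)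
  define Q where "Q = [shift_calls 1 e] @ map (shift_calls 1) P"
  have "\<exists>n\<le>m x ^ c. computes Q (enc x) (enc (f x)) n" for x
  proof -
    obtain n where n: "n \<le> t x" "eval P [enc x] e (enc (f x)) n"
      using implD[OF i(1), of x] by (auto simp: runs_def)
    have "eval Q [enc x] (shift_calls 1 e) (enc (f x)) n"
      using eval_link[OF n(2), of "[shift_calls 1 e]" "[]"] by (simp add: Q_def)
    then have "runs Q [enc x] (Q ! 0) (enc (f x)) n" by (auto simp: runs_def Q_def)
    moreover have "runs Q [enc x] (Var 0) (enc x) 1" by (rule runs_Var) auto
    ultimately have "runs Q [enc x] (Call 0 [Var 0]) (enc (f x)) (1 + n + 1)"
      by (intro runs_Call1) (auto simp: Q_def)
    then have "runs Q [enc x] (Call 0 [Var 0]) (enc (f x)) (m x ^ c)"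
      using c[of x] n(1) by (auto intro: runs_mono)
    then show ?thesis by (auto simp: runs_def computes_def)
  qed
  then show ?thesis by blast
qed

section \<open>Feasible list and word functions\<close>

lemma feas_not: "feas m b \<Longrightarrow> feas m (\<lambda>x. \<not> b x)"
  by (rule feas_cong[OF feas_if[of m b "\<lambda>x. False" "\<lambda>x. True"]]) (auto intro: feas_const)

lemma feas_conj: "feas m b \<Longrightarrow> feas m c \<Longrightarrow> feas m (\<lambda>x. b x \<and> c x)"
  by (rule feas_cong[OF feas_if[of m b c "\<lambda>x. False"]]) (auto intro: feas_const)

lemma feas_Cons: "feas m f \<Longrightarrow> feas m g \<Longrightarrow> feas m (\<lambda>x. f x # g x)"
  by (rule feas_recode[OF feas_pair[of m f g]]) simp_all

lemma feas_Suc: "feas m f \<Longrightarrow> feas m (\<lambda>x. Suc (f x))"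
  by (rule feas_recode[OF feas_pair[OF feas_const[of m f False], of f]]) simp_all

text \<open>A number and a list of that many \<open>False\<close> have the same encoding; counting
  loops thereby become folds.\<close>

lemma feas_unary: "feas m f \<Longrightarrow> feas m (\<lambda>x. replicate (f x) False)"
proof (erule feas_recode)
  have "enc (replicate n False) = enc n" for n by (induction n) auto
  then show "enc (replicate (f x) False) = enc (f x)" for x .
qed

lemma ptime_fst: "ptime fst"
  using feas_fst[OF ptime_id] .

lemma ptime_snd: "ptime snd"
  using feas_snd[OF ptime_id] .

lemmas feas_proj = ptime_id ptime_fst ptime_snd feas_fst feas_snd
lemmas feas_basic = feas_proj feas_pair feas_if feas_eq feas_not feas_conj feas_Cons feas_Suc

lemma ptime_const: "ptime (\<lambda>x. c)"
  using feas_const[OF ptime_id] .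

text \<open>\<open>hd []\<close> is some fixed value of the type, which the program returns as a
  literal.\<close>

lemma ptime_hd: "ptime (hd :: 'a::encodable list \<Rightarrow> 'a)"
proof -
  let ?c = "hd [] :: 'a"
  obtain n where n: "\<forall>env. runs [] env (quote_tree (enc ?c)) (enc ?c) n" using runs_quote by blast
  have "runs [] [enc xs] (If_Leaf (Var 0) (quote_tree (enc ?c)) (Fst_Exp (Var 0))) (enc (hd xs)) (n + 10)"
    for xs :: "'a list"
  proof -
    have v: "runs [] [enc xs] (Var 0) (enc xs) 1" by (rule runs_Var) auto
    show ?thesis
    proof (cases xs)
      case Nil
      then have e: "enc (hd xs) = enc ?c" and v': "runs [] [enc xs] (Var 0) Leaf 1"
        using v by simp_all
      show ?thesis unfolding e by (rule runs_mono[OF runs_If_Leaf[OF v' spec[OF n]]]) simp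
    next
      case (Cons y ys)
      then have e: "enc (hd xs) = enc y" and v': "runs [] [enc xs] (Var 0) (Node (enc y) (enc ys)) 1"
        using v by simp_all
      show ?thesis unfolding e by (rule runs_mono[OF runs_If_Node[OF v' runs_Fst[OF v']]]) simp
    qed
  qed
  then have "impl [] (If_Leaf (Var 0) (quote_tree (enc ?c)) (Fst_Exp (Var 0))) hd (\<lambda>xs :: 'a list. n + 10)"
    unfolding impl_def by blast
  moreover have "poly_bd sz (\<lambda>xs :: 'a list. sz (hd xs))"
  proof (rule poly_bd_mono)
    show "poly_bd sz (\<lambda>xs :: 'a list. sz xs + sz ?c)"
      by (intro poly_bd_add poly_bd_sz poly_bd_const[OF poly_bd_sz])
    show "sz (hd xs) \<le> sz xs + sz ?c" for xs :: "'a list" by (cases xs) (auto simp: sz_def)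
  qed
  ultimately show ?thesis using poly_bd_const[OF poly_bd_sz] by (rule feasI)
qed

lemma ptime_tl: "ptime tl"
proof -
  have "runs [] [enc xs] (If_Leaf (Var 0) Nil_Exp (Snd_Exp (Var 0))) (enc (tl xs)) 10"
    for xs :: "'a list"
  proof -
    have v: "runs [] [enc xs] (Var 0) (enc xs) 1" by (rule runs_Var) auto
    show ?thesis
    proof (cases xs)
      case Nil
      then have e: "enc (tl xs) = Leaf" and v': "runs [] [enc xs] (Var 0) Leaf 1"
        using v by simp_all
      show ?thesis unfolding e by (rule runs_mono[OF runs_If_Leaf[OF v' runs_Nil]]) simp
    next
      case (Cons y ys)
      then have e: "enc (tl xs) = enc ys" and v': "runs [] [enc xs] (Var 0) (Node (enc y) (enc ys)) 1"
        using v by simp_all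
      show ?thesis unfolding e by (rule runs_mono[OF runs_If_Node[OF v' runs_Snd[OF v']]]) simp
    qed
  qed
  then have "impl [] (If_Leaf (Var 0) Nil_Exp (Snd_Exp (Var 0))) tl (\<lambda>xs :: 'a list. 10)"
    unfolding impl_def by blast
  moreover have "poly_bd sz (\<lambda>xs :: 'a list. sz (tl xs))"
  proof (rule poly_bd_mono[OF poly_bd_sz])
    show "sz (tl xs) \<le> sz xs" for xs :: "'a list" by (cases xs) (auto simp: sz_def)
  qed
  ultimately show ?thesis using poly_bd_const[OF poly_bd_sz] by (rule feasI)
qed

lemmas feas_hd = feas_compose[OF ptime_hd]
lemmas feas_tl = feas_compose[OF ptime_tl]

lemma feas_pred: "feas m f \<Longrightarrow> feas m (\<lambda>x. f x - 1 :: nat)"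
proof (rule feas_recode[OF feas_tl[OF feas_unary[of m f]]])
  have "enc (replicate n False) = enc n" for n by (induction n) auto
  moreover have "tl (replicate n False) = replicate (n - 1) False" for n by (cases n) auto
  ultimately show "enc (f x - 1) = enc (tl (replicate (f x) False))" for x by simp
qed

lemma ptime_append: "ptime (\<lambda>p. fst p @ snd p)"
proof -
  have "ptime (\<lambda>p. foldr (\<lambda>(z :: 'a) acc. z # acc) (fst p) (snd p))"
  proof (rule feas_foldr)
    show "ptime (\<lambda>p :: 'a \<times> 'a list \<times> 'a list \<times> 'a list. fst p # fst (snd p))"
      by (intro feas_basic)
    show "poly_bd sz (\<lambda>p. sz (fst p :: 'a list) + sz (snd p :: 'a list))"
      by (intro poly_bd_add feas_size feas_basic)
    fix p :: "'a list \<times> 'a list" and ys zs assume "fst p = ys @ zs"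
    then show "sz (foldr (\<lambda>z acc. z # acc) zs (snd p)) \<le> sz (fst p) + sz (snd p)"
      using sz_append[of zs "snd p"] sz_suffix[of zs ys] by (simp add: foldr_conv_fold fold_Cons_rev)
  qed (intro feas_basic)+
  then show ?thesis by (rule feas_cong) (simp add: foldr_conv_fold fold_Cons_rev)
qed

lemmas feas_append = feas_compose2[OF ptime_append]

lemma foldr_concat_map: "foldr (\<lambda>z acc. f z @ acc) zs [] = concat (map f zs)"
  by (induction zs) auto

lemma sum_list_bound: "(\<And>z. z \<in> set zs \<Longrightarrow> f z \<le> (b :: nat)) \<Longrightarrow> (\<Sum>z\<leftarrow>zs. f z) \<le> length zs * b"
  by (induction zs) (auto intro: add_le_mono)

lemma feas_concat_map_measure:
  assumes "feas m (\<lambda>x. x)" "feas m xs"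
    and b: "feas m' (\<lambda>p. b (fst p) (snd p))"
    and bd: "poly_bd m bd" and le: "\<And>x z. z \<in> set (xs x) \<Longrightarrow> m' (z, x) \<le> bd x"
  shows "feas m (\<lambda>x. concat (map (\<lambda>z. b z x) (xs x)))"
proof -
  obtain c where c: "\<And>p. sz (b (fst p) (snd p)) \<le> m' p ^ c"
    using feas_size[OF b] unfolding poly_bd_def by blast
  have sb: "sz (b z x) \<le> bd x ^ c" if "z \<in> set (xs x)" for z x
    using c[of "(z, x)"] power_mono[OF le[OF that], of c] by simp
  define S where "S x = 2 + sz (xs x) * bd x ^ c" for x
  have S: "poly_bd m S"
    unfolding S_def
    by (intro poly_bd_add poly_bd_mult poly_bd_power bd feas_size[OF assms(2)] poly_bd_const[OF bd])
  have sc: "sz (concat (map (\<lambda>z. b z x) zs)) \<le> S x" if "xs x = ys @ zs" for x ys zs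
  proof -
    have "sz (concat (map (\<lambda>z. b z x) zs)) \<le> 2 + (\<Sum>z\<leftarrow>zs. sz (b z x))" by (rule sz_concat_map)
    also have "(\<Sum>z\<leftarrow>zs. sz (b z x)) \<le> length zs * bd x ^ c"
      using that by (intro sum_list_bound sb) auto
    also have "\<dots> \<le> sz (xs x) * bd x ^ c"
      using length_le_sz[of zs] sz_suffix[of zs ys] that by (intro mult_le_mono1) simp
    finally show ?thesis by (simp add: S_def)
  qed
  \<comment> \<open>The body is feasible relative to \<open>m'\<close>, appending relative to
    \<open>sz\<close>; the sum dominates both.\<close>
  define m2 where "m2 p = m' (fst p, snd (snd p)) + sz p" for p :: "'b \<times> 'c list \<times> 'a"
  have "2 \<le> m2 p" for p using sz_ge[of p] by (simp add: m2_def)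
  then have m2: "poly_bd m2 m2" unfolding poly_bd_def by (auto intro: exI[of _ 1])
  have id: "feas m2 (\<lambda>p. p)"
    by (rule feas_id, rule poly_bd_mono[OF m2]) (simp add: m2_def)
  have "feas m (\<lambda>x. foldr (\<lambda>z acc. b z x @ acc) (xs x) [])"
  proof (rule feas_foldr_measure[OF assms(1,2) feas_const[OF assms(2)]])
    have "feas m2 (\<lambda>p. (fst p, snd (snd p)))" by (intro feas_pair feas_fst feas_snd id)
    moreover have "poly_bd m2 (\<lambda>p. m' (fst p, snd (snd p)))"
      by (rule poly_bd_mono[OF m2]) (simp add: m2_def)
    ultimately have "feas m2 (\<lambda>p. b (fst (fst p, snd (snd p))) (snd (fst p, snd (snd p))))"
      by (rule feas_compose_measure[OF b])
    then show "feas m2 (\<lambda>p. b (fst p) (snd (snd p)) @ fst (snd p))"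
      by (intro feas_append feas_fst feas_snd id) simp
    show "poly_bd m S" by (rule S)
    show "sz (foldr (\<lambda>z acc. b z x @ acc) zs []) \<le> S x" if "xs x = ys @ zs" for x ys zs
      using sc[OF that] by (simp add: foldr_concat_map)
    show "poly_bd m (\<lambda>x. bd x + (sz (xs x) + (S x + sz x)))"
      by (intro poly_bd_add bd S feas_size[OF assms(1)] feas_size[OF assms(2)])
    fix x ys z zs assume ys: "xs x = ys @ z # zs"
    let ?acc = "concat (map (\<lambda>z. b z x) zs)"
    have "m' (z, x) \<le> bd x" using ys by (intro le) simp
    moreover have "sz z \<le> sz (xs x)" by (rule sz_member) (simp add: ys)
    moreover have "sz ?acc \<le> S x" using ys by (intro sc[of x "ys @ [z]"]) simp
    ultimately have "m2 (z, ?acc, x) \<le> bd x + (sz (xs x) + (S x + sz x))"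
      using sz_pair[of z "(?acc, x)"] sz_pair[of ?acc x] by (simp add: m2_def)
    then show "m2 (z, foldr (\<lambda>z acc. b z x @ acc) zs [], x) \<le> bd x + (sz (xs x) + (S x + sz x))"
      by (simp only: foldr_concat_map)
  qed
  then show ?thesis by (rule feas_cong) (simp add: foldr_concat_map)
qed

lemma feas_concat_map:
  assumes "feas m (\<lambda>x. x)" "feas m xs" "ptime (\<lambda>p. b (fst p) (snd p))"
  shows "feas m (\<lambda>x. concat (map (\<lambda>z. b z x) (xs x)))"
proof (rule feas_concat_map_measure[OF assms])
  show "poly_bd m (\<lambda>x. sz (xs x) + sz x)"
    by (intro poly_bd_add feas_size[OF assms(1)] feas_size[OF assms(2)])
  show "sz (z, x) \<le> sz (xs x) + sz x" if "z \<in> set (xs x)" for x z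
    using sz_pair[of z x] sz_member[OF that] by linarith
qed

lemma feas_map:
  assumes "feas m (\<lambda>x. x)" "feas m xs" "ptime (\<lambda>p. b (fst p) (snd p))"
  shows "feas m (\<lambda>x. map (\<lambda>z. b z x) (xs x))"
proof -
  have "feas m (\<lambda>x. concat (map (\<lambda>z. [b z x]) (xs x)))"
    by (intro feas_concat_map assms feas_Cons ptime_const)
  then show ?thesis by (rule feas_cong) (simp add: concat_map_singleton)
qed

lemma feas_filter:
  assumes "feas m (\<lambda>x. x)" "feas m xs" "ptime (\<lambda>p. b (fst p) (snd p))"
  shows "feas m (\<lambda>x. filter (\<lambda>z. b z x) (xs x))"
proof -
  have "feas m (\<lambda>x. concat (map (\<lambda>z. if b z x then [z] else []) (xs x)))"
    by (intro feas_concat_map assms feas_if feas_Cons ptime_const ptime_fst)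
  moreover have "concat (map (\<lambda>z. if P z then [z] else []) ys) = filter P ys" for P and ys :: "'b list"
    by (induction ys) auto
  ultimately show ?thesis by simp
qed

lemma ptime_member: "ptime (\<lambda>p. fst p \<in> set (snd p))"
proof -
  have "ptime (\<lambda>p. foldr (\<lambda>(z :: 'a) acc. if z = fst p then True else acc) (snd p) False)"
  proof (rule feas_foldr)
    show "ptime (\<lambda>p :: 'a \<times> bool \<times> 'a \<times> 'a list.
        if fst p = fst (snd (snd p)) then True else fst (snd p))"
      by (intro feas_basic ptime_const)
    show "poly_bd sz (\<lambda>p :: 'a \<times> 'a list. 3)" by (rule poly_bd_const[OF poly_bd_sz])
  qed (intro feas_basic ptime_const sz_bool)+
  moreover have "foldr (\<lambda>z acc. if z = y then True else acc) zs False \<longleftrightarrow> y \<in> set zs"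
    for y :: 'a and zs
    by (induction zs) auto
  ultimately show ?thesis by simp
qed

lemmas feas_member = feas_compose2[OF ptime_member]

lemma sz_list_le:
  assumes "length ys \<le> n" "\<And>y. y \<in> set ys \<Longrightarrow> sz y \<le> b"
  shows "sz ys \<le> 2 + n * b"
proof -
  have "sz ys \<le> 2 + length ys * b"
    using assms(2)
  proof (induction ys)
    case (Cons y ys)
    have "sz (y # ys) + 1 = sz y + sz ys" by (simp add: sz_def)
    moreover have "sz y \<le> b" using Cons.prems by simp
    moreover have "sz ys \<le> 2 + length ys * b" using Cons by simp
    ultimately show ?case by simp
  qed (simp add: sz_def)
  also have "length ys * b \<le> n * b" using assms(1) by (rule mult_le_mono1)
  finally show ?thesis by simp
qed

text \<open>A quadratic bound is enough for \<open>remdups\<close>, \<open>rev\<close> and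
  \<open>reduce\<close>, whose results consist of entries of the input and are no longer than
  it.\<close>

lemma sz_sublist: "set ys \<subseteq> set xs \<Longrightarrow> length ys \<le> length xs \<Longrightarrow> sz ys \<le> 2 + sz xs * sz xs"
proof (rule sz_list_le)
  show "length ys \<le> length xs \<Longrightarrow> length ys \<le> sz xs" using length_le_sz[of xs] by simp
  show "set ys \<subseteq> set xs \<Longrightarrow> y \<in> set ys \<Longrightarrow> sz y \<le> sz xs" for y using sz_member[of y xs] by blast
qed

lemma poly_bd_sz_square: "poly_bd sz (\<lambda>x. 2 + sz x * sz x)"
  by (intro poly_bd_add poly_bd_mult poly_bd_sz poly_bd_const[OF poly_bd_sz])

lemma ptime_remdups: "ptime remdups"
proof -
  have foldr: "foldr (\<lambda>z acc. if z \<in> set acc then acc else z # acc) xs [] = remdups xs"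
    for xs :: "'a list"
    by (induction xs) auto
  have "ptime (\<lambda>xs. foldr (\<lambda>(z :: 'a) acc. if z \<in> set acc then acc else z # acc) xs [])"
  proof (rule feas_foldr)
    show "ptime (\<lambda>p :: 'a \<times> 'a list \<times> 'a list.
        if fst p \<in> set (fst (snd p)) then fst (snd p) else fst p # fst (snd p))"
      by (intro feas_basic feas_member)
    fix xs ys zs :: "'a list" assume "xs = ys @ zs"
    then show "sz (foldr (\<lambda>z acc. if z \<in> set acc then acc else z # acc) zs []) \<le> 2 + sz xs * sz xs"
      unfolding foldr by (intro sz_sublist) (auto intro: le_trans[OF length_remdups_leq])
  qed (rule ptime_id ptime_const poly_bd_sz_square)+
  then show ?thesis by (rule feas_cong) (rule foldr)
qed

lemmas feas_remdups = feas_compose[OF ptime_remdups]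

lemma ptime_rev: "ptime rev"
proof -
  have foldr: "foldr (\<lambda>z acc. acc @ [z]) xs [] = rev xs" for xs :: "'a list"
    by (induction xs) auto
  have "ptime (\<lambda>xs. foldr (\<lambda>(z :: 'a) acc. acc @ [z]) xs [])"
  proof (rule feas_foldr)
    show "ptime (\<lambda>p :: 'a \<times> 'a list \<times> 'a list. fst (snd p) @ [fst p])"
      by (intro feas_basic feas_append ptime_const)
    fix xs ys zs :: "'a list" assume "xs = ys @ zs"
    then show "sz (foldr (\<lambda>z acc. acc @ [z]) zs []) \<le> 2 + sz xs * sz xs"
      unfolding foldr by (intro sz_sublist) auto
  qed (rule ptime_id ptime_const poly_bd_sz_square)+
  then show ?thesis by (rule feas_cong) (rule foldr)
qed

lemmas feas_rev = feas_compose[OF ptime_rev]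

lemma feas_butlast: "feas m f \<Longrightarrow> feas m (\<lambda>x. butlast (f x))"
proof -
  have butlast: "rev (tl (rev xs)) = butlast xs" for xs :: "'b list"
    by (induction xs rule: rev_induct) auto
  assume "feas m f"
  then have "feas m (\<lambda>x. rev (tl (rev (f x))))" by (intro feas_rev feas_tl)
  then show ?thesis by (rule feas_cong) (simp add: butlast)
qed

lemma ptime_length: "ptime length"
proof -
  have foldr: "foldr (\<lambda>z n. Suc n) xs 0 = length xs" for xs :: "'a list"
    by (induction xs) auto
  have "ptime (\<lambda>xs. foldr (\<lambda>(z :: 'a) n. Suc n) xs 0)"
  proof (rule feas_foldr)
    show "ptime (\<lambda>p :: 'a \<times> nat \<times> 'a list. Suc (fst (snd p)))" by (intro feas_basic)
    fix xs ys zs :: "'a list" assume "xs = ys @ zs"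
    then show "sz (foldr (\<lambda>z n. Suc n) zs 0) \<le> sz xs"
      unfolding foldr by (simp add: sz_nat sz_list)
  qed (rule ptime_id ptime_const poly_bd_sz)+
  then show ?thesis by (rule feas_cong) (rule foldr)
qed

lemmas feas_length = feas_compose[OF ptime_length]


subsection \<open>Arithmetic\<close>

lemma foldr_const: "foldr (\<lambda>z. f) (replicate n c) = f ^^ n"
  by (induction n) auto

text \<open>Matches the suffix form of the bounds in \<open>feas_foldr\<close> when the list is a
  mere counter: intermediate values are iterates.\<close>

lemma foldr_const_suffix:
  "replicate n c = ys @ zs \<Longrightarrow> \<exists>i\<le>n. foldr (\<lambda>z. f) zs = f ^^ i"
  by (metis append_eq_conv_conj drop_replicate foldr_const diff_le_self)

lemma poly_bd_nat: "feas m f \<Longrightarrow> poly_bd m (\<lambda>x. f x :: nat)"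
  by (rule poly_bd_mono[OF feas_size]) (auto simp: sz_nat)

lemma ptime_add: "ptime (\<lambda>p. fst p + snd p :: nat)"
proof -
  have iter: "(Suc ^^ i) n = i + n" for i n by (induction i) auto
  have "ptime (\<lambda>p. foldr (\<lambda>z n. Suc n) (replicate (fst p) False) (snd p))"
  proof (rule feas_foldr)
    show "ptime (\<lambda>p :: bool \<times> nat \<times> nat \<times> nat. Suc (fst (snd p)))" by (intro feas_basic)
    show "poly_bd sz (\<lambda>p :: nat \<times> nat. fst p + snd p + 2)"
      by (intro poly_bd_add poly_bd_nat feas_basic poly_bd_const[OF poly_bd_sz])
    fix p :: "nat \<times> nat" and ys zs assume "replicate (fst p) False = ys @ zs"
    from foldr_const_suffix[OF this, of Suc]
    show "sz (foldr (\<lambda>z n. Suc n) zs (snd p)) \<le> fst p + snd p + 2"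
      by (auto simp: iter sz_nat)
  qed (intro feas_basic feas_unary)+
  then show ?thesis by (rule feas_cong) (simp add: foldr_const iter)
qed

lemmas feas_add = feas_compose2[OF ptime_add]

lemma ptime_mult: "ptime (\<lambda>p. fst p * snd p :: nat)"
proof -
  have iter: "((\<lambda>a. a + n) ^^ i) 0 = i * n" for i n :: nat by (induction i) auto
  have "ptime (\<lambda>p. foldr (\<lambda>z a. a + snd p) (replicate (fst p) False) (0 :: nat))"
  proof (rule feas_foldr)
    show "ptime (\<lambda>p :: bool \<times> nat \<times> nat \<times> nat. fst (snd p) + snd (snd (snd p)))"
      by (intro feas_basic feas_add)
    show "poly_bd sz (\<lambda>p :: nat \<times> nat. fst p * snd p + 2)"
      by (intro poly_bd_add poly_bd_mult poly_bd_nat feas_basic poly_bd_const[OF poly_bd_sz])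
    fix p :: "nat \<times> nat" and ys zs assume "replicate (fst p) False = ys @ zs"
    from foldr_const_suffix[OF this, of "\<lambda>a. a + snd p"]
    show "sz (foldr (\<lambda>z a. a + snd p) zs 0) \<le> fst p * snd p + 2"
      by (auto simp: iter sz_nat)
  qed (intro feas_basic feas_unary ptime_const)+
  then show ?thesis by (rule feas_cong) (simp add: foldr_const iter)
qed

lemmas feas_mult = feas_compose2[OF ptime_mult]

lemma ptime_minus: "ptime (\<lambda>p. fst p - snd p :: nat)"
proof -
  have iter: "((\<lambda>a. a - 1) ^^ i) n = n - i" for i n :: nat by (induction i) auto
  have "ptime (\<lambda>p. foldr (\<lambda>z a. a - 1) (replicate (snd p) False) (fst p :: nat))"
  proof (rule feas_foldr)
    show "ptime (\<lambda>p :: bool \<times> nat \<times> nat \<times> nat. fst (snd p) - 1)"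
      by (intro feas_basic feas_pred)
    show "poly_bd sz (\<lambda>p :: nat \<times> nat. fst p + 2)"
      by (intro poly_bd_add poly_bd_nat feas_basic poly_bd_const[OF poly_bd_sz])
    fix p :: "nat \<times> nat" and ys zs assume "replicate (snd p) False = ys @ zs"
    from foldr_const_suffix[OF this, of "\<lambda>a :: nat. a - 1"]
    obtain i where i: "foldr (\<lambda>z a :: nat. a - 1) zs = (\<lambda>a. a - 1) ^^ i" by blast
    show "sz (foldr (\<lambda>z a. a - 1) zs (fst p)) \<le> fst p + 2"
      unfolding i iter sz_nat by simp
  qed (intro feas_basic feas_unary)+
  then show ?thesis by (rule feas_cong) (simp only: foldr_const iter)
qed

lemmas feas_minus = feas_compose2[OF ptime_minus]

lemma feas_le: "feas m f \<Longrightarrow> feas m g \<Longrightarrow> feas m (\<lambda>x. f x \<le> (g x :: nat))"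
proof -
  assume f: "feas m f" and g: "feas m g"
  have "feas m (\<lambda>x. f x - g x = 0)" by (intro feas_eq feas_minus f g feas_const[OF f])
  then show ?thesis by (rule feas_cong) simp
qed

lemma feas_less: "feas m f \<Longrightarrow> feas m g \<Longrightarrow> feas m (\<lambda>x. f x < (g x :: nat))"
  using feas_le[OF feas_Suc, of m f g] by (simp add: Suc_le_eq)

lemma feas_max: "feas m f \<Longrightarrow> feas m g \<Longrightarrow> feas m (\<lambda>x. max (f x) (g x :: nat))"
  using feas_if[OF feas_le, of m f g g f] by (simp add: max_def)

section \<open>The algorithm\<close>

text \<open>A uniform triple. For \<open>Swap\<close> and \<open>Transvect\<close> it has the same
  encoding as the description itself; \<open>Invert\<close> repeats its index to fill the third
  place.\<close>

fun nielsen_code :: "nielsen \<Rightarrow> nat \<times> nat \<times> nat" where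
  "nielsen_code (Invert i) = (0, i, i)"
| "nielsen_code (Swap i j) = (1, i, j)"
| "nielsen_code (Transvect i j) = (2, i, j)"

text \<open>The image of a letter under the automorphism described by \<open>d\<close>, or under its inverse if \<open>s\<close>.\<close>

definition nielsen_letter :: "bool \<Rightarrow> nielsen \<Rightarrow> letter \<Rightarrow> word" where
  "nielsen_letter s d x =
    (if fst x = fst (snd (nielsen_code d)) then
       if fst (nielsen_code d) = 0 then [(fst x, \<not> snd x)]
       else if fst (nielsen_code d) = 1 then [(snd (snd (nielsen_code d)), snd x)]
       else if snd x then [(snd (snd (nielsen_code d)), \<not> s), x]
       else [x, (snd (snd (nielsen_code d)), s)]
     else if fst (nielsen_code d) = 1 \<and> fst x = snd (snd (nielsen_code d)) then
       [(fst (snd (nielsen_code d)), snd x)]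
     else [x])"

definition nielsen_apply :: "bool \<Rightarrow> nielsen \<Rightarrow> word \<Rightarrow> word" where
  "nielsen_apply s d w = reduce (concat (map (nielsen_letter s d) w))"

definition nielsens_apply :: "bool \<Rightarrow> nielsen list \<Rightarrow> word \<Rightarrow> word" where
  "nielsens_apply s ds w = foldr (nielsen_apply s) ds w"

definition letters :: "nat \<Rightarrow> letter list" where
  "letters k = concat (map (\<lambda>i. [(i, False), (i, True)]) [0..<k])"

definition extend_words :: "nat \<Rightarrow> word list \<Rightarrow> word list" where
  "extend_words k ws = concat (map (\<lambda>w. map (\<lambda>x. x # w) (letters k)) ws)"

definition all_words :: "nat \<Rightarrow> nat \<Rightarrow> word list" where
  "all_words k n = foldr (\<lambda>_. extend_words k) (replicate n False) [[]]"

text \<open>Neither a Nielsen automorphism nor its inverse more than doubles lengths, hence one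
  doubling per factor.\<close>

definition image_bound :: "nielsen list \<Rightarrow> nat" where
  "image_bound ds = foldr (\<lambda>_ n. n + n) ds 1"

definition window :: "nielsen list \<Rightarrow> nat" where
  "window ds = 2 * image_bound ds * image_bound ds"

type_synonym edge = "word \<times> word \<times> vec"

text \<open>A reduced word \<open>e\<close> one letter longer than the window is the edge from
  \<open>tl e\<close> to \<open>butlast e\<close>, which prepends \<open>hd e\<close> and drops the
  last letter. The inverse automorphism applies the inverse substitutions in reverse order.\<close>

definition word_edge :: "nielsen list \<Rightarrow> word \<Rightarrow> edge" where
  "word_edge ds e = (tl e, butlast e, 1,
     length (nielsens_apply False ds e) + image_bound ds - length (nielsens_apply False ds (tl e)),
     length (nielsens_apply True (rev ds) e) + image_bound ds
       - length (nielsens_apply True (rev ds) (tl e)))"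

definition edges :: "nat \<Rightarrow> nielsen list \<Rightarrow> edge list" where
  "edges k ds = concat (map (\<lambda>e. if reduce e = e then [word_edge ds e] else [])
     (all_words k (Suc (window ds))))"

definition vec_add :: "vec \<Rightarrow> vec \<Rightarrow> vec" where
  "vec_add p q = (fst p + fst q, fst (snd p) + fst (snd q), snd (snd p) + snd (snd q))"

text \<open>An entry keeps the start, end and weight of a walk but not its letters, so walks that
  agree in these data merge.\<close>

definition extend_walks :: "edge list \<Rightarrow> edge list \<Rightarrow> edge list" where
  "extend_walks E W = remdups (W @ concat (map (\<lambda>w. concat (map (\<lambda>e.
     if fst e = fst (snd w) then [(fst w, fst (snd e), vec_add (snd (snd e)) (snd (snd w)))]
     else []) E)) W))"

text \<open>Only the length of \<open>fuel\<close> matters: it is the number of rounds.\<close>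

definition saturate :: "word list \<Rightarrow> edge list \<Rightarrow> edge list" where
  "saturate fuel E = foldr (\<lambda>_. extend_walks E) fuel (remdups E)"

definition closed_list :: "edge list \<Rightarrow> vec list" where
  "closed_list W = map (\<lambda>w. snd (snd w)) (filter (\<lambda>w. fst w = fst (snd w)) W)"

definition candidate_list :: "vec list \<Rightarrow> vec list" where
  "candidate_list S =
    filter (\<lambda>v. 0 < fst v) (S @ concat (map (\<lambda>p. map (\<lambda>q. balance p q) S) S))"

definition less_ratio :: "vec \<Rightarrow> nat \<times> nat \<Rightarrow> nat \<times> nat" where
  "less_ratio v r = (let a = max (fst (snd v)) (snd (snd v))
     in if a * snd r \<le> fst r * fst v then (a, fst v) else r)"

text \<open>The initial fraction \<open>(1, 0)\<close> acts as infinity: every candidate replaces it.\<close>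

definition min_ratio :: "vec list \<Rightarrow> nat \<times> nat" where
  "min_ratio S = foldr less_ratio S (1, 0)"

text \<open>Subtracting \<open>image_bound ds * snd r\<close> removes the offset carried by the
  gains; the fraction exceeds 1 exactly when \<open>snd r < p\<close>.\<close>

definition answer :: "nat \<Rightarrow> nielsen list \<Rightarrow> (nat \<times> nat) \<times> bool" where
  "answer k ds =
    (let r = min_ratio (candidate_list (closed_list
         (saturate (all_words k (Suc (window ds))) (edges k ds))));
         p = fst r - image_bound ds * snd r
     in ((p, snd r), snd r < p))"


subsection \<open>Feasibility of the polynomial parts\<close>

lemma ptime_nielsen_code: "ptime nielsen_code"
proof (rule feasI)
  show "impl [] (If_Leaf (Fst_Exp (Var 0)) (Cons_Exp Nil_Exp (Cons_Exp (Snd_Exp (Var 0)) (Snd_Exp (Var 0))))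
      (Var 0)) nielsen_code (\<lambda>d. 20)"
    unfolding impl_def
  proof
    fix d :: nielsen
    let ?e = "If_Leaf (Fst_Exp (Var 0))
      (Cons_Exp Nil_Exp (Cons_Exp (Snd_Exp (Var 0)) (Snd_Exp (Var 0)))) (Var 0)"
    have v: "runs [] [enc d] (Var 0) (enc d) 1" by (rule runs_Var) auto
    show "runs [] [enc d] ?e (enc (nielsen_code d)) 20"
    proof (cases d)
      case (Invert i)
      then have "enc d = Node Leaf (enc i)" by (simp add: enc_nielsen_def enc_nat_eq)
      then have v': "runs [] [enc d] (Var 0) (Node Leaf (enc i)) 1" using v by simp
      have e: "enc (nielsen_code d) = Node Leaf (Node (enc i) (enc i))" by (simp add: Invert)
      show ?thesis unfolding e
        by (rule runs_mono[OF runs_If_Leaf[OF runs_Fst[OF v'] runs_Cons[OF runs_Nil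
            runs_Cons[OF runs_Snd[OF v'] runs_Snd[OF v']]]]]) simp
    next
      case (Swap i j)
      then have e: "enc d = Node (Node Leaf Leaf) (Node (enc i) (enc j))"
        by (simp add: enc_nielsen_def enc_nat_eq)
      then have v': "runs [] [enc d] (Var 0) (Node (Node Leaf Leaf) (Node (enc i) (enc j))) 1"
        using v by simp
      have e': "enc (nielsen_code d) = enc d" unfolding e by (simp add: Swap)
      show ?thesis unfolding e'
        by (rule runs_mono[OF runs_If_Node[OF runs_Fst[OF v'] v]]) simp
    next
      case (Transvect i j)
      then have e: "enc d = Node (Node Leaf (Node Leaf Leaf)) (Node (enc i) (enc j))"
        by (simp add: enc_nielsen_def enc_nat_eq numeral_2_eq_2)
      then have v': "runs [] [enc d] (Var 0)
          (Node (Node Leaf (Node Leaf Leaf)) (Node (enc i) (enc j))) 1"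
        using v by simp
      have e': "enc (nielsen_code d) = enc d" unfolding e by (simp add: Transvect numeral_2_eq_2)
      show ?thesis unfolding e'
        by (rule runs_mono[OF runs_If_Node[OF runs_Fst[OF v'] v]]) simp
    qed
  qed
  show "poly_bd sz (\<lambda>d :: nielsen. 20)" by (rule poly_bd_const[OF poly_bd_sz])
  have le: "sz (nielsen_code d) \<le> 2 * sz d + 10" for d
  proof -
    have two: "enc_nat 2 = Node Leaf (Node Leaf Leaf)" by (simp add: numeral_2_eq_2)
    show ?thesis by (cases d) (simp_all add: sz_def enc_nielsen_def enc_nat_eq enc_prod_def two)
  qed
  have "poly_bd sz (\<lambda>d :: nielsen. 2 * sz d + 10)"
    by (intro poly_bd_add poly_bd_mult poly_bd_sz poly_bd_const[OF poly_bd_sz])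
  then show "poly_bd sz (\<lambda>d. sz (nielsen_code d))" by (rule poly_bd_mono) (rule le)
qed

lemmas feas_nielsen_code = feas_compose[OF ptime_nielsen_code]

lemma ptime_nielsen_letter: "ptime (\<lambda>p. nielsen_letter (fst p) (fst (snd p)) (snd (snd p)))"
  unfolding nielsen_letter_def
  by (intro feas_if feas_eq feas_conj feas_not feas_Cons feas_pair feas_nielsen_code feas_proj
      ptime_const)

lemma ptime_push_letter: "ptime (\<lambda>p. push_letter (fst p) (snd p))"
proof -
  have "ptime (\<lambda>p :: letter \<times> word. if snd p = [] then [fst p]
      else if hd (snd p) = (fst (fst p), \<not> snd (fst p)) then tl (snd p) else fst p # snd p)"
    by (intro feas_basic feas_hd feas_tl ptime_const)
  moreover have "push_letter x w = (if w = [] then [x]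
      else if hd w = (fst x, \<not> snd x) then tl w else x # w)" for x w
    by (cases w) (auto simp: inv_letter_def)
  ultimately show ?thesis by simp
qed

lemma ptime_reduce: "ptime reduce"
proof -
  have "ptime (\<lambda>w. foldr (\<lambda>z acc. push_letter z acc) w [])"
  proof (rule feas_foldr)
    show "ptime (\<lambda>p :: letter \<times> word \<times> word. push_letter (fst p) (fst (snd p)))"
      by (intro feas_compose2[OF ptime_push_letter] feas_proj)
    fix w ys zs :: word assume "w = ys @ zs"
    then show "sz (foldr (\<lambda>z acc. push_letter z acc) zs []) \<le> 2 + sz w * sz w"
      using set_reduce[of zs] length_reduce_le[of zs]
      unfolding reduce_def by (intro sz_sublist) auto
  qed (rule ptime_id ptime_const poly_bd_sz_square)+
  then show ?thesis by (rule feas_cong) (simp add: reduce_def)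
qed

lemmas feas_reduce = feas_compose[OF ptime_reduce]

lemma ptime_nielsen_apply: "ptime (\<lambda>p. nielsen_apply (fst p) (fst (snd p)) (snd (snd p)))"
  unfolding nielsen_apply_def
  by (intro feas_reduce feas_concat_map feas_compose3[OF ptime_nielsen_letter] feas_proj)

lemma ptime_extend_words: "ptime (extend_words k)"
proof -
  have "ptime (\<lambda>ws :: word list. concat (map (\<lambda>w. map (\<lambda>x. x # w) (letters k)) ws))"
    by (intro feas_concat_map feas_map feas_Cons feas_proj ptime_const)
  then show ?thesis by (rule feas_cong) (simp add: extend_words_def)
qed

lemma ptime_vec_add: "ptime (\<lambda>p. vec_add (fst p) (snd p))"
  unfolding vec_add_def by (intro feas_add feas_pair feas_proj)

lemma ptime_extend_walks: "ptime (\<lambda>p. extend_walks (fst p) (snd p))"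
  unfolding extend_walks_def
  by (intro feas_remdups feas_append feas_concat_map feas_if feas_eq feas_Cons feas_pair
      feas_compose2[OF ptime_vec_add] feas_proj ptime_const)

lemma extend_walks_values:
  assumes W: "set W \<subseteq> A \<times> B \<times> {..m} \<times> {..m} \<times> {..m :: nat}"
    and E: "set E \<subseteq> A \<times> B \<times> {..s} \<times> {..s} \<times> {..s}"
  shows "set (extend_walks E W) \<subseteq> A \<times> B \<times> {..s + m} \<times> {..s + m} \<times> {..s + m}"
proof
  fix w assume "w \<in> set (extend_walks E W)"
  then consider "w \<in> set W" | v e where "v \<in> set W" "e \<in> set E"
      "w = (fst v, fst (snd e), vec_add (snd (snd e)) (snd (snd v)))"
    by (auto simp: extend_walks_def split: if_splits)
  then show "w \<in> A \<times> B \<times> {..s + m} \<times> {..s + m} \<times> {..s + m}"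
  proof cases
    case 1
    with W have "w \<in> A \<times> B \<times> {..m} \<times> {..m} \<times> {..m}" by blast
    then show ?thesis by auto
  next
    case 2
    with W E have "v \<in> A \<times> B \<times> {..m} \<times> {..m} \<times> {..m}" "e \<in> A \<times> B \<times> {..s} \<times> {..s} \<times> {..s}"
      by blast+
    with 2(3) show ?thesis by (auto simp: vec_add_def intro: add_mono)
  qed
qed

text \<open>The list of walks stays polynomial: it is free of repetitions, and its entries range over
  the end points occurring in \<open>E\<close> and over numbers that grow linearly with the number of rounds.\<close>

lemma saturate_size:
  fixes fuel :: "word list" and E :: "edge list"
  assumes "length zs \<le> n"
  defines "t \<equiv> n * sz E + sz E"
  shows "sz (foldr (\<lambda>_. extend_walks E) zs (remdups E))
    \<le> 2 + (sz E * sz E * (t + 1) ^ 3) * (2 * sz E + 3 * t + 6)"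
proof -
  let ?A = "fst ` set E" and ?B = "(fst \<circ> snd) ` set E"
  have mem: "sz u \<le> sz E \<and> sz v \<le> sz E \<and> a \<le> sz E \<and> b \<le> sz E \<and> c \<le> sz E"
    if "(u, v, a, b, c) \<in> set E" for u v a b c
  proof -
    have "sz u + sz v + sz a + sz b + sz c \<le> sz (u, v, a, b, c) + 8" by (simp add: sz_def)
    moreover have "sz (u, v, a, b, c) \<le> sz E" using that by (rule sz_member)
    moreover have "2 \<le> sz u" "2 \<le> sz v" by (rule sz_ge)+
    ultimately show ?thesis by (simp add: sz_nat)
  qed
  have E: "set E \<subseteq> ?A \<times> ?B \<times> {..sz E} \<times> {..sz E} \<times> {..sz E}"
    using mem by force
  define W where "W = foldr (\<lambda>_. extend_walks E) zs (remdups E)"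
  have "distinct (foldr (\<lambda>_. extend_walks E) zs (remdups E)) \<and>
      set (foldr (\<lambda>_. extend_walks E) zs (remdups E)) \<subseteq>
      ?A \<times> ?B \<times> {..length zs * sz E + sz E} \<times> {..length zs * sz E + sz E} \<times> {..length zs * sz E + sz E}"
  proof (induction zs)
    case (Cons z zs)
    have eq: "length (z # zs) * sz E + sz E = sz E + (length zs * sz E + sz E)" by simp
    from Cons extend_walks_values[OF _ E, of _ "length zs * sz E + sz E"] show ?case
      unfolding eq by (auto simp: extend_walks_def)
  qed (use E in simp)
  moreover have "length zs * sz E + sz E \<le> t" using assms(1) by (simp add: t_def)
  ultimately have dW: "distinct W" and sW: "set W \<subseteq> ?A \<times> ?B \<times> {..t} \<times> {..t} \<times> {..t}"
    unfolding W_def by (auto 0 3)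
  have "card (?A \<times> ?B \<times> {..t} \<times> {..t} \<times> {..t}) = card ?A * (card ?B * ((t + 1) * ((t + 1) * (t + 1))))"
    by (simp add: card_cartesian_product)
  also have "\<dots> \<le> sz E * (sz E * ((t + 1) * ((t + 1) * (t + 1))))"
  proof (intro mult_le_mono order_refl)
    show "card ?A \<le> sz E" "card ?B \<le> sz E"
      using card_image_le[of "set E" fst] card_image_le[of "set E" "fst \<circ> snd"]
        card_length[of E] length_le_sz[of E] by (auto intro: le_trans)
  qed
  also have "\<dots> = sz E * sz E * (t + 1) ^ 3" by (simp only: power3_eq_cube mult.assoc)
  finally have card: "card (?A \<times> ?B \<times> {..t} \<times> {..t} \<times> {..t}) \<le> sz E * sz E * (t + 1) ^ 3" .
  have "sz W \<le> 2 + (sz E * sz E * (t + 1) ^ 3) * (2 * sz E + 3 * t + 6)"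
  proof (rule sz_list_le)
    have "length W = card (set W)" using dW by (simp add: distinct_card)
    also have "\<dots> \<le> card (?A \<times> ?B \<times> {..t} \<times> {..t} \<times> {..t})" using sW by (intro card_mono) auto
    finally show "length W \<le> sz E * sz E * (t + 1) ^ 3" using card by simp
    fix w assume "w \<in> set W"
    with sW obtain u v a b c where w: "w = (u, v, a, b, c)" "u \<in> ?A" "v \<in> ?B" "a \<le> t" "b \<le> t" "c \<le> t"
      by (cases w) force
    have "sz u \<le> sz E" "sz v \<le> sz E" using mem w(2,3) by force+
    moreover have "sz w \<le> sz u + (sz v + (sz a + (sz b + sz c)))"
      using sz_pair[of u "(v, a, b, c)"] sz_pair[of v "(a, b, c)"] sz_pair[of a "(b, c)"] sz_pair[of b c]
      unfolding w(1) by linarith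
    ultimately show "sz w \<le> 2 * sz E + 3 * t + 6" using w by (simp add: sz_nat)
  qed
  then show ?thesis by (simp add: W_def)
qed

lemma ptime_saturate: "ptime (\<lambda>p. saturate (fst p) (snd p))"
proof -
  have "ptime (\<lambda>p :: word list \<times> edge list.
      foldr (\<lambda>_. extend_walks (snd p)) (fst p) (remdups (snd p)))"
  proof (rule feas_foldr)
    show "ptime (\<lambda>p :: word \<times> edge list \<times> word list \<times> edge list.
        extend_walks (snd (snd (snd p))) (fst (snd p)))"
      by (intro feas_compose2[OF ptime_extend_walks] feas_proj)
    let ?t = "\<lambda>p :: word list \<times> edge list. length (fst p) * sz (snd p) + sz (snd p)"
    show "poly_bd sz (\<lambda>p. 2 + (sz (snd p) * sz (snd p) * (?t p + 1) ^ 3) * (2 * sz (snd p) + 3 * ?t p + 6))"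
    proof -
      have l: "poly_bd sz (\<lambda>p :: word list \<times> edge list. length (fst p))"
        by (intro poly_bd_nat feas_length feas_proj)
      have s: "poly_bd sz (\<lambda>p :: word list \<times> edge list. sz (snd p))"
        by (intro feas_size feas_proj)
      show ?thesis
        by (intro poly_bd_add poly_bd_mult poly_bd_power l s poly_bd_const[OF poly_bd_sz])
    qed
    fix p :: "word list \<times> edge list" and ys zs assume "fst p = ys @ zs"
    then show "sz (foldr (\<lambda>_. extend_walks (snd p)) zs (remdups (snd p)))
        \<le> 2 + (sz (snd p) * sz (snd p) * (?t p + 1) ^ 3) * (2 * sz (snd p) + 3 * ?t p + 6)"
      by (intro saturate_size) simp
  qed (intro feas_proj feas_remdups)+
  then show ?thesis by (simp add: saturate_def)
qed

lemma ptime_closed_list: "ptime closed_list"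
proof -
  have "ptime (\<lambda>W :: edge list. map (\<lambda>w. snd (snd w)) (filter (\<lambda>w. fst w = fst (snd w)) W))"
    by (intro feas_map feas_filter feas_eq feas_proj)
  then show ?thesis by (rule feas_cong) (simp add: closed_list_def)
qed

lemma ptime_balance: "ptime (\<lambda>p. balance (fst p) (snd p))"
  unfolding balance_def abs_diff_def case_prod_beta
  by (intro feas_pair feas_add feas_mult feas_minus feas_proj)

lemma ptime_candidate_list: "ptime candidate_list"
proof -
  have "ptime (\<lambda>S :: vec list.
      filter (\<lambda>v. 0 < fst v) (S @ concat (map (\<lambda>p. map (\<lambda>q. balance p q) S) S)))"
    by (intro feas_filter feas_append feas_concat_map feas_map feas_compose2[OF ptime_balance]
        feas_less feas_proj ptime_const)
  then show ?thesis by (rule feas_cong) (simp add: candidate_list_def)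
qed

text \<open>The running minimum is the start value or is copied from an entry, so its size does not
  build up during the fold.\<close>

lemma min_ratio_cases:
  "min_ratio S = (1, 0) \<or> (\<exists>v\<in>set S. min_ratio S = (max (fst (snd v)) (snd (snd v)), fst v))"
  by (induction S) (auto simp: min_ratio_def less_ratio_def Let_def)

lemma ptime_less_ratio: "ptime (\<lambda>p. less_ratio (fst p) (snd p))"
  unfolding less_ratio_def Let_def
  by (intro feas_if feas_le feas_mult feas_max feas_pair feas_proj)

lemma ptime_min_ratio: "ptime min_ratio"
proof -
  have "ptime (\<lambda>S. foldr (\<lambda>v r. less_ratio v r) S (1, 0))"
  proof (rule feas_foldr)
    show "ptime (\<lambda>p :: vec \<times> (nat \<times> nat) \<times> vec list. less_ratio (fst p) (fst (snd p)))"
      by (intro feas_compose2[OF ptime_less_ratio] feas_proj)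
    show "poly_bd sz (\<lambda>S :: vec list. sz S + 10)"
      by (intro poly_bd_add poly_bd_sz poly_bd_const[OF poly_bd_sz])
    fix S ys zs :: "vec list" assume S: "S = ys @ zs"
    have "sz (min_ratio zs) \<le> sz S + 10"
      using min_ratio_cases[of zs]
    proof
      assume "\<exists>v\<in>set zs. min_ratio zs = (max (fst (snd v)) (snd (snd v)), fst v)"
      then obtain v where v: "v \<in> set zs" "min_ratio zs = (max (fst (snd v)) (snd (snd v)), fst v)"
        by blast
      obtain n a b where nab: "v = (n, a, b)" by (metis prod_cases3)
      have "sz v \<le> sz S" using v(1) by (intro sz_member) (simp add: S)
      moreover have "sz (min_ratio zs) \<le> sz v"
      proof -
        have "size (enc (max a b)) \<le> size (enc a) + size (enc b)"
          using sz_nat[of a] sz_nat[of b] sz_nat[of "max a b"] by (simp add: sz_def)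
        then show ?thesis by (simp add: v(2) nab sz_def)
      qed
      ultimately show ?thesis by simp
    qed (simp add: sz_def)
    then show "sz (foldr (\<lambda>v r. less_ratio v r) zs (1, 0)) \<le> sz S + 10"
      by (simp add: min_ratio_def)
  qed (rule ptime_id ptime_const)+
  then show ?thesis by (rule feas_cong) (simp add: min_ratio_def)
qed

subsection \<open>Feasibility of the exponential parts\<close>

lemma length_nielsen_letter: "length (nielsen_letter s d x) \<le> 2"
  by (simp add: nielsen_letter_def)

lemma length_concat_le: "(\<And>x. length (f x) \<le> n) \<Longrightarrow> length (concat (map f w)) \<le> n * length w"
  by (induction w) (auto simp: add_mono)

lemma length_nielsens_apply: "length (nielsens_apply s ds w) \<le> 2 ^ length ds * length w"
proof (induction ds)
  case (Cons d ds)
  have "length (nielsens_apply s (d # ds) w) \<le> 2 * length (nielsens_apply s ds w)"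
    unfolding nielsens_apply_def foldr_Cons o_def nielsen_apply_def
    by (rule le_trans[OF length_reduce_le length_concat_le[OF length_nielsen_letter]])
  with Cons show ?case by simp
qed (simp add: nielsens_apply_def)

lemma fst_nielsen_letter:
  "y \<in> set (nielsen_letter s d x) \<Longrightarrow>
    fst y \<in> {fst x, fst (snd (nielsen_code d)), snd (snd (nielsen_code d))}"
  by (auto simp: nielsen_letter_def split: if_splits)

lemma nielsen_code_le: "fst (snd (nielsen_code d)) \<le> sz d" "snd (snd (nielsen_code d)) \<le> sz d"
  using sz_nat by (cases d; auto simp: sz_def enc_nielsen_def enc_nat_eq)+

text \<open>Feasibility concerns all inputs, including descriptions with indices outside the basis;
  hence a bound by the input size and not by \<open>k\<close>.\<close>

lemma fst_nielsens_apply: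
  "y \<in> set (nielsens_apply s ds w) \<Longrightarrow> fst y \<le> sz w + sz ds"
proof (induction ds arbitrary: y)
  case Nil
  then have "sz y \<le> sz w" by (intro sz_member) (simp add: nielsens_apply_def)
  moreover have "fst y \<le> sz y" using sz_nat[of "fst y"] by (simp add: sz_def enc_prod_def)
  ultimately show ?case by simp
next
  case (Cons d ds)
  have "y \<in> set (concat (map (nielsen_letter s d) (nielsens_apply s ds w)))"
    by (rule subsetD[OF set_reduce])
      (use Cons.prems in \<open>simp add: nielsens_apply_def nielsen_apply_def\<close>)
  then obtain x where x: "x \<in> set (nielsens_apply s ds w)" "y \<in> set (nielsen_letter s d x)" by auto
  have d: "sz d \<le> sz (d # ds)" by (rule sz_member) simp
  have ds: "sz ds \<le> sz (d # ds)" using sz_suffix[of ds "[d]"] by simp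
  from fst_nielsen_letter[OF x(2)] Cons.IH[OF x(1)] nielsen_code_le[of d] d ds
  show ?case by auto
qed

lemma sz_letter: "sz (x :: letter) \<le> fst x + 4"
  using sz_nat[of "fst x"] sz_bool[of "snd x"] by (simp add: sz_def enc_prod_def)

text \<open>Each substitution may double the length, so the intermediate words stay small only
  relative to a measure that controls \<open>2 ^ length (ds x)\<close>.\<close>

lemma feas_nielsens_apply:
  assumes "feas m (\<lambda>x. x)" "feas m ds" "feas m w" "poly_bd m (\<lambda>x. 2 ^ length (ds x))"
  shows "feas m (\<lambda>x. nielsens_apply s (ds x) (w x))"
proof -
  have "feas m (\<lambda>x. foldr (\<lambda>d. nielsen_apply s d) (ds x) (w x))"
  proof (rule feas_foldr[OF assms(1-3)])
    show "ptime (\<lambda>p :: nielsen \<times> word \<times> 'a. nielsen_apply s (fst p) (fst (snd p)))"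
      by (intro feas_compose3[OF ptime_nielsen_apply] feas_proj ptime_const)
    have s: "poly_bd m (\<lambda>x. sz (ds x))" "poly_bd m (\<lambda>x. sz (w x))"
      using assms feas_size by blast+
    show "poly_bd m (\<lambda>x. 2 + (2 ^ length (ds x) * sz (w x)) * (sz (w x) + sz (ds x) + 4))"
      by (intro poly_bd_add poly_bd_mult assms(4) s poly_bd_const[OF assms(4)])
    fix x ys zs assume ds: "ds x = ys @ zs"
    have "length (nielsens_apply s zs (w x)) \<le> 2 ^ length zs * length (w x)"
      by (rule length_nielsens_apply)
    also have "\<dots> \<le> 2 ^ length (ds x) * sz (w x)"
      using ds length_le_sz by (intro mult_le_mono power_increasing) auto
    finally have "length (nielsens_apply s zs (w x)) \<le> 2 ^ length (ds x) * sz (w x)" .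
    moreover have "sz y \<le> sz (w x) + sz (ds x) + 4" if "y \<in> set (nielsens_apply s zs (w x))" for y
      using fst_nielsens_apply[OF that] sz_letter[of y] sz_suffix[of zs ys] ds by simp
    ultimately show "sz (foldr (\<lambda>d. nielsen_apply s d) zs (w x))
        \<le> 2 + (2 ^ length (ds x) * sz (w x)) * (sz (w x) + sz (ds x) + 4)"
      unfolding nielsens_apply_def[symmetric] by (rule sz_list_le)
  qed
  then show ?thesis by (simp add: nielsens_apply_def)
qed

lemma image_bound_eq: "image_bound ds = 2 ^ length ds"
proof -
  have "foldr (\<lambda>_ n. n + n) zs 1 = (2 :: nat) ^ length zs" for zs :: "nielsen list"
    by (induction zs) auto
  then show ?thesis by (simp add: image_bound_def)
qed

lemma feas_image_bound:
  assumes "feas m (\<lambda>x. x)" "feas m ds" "poly_bd m (\<lambda>x. 2 ^ length (ds x))"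
  shows "feas m (\<lambda>x. image_bound (ds x))"
proof -
  have "feas m (\<lambda>x. foldr (\<lambda>(_ :: nielsen) n :: nat. n + n) (ds x) 1)"
  proof (rule feas_foldr[OF assms(1,2) feas_const[OF assms(1)]])
    show "ptime (\<lambda>p :: nielsen \<times> nat \<times> 'a. fst (snd p) + fst (snd p))"
      by (intro feas_add feas_proj)
    show "poly_bd m (\<lambda>x. 2 ^ length (ds x) + 2)"
      by (intro poly_bd_add assms(3) poly_bd_const[OF assms(3)])
    fix x ys zs assume "ds x = ys @ zs"
    then have "(2 :: nat) ^ length zs \<le> 2 ^ length (ds x)" by (intro power_increasing) auto
    then show "sz (foldr (\<lambda>_ n :: nat. n + n) zs 1) \<le> 2 ^ length (ds x) + 2"
      using image_bound_eq[of zs] by (simp add: image_bound_def sz_nat)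
  qed
  then show ?thesis by (simp add: image_bound_def)
qed

lemma set_letters: "set (letters k) = {x. fst x < k}"
  by (force simp: letters_def)

lemma length_letters: "length (letters k) = 2 * k"
  by (simp add: letters_def length_concat o_def sum_list_triv)

lemma all_words_Suc: "all_words k (Suc n) = extend_words k (all_words k n)"
  by (simp add: all_words_def)

lemma set_all_words: "set (all_words k n) = {w. set w \<subseteq> {x. fst x < k} \<and> length w = n}"
proof (induction n)
  case (Suc n)
  have "w \<in> set (all_words k (Suc n)) \<longleftrightarrow> set w \<subseteq> {x. fst x < k} \<and> length w = Suc n" for w
    unfolding all_words_Suc extend_words_def using Suc by (cases w) (auto simp: set_letters)
  then show ?case by blast
qed (auto simp: all_words_def)

lemma length_all_words: "length (all_words k n) = (2 * k) ^ n"
proof (induction n)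
  case (Suc n)
  have "length (extend_words k ws) = 2 * k * length ws" for ws
    unfolding extend_words_def by (induction ws) (auto simp: length_letters)
  then show ?case using Suc by (simp add: all_words_Suc)
qed (simp add: all_words_def)

text \<open>The first summand bounds the number of words one letter longer than the window; the base
  \<open>2 * k + 2\<close> is at least 2 for every \<open>k\<close>.\<close>

definition algorithm_measure :: "nat \<Rightarrow> nielsen list \<Rightarrow> nat" where
  "algorithm_measure k ds = (2 * k + 2) ^ Suc (window ds) + sz ds"

lemma poly_bd_algorithm_measure: "poly_bd (algorithm_measure k) (algorithm_measure k)"
proof -
  have "2 \<le> algorithm_measure k ds" for ds
    using sz_ge[of ds] by (simp add: algorithm_measure_def)
  then show ?thesis unfolding poly_bd_def by (auto intro: exI[of _ 1])
qed

lemma poly_bd_window: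
  "poly_bd (algorithm_measure k) (\<lambda>ds. (2 * k + 2) ^ Suc (window ds))"
  "poly_bd (algorithm_measure k) (\<lambda>ds. Suc (window ds))"
  "poly_bd (algorithm_measure k) (\<lambda>ds. 2 ^ length ds)"
  "poly_bd (algorithm_measure k) sz"
proof -
  show p: "poly_bd (algorithm_measure k) (\<lambda>ds. (2 * k + 2) ^ Suc (window ds))"
    by (rule poly_bd_mono[OF poly_bd_algorithm_measure]) (simp add: algorithm_measure_def)
  show w: "poly_bd (algorithm_measure k) (\<lambda>ds. Suc (window ds))"
  proof (rule poly_bd_mono[OF p])
    fix ds
    have "Suc (window ds) \<le> 2 ^ Suc (window ds)" by (rule less_imp_le[OF less_exp])
    also have "\<dots> \<le> (2 * k + 2) ^ Suc (window ds)" by (rule power_mono) auto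
    finally show "Suc (window ds) \<le> (2 * k + 2) ^ Suc (window ds)" .
  qed
  show "poly_bd (algorithm_measure k) (\<lambda>ds. 2 ^ length ds)"
  proof (rule poly_bd_mono[OF w])
    fix ds :: "nielsen list"
    have "(2 :: nat) ^ length ds * 1 \<le> 2 ^ length ds * 2 ^ length ds" by (rule mult_le_mono2) simp
    then show "2 ^ length ds \<le> Suc (window ds)"
      unfolding window_def image_bound_eq mult.assoc by linarith
  qed
  show "poly_bd (algorithm_measure k) sz"
    by (rule poly_bd_mono[OF poly_bd_algorithm_measure]) (simp add: algorithm_measure_def)
qed

lemma feas_window: "feas (algorithm_measure k) (\<lambda>ds. Suc (window ds))"
proof -
  note id = feas_id[OF poly_bd_window(4)]
  show ?thesis
    unfolding window_def
    by (intro feas_Suc feas_mult feas_image_bound id poly_bd_window(3) feas_const[OF id])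
qed

lemma sz_all_words:
  assumes "i \<le> n"
  shows "sz (all_words k i) \<le> 2 + (2 * k + 2) ^ n * (2 + n * (k + 4))"
proof (rule sz_list_le)
  have "length (all_words k i) \<le> (2 * k + 2) ^ i"
    unfolding length_all_words by (rule power_mono) auto
  also have "\<dots> \<le> (2 * k + 2) ^ n" using assms by (intro power_increasing) auto
  finally show "length (all_words k i) \<le> (2 * k + 2) ^ n" .
  fix w assume w: "w \<in> set (all_words k i)"
  show "sz w \<le> 2 + n * (k + 4)"
  proof (rule sz_list_le)
    show "length w \<le> n" using w assms by (simp add: set_all_words)
    fix x assume "x \<in> set w"
    then have "fst x < k" using w by (auto simp: set_all_words)
    then show "sz x \<le> k + 4" using sz_letter[of x] by simp
  qed
qed

lemma feas_all_words: "feas (algorithm_measure k) (\<lambda>ds. all_words k (Suc (window ds)))"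
proof -
  note id = feas_id[OF poly_bd_window(4)]
  have iter: "(extend_words k ^^ i) [[]] = all_words k i" for i
    by (simp add: all_words_def foldr_const)
  have "feas (algorithm_measure k) (\<lambda>ds :: nielsen list.
      foldr (\<lambda>_ acc. extend_words k acc) (replicate (Suc (window ds)) False) [[]])"
  proof (rule feas_foldr[OF id feas_unary[OF feas_window] feas_const[OF id]])
    show "ptime (\<lambda>p :: bool \<times> word list \<times> nielsen list. extend_words k (fst (snd p)))"
      by (intro feas_compose[OF ptime_extend_words] feas_proj)
    show "poly_bd (algorithm_measure k) (\<lambda>ds. 2 + (2 * k + 2) ^ Suc (window ds) * (2 + Suc (window ds) * (k + 4)))"
      by (intro poly_bd_add poly_bd_mult poly_bd_window(1,2) poly_bd_const[OF poly_bd_window(1)])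
    fix ds :: "nielsen list" and ys zs assume "replicate (Suc (window ds)) False = ys @ zs"
    from foldr_const_suffix[OF this, of "extend_words k"]
    obtain i where "i \<le> Suc (window ds)" "foldr (\<lambda>_. extend_words k) zs = extend_words k ^^ i" by blast
    then show "sz (foldr (\<lambda>_ acc. extend_words k acc) zs [[]])
        \<le> 2 + (2 * k + 2) ^ Suc (window ds) * (2 + Suc (window ds) * (k + 4))"
      using sz_all_words by (simp only: iter)
  qed
  then show ?thesis by (simp only: all_words_def)
qed

lemma feas_edges: "feas (algorithm_measure k) (edges k)"
proof -
  note id = feas_id[OF poly_bd_window(4)]
  \<comment> \<open>Computing one edge applies all substitutions to words, so the local measure
    contains a power of 2 besides the sizes.\<close>
  define m' where "m' p = 2 ^ length (snd p) + (sz (fst p) + sz (snd p))"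
    for p :: "word \<times> nielsen list"
  have "2 \<le> m' p" for p using sz_ge[of "fst p"] by (simp add: m'_def)
  then have m': "poly_bd m' m'" unfolding poly_bd_def by (auto intro: exI[of _ 1])
  have "poly_bd m' sz"
  proof (rule poly_bd_mono[OF m'])
    show "sz p \<le> m' p" for p using sz_pair[of "fst p" "snd p"] by (simp add: m'_def)
  qed
  then have id': "feas m' (\<lambda>p. p)" by (rule feas_id)
  have pw: "poly_bd m' (\<lambda>p. 2 ^ length (snd p))" by (rule poly_bd_mono[OF m']) (simp add: m'_def)
  have pw': "poly_bd m' (\<lambda>p. 2 ^ length (rev (snd p)))" using pw by simp
  have "feas (algorithm_measure k) (\<lambda>ds. concat (map (\<lambda>e. if reduce e = e then [word_edge ds e] else [])
     (all_words k (Suc (window ds)))))"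
  proof (rule feas_concat_map_measure[OF id feas_all_words])
    show "feas m' (\<lambda>p. if reduce (fst p) = fst p then [word_edge (snd p) (fst p)] else [])"
      unfolding word_edge_def
      by (intro feas_if feas_eq feas_reduce feas_Cons feas_pair feas_minus feas_add feas_length
          feas_nielsens_apply feas_image_bound feas_rev feas_tl feas_butlast feas_fst feas_snd
          id' pw pw' feas_const[OF id'])
    show "poly_bd (algorithm_measure k) (\<lambda>ds. 2 ^ length ds + (sz (all_words k (Suc (window ds))) + sz ds))"
      by (intro poly_bd_add poly_bd_window feas_size[OF feas_all_words])
    fix ds :: "nielsen list" and e assume "e \<in> set (all_words k (Suc (window ds)))"
    from sz_member[OF this]
    show "m' (e, ds) \<le> 2 ^ length ds + (sz (all_words k (Suc (window ds))) + sz ds)"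
      by (simp add: m'_def)
  qed
  then show ?thesis by (rule feas_cong) (simp add: edges_def)
qed

lemma feas_answer: "feas (algorithm_measure k) (answer k)"
proof -
  note id = feas_id[OF poly_bd_window(4)]
  define r where "r ds = min_ratio (candidate_list (closed_list
      (saturate (all_words k (Suc (window ds))) (edges k ds))))" for ds
  have r: "feas (algorithm_measure k) r"
    unfolding r_def
    by (intro feas_compose[OF ptime_min_ratio] feas_compose[OF ptime_candidate_list]
        feas_compose[OF ptime_closed_list] feas_compose2[OF ptime_saturate] feas_all_words feas_edges)
  have M: "feas (algorithm_measure k) image_bound"
    using feas_image_bound[OF id id poly_bd_window(3)] .
  have "feas (algorithm_measure k) (\<lambda>ds. ((fst (r ds) - image_bound ds * snd (r ds), snd (r ds)),
      snd (r ds) < fst (r ds) - image_bound ds * snd (r ds)))"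
    by (intro feas_pair feas_less feas_minus feas_mult feas_fst feas_snd r M)
  then show ?thesis by (rule feas_cong) (simp add: answer_def Let_def r_def)
qed


subsection \<open>Nielsen automorphisms as substitutions\<close>

lemma nielsen_letter_inv: "nielsen_letter s d (inv_letter x) = word_inv (nielsen_letter s d x)"
  by (auto simp: nielsen_letter_def word_inv_def inv_letter_def prod_eq_iff)

text \<open>A cancelling pair of letters goes to a cancelling pair of words, so the substitution is
  well defined on group elements.\<close>

lemma reduce_concat_reduce:
  assumes inv: "\<And>x. h (inv_letter x) = word_inv (h x)"
  shows "reduce (concat (map h (reduce w))) = reduce (concat (map h w))"
proof (induction w)
  case (Cons x w)
  have *: "reduce (concat (map h (push_letter x v))) = reduce (h x @ concat (map h v))" for v
    by (cases v) (auto simp: inv)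
  have "reduce (concat (map h (reduce (x # w)))) = reduce (h x @ concat (map h (reduce w)))"
    using *[of "reduce w"] by (simp add: reduce_def)
  also have "\<dots> = reduce (h x @ concat (map h w))"
    using Cons by (metis reduce_reduce_right)
  finally show ?case by simp
qed simp

lemma nielsen_apply_reduce: "nielsen_apply s d (reduce w) = nielsen_apply s d w"
  unfolding nielsen_apply_def by (rule reduce_concat_reduce) (rule nielsen_letter_inv)

lemma nielsen_apply_Cons:
  "nielsen_apply s d (x # w) = reduce (nielsen_letter s d x @ nielsen_apply s d w)"
  by (simp add: nielsen_apply_def)

lemma nielsen_apply_append:
  "nielsen_apply s d (u @ v) = reduce (nielsen_apply s d u @ nielsen_apply s d v)"
  by (simp add: nielsen_apply_def)

lemma is_nielsen_auto: "is_nielsen k d \<tau> \<Longrightarrow> \<tau> \<in> auto (free_group k)"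
  by (cases d) auto

text \<open>\<open>is_nielsen\<close> prescribes values on the basis only; inverse letters follow
  from the homomorphism property.\<close>

lemma is_nielsen_letter:
  assumes "is_nielsen k d \<tau>" "fst x < k"
  shows "\<tau> [x] = reduce (nielsen_letter False d x)"
proof -
  note \<tau> = auto_free_group[OF is_nielsen_auto[OF assms(1)]]
  have pos: "\<tau> [(l, False)] = reduce (nielsen_letter False d (l, False))" if l: "l < k" for l
  proof (cases d)
    case (Invert i)
    with assms(1) have i: "i < k" by simp
    have "inv\<^bsub>free_group k\<^esub> [(i, False)] = [(i, True)]"
      using i by (subst inv_free_group) (auto simp: words_Cons_iff word_inv_def inv_letter_def)
    then show ?thesis using assms(1) l Invert
      by (cases "l = i") (auto simp: basis_elem_def nielsen_letter_def reduce_def)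
  next
    case (Swap i j)
    then show ?thesis using assms(1) l
      by (cases "l = i"; cases "l = j") (auto simp: basis_elem_def nielsen_letter_def reduce_def)
  next
    case (Transvect i j)
    then show ?thesis using assms(1) l
      by (cases "l = i") (auto simp: basis_elem_def nielsen_letter_def reduce_def)
  qed
  show ?thesis
  proof (cases "snd x")
    case False
    then show ?thesis using pos[OF assms(2)] by (cases x) auto
  next
    case True
    then have x: "x = inv_letter (fst x, False)" by (cases x) (simp add: inv_letter_def)
    have w: "[(fst x, False)] \<in> words k" using assms(2) by (simp add: words_Cons_iff)
    have "\<tau> [x] = \<tau> (word_inv [(fst x, False)])" by (subst x) (simp add: word_inv_def)
    also have "\<dots> = word_inv (reduce (nielsen_letter False d (fst x, False)))"
      using \<tau>(3)[OF w] pos[OF assms(2)] by simp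
    also have "\<dots> = reduce (nielsen_letter False d x)"
      by (subst (2) x) (simp add: nielsen_letter_inv word_inv_reduce)
    finally show ?thesis .
  qed
qed

lemma is_nielsen_apply:
  assumes "is_nielsen k d \<tau>" "w \<in> words k"
  shows "\<tau> w = nielsen_apply False d w"
  using assms(2)
proof (induction w)
  case Nil
  then show ?case
    using auto_free_group(4)[OF is_nielsen_auto[OF assms(1)]] by (simp add: nielsen_apply_def)
next
  case (Cons x w)
  have x: "fst x < k" and w: "w \<in> words k" using Cons.prems by (auto simp: words_Cons_iff)
  have "[x] \<in> words k" using x by (simp add: words_Cons_iff)
  then have "\<tau> (reduce ([x] @ w)) = reduce (\<tau> [x] @ \<tau> w)"
    using auto_free_group(2)[OF is_nielsen_auto[OF assms(1)]] w by blast
  then show ?case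
    using Cons.IH[OF w] is_nielsen_letter[OF assms(1) x] Cons.prems
    by (simp add: reduced_if_words nielsen_apply_Cons)
qed

text \<open>The substitutions undo each other on letters and are compatible with reduction. The
  other order of composition comes from bijectivity, in \<open>aut_product_inverse\<close>.\<close>

lemma nielsen_apply_inverse:
  assumes "is_nielsen k d \<tau>" "reduced w"
  shows "nielsen_apply True d (nielsen_apply False d w) = w"
  using assms(2)
proof (induction w)
  case (Cons x w)
  have letter: "nielsen_apply True d (nielsen_letter False d x) = [x]"
  proof (cases d)
    case (Invert i)
    then show ?thesis by (cases x) (auto simp: nielsen_apply_def nielsen_letter_def reduce_def)
  next
    case (Swap i j)
    then show ?thesis using assms(1)
      by (cases x) (auto simp: nielsen_apply_def nielsen_letter_def reduce_def)
  next
    case (Transvect i j)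
    then show ?thesis using assms(1)
      by (cases x) (auto simp: nielsen_apply_def nielsen_letter_def reduce_def inv_letter_def)
  qed
  have "nielsen_apply True d (nielsen_apply False d (x # w))
      = reduce (nielsen_apply True d (nielsen_letter False d x)
          @ nielsen_apply True d (nielsen_apply False d w))"
    unfolding nielsen_apply_Cons nielsen_apply_reduce nielsen_apply_append ..
  also have "\<dots> = x # w" using Cons by (simp add: letter reduced_Cons)
  finally show ?case .
qed (simp add: nielsen_apply_def)

lemma aut_product_apply:
  assumes "list_all2 (is_nielsen k) ds \<tau>s"
  shows "aut_product k \<tau>s \<in> auto (free_group k)"
    and "w \<in> words k \<Longrightarrow> aut_product k \<tau>s w = nielsens_apply False ds w"
    and "w \<in> words k \<Longrightarrow> nielsens_apply True (rev ds) (nielsens_apply False ds w) = w"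
proof -
  interpret group "free_group k" by (rule group_free_group)
  interpret A: group "AutoGroup (free_group k)" by (rule AutoGroup)
  have "aut_product k \<tau>s \<in> auto (free_group k) \<and> (\<forall>w\<in>words k.
      aut_product k \<tau>s w = nielsens_apply False ds w \<and>
      nielsens_apply True (rev ds) (nielsens_apply False ds w) = w)"
    using assms
  proof (induction rule: list_all2_induct)
    case Nil
    have "aut_product k [] = \<one>\<^bsub>AutoGroup (free_group k)\<^esub>" by (simp add: aut_product_def)
    moreover have "\<one>\<^bsub>AutoGroup (free_group k)\<^esub> \<in> auto (free_group k)"
      using A.one_closed unfolding carrier_AutoGroup .
    ultimately have "aut_product k [] \<in> auto (free_group k)" by simp
    moreover have "aut_product k [] w = w" if "w \<in> words k" for w
      using that by (simp add: aut_product_def auto_one)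
    ultimately show ?case by (simp add: nielsens_apply_def)
  next
    case (Cons d ds \<tau> \<tau>s)
    note \<tau> = is_nielsen_auto[OF Cons(1)]
    have eq: "aut_product k (\<tau> # \<tau>s) = compose (words k) \<tau> (aut_product k \<tau>s)"
      using auto_mult[OF \<tau>, of "aut_product k \<tau>s"] Cons(3) by (simp add: aut_product_def)
    have "aut_product k (\<tau> # \<tau>s) \<in> auto (free_group k)"
      using A.m_closed[of \<tau> "aut_product k \<tau>s"] \<tau> Cons(3)
      by (simp add: aut_product_def carrier_AutoGroup)
    moreover have "aut_product k (\<tau> # \<tau>s) w = nielsens_apply False (d # ds) w \<and>
        nielsens_apply True (rev (d # ds)) (nielsens_apply False (d # ds) w) = w"
      if w: "w \<in> words k" for w
    proof -
      have p: "aut_product k \<tau>s w \<in> words k" using auto_free_group(1) Cons(3) w by blast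
      have "aut_product k (\<tau> # \<tau>s) w = nielsen_apply False d (nielsens_apply False ds w)"
        using eq w is_nielsen_apply[OF Cons(1) p] Cons(3) by (simp add: compose_def)
      moreover have "nielsen_apply True d (nielsen_apply False d (nielsens_apply False ds w))
          = nielsens_apply False ds w"
        using nielsen_apply_inverse[OF Cons(1) reduced_if_words[OF p]] Cons(3) w by simp
      ultimately show ?thesis using Cons(3) w by (simp add: nielsens_apply_def)
    qed
    ultimately show ?case by blast
  qed
  then show "aut_product k \<tau>s \<in> auto (free_group k)"
    "w \<in> words k \<Longrightarrow> aut_product k \<tau>s w = nielsens_apply False ds w"
    "w \<in> words k \<Longrightarrow> nielsens_apply True (rev ds) (nielsens_apply False ds w) = w"
    by blast+
qed

text \<open>A left inverse of a bijection is its inverse: applied to the image of the preimage of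
  \<open>w\<close>, the computed map returns that preimage.\<close>

lemma aut_product_inverse:
  assumes "list_all2 (is_nielsen k) ds \<tau>s" "w \<in> words k"
  shows "(inv\<^bsub>AutoGroup (free_group k)\<^esub> (aut_product k \<tau>s)) w = nielsens_apply True (rev ds) w"
proof -
  interpret group "free_group k" by (rule group_free_group)
  note f = aut_product_apply[OF assms(1)]
  let ?v = "(inv\<^bsub>AutoGroup (free_group k)\<^esub> (aut_product k \<tau>s)) w"
  have "inv\<^bsub>AutoGroup (free_group k)\<^esub> (aut_product k \<tau>s) \<in> auto (free_group k)"
    using group.inv_closed[OF AutoGroup, of "aut_product k \<tau>s"] f(1) by (simp add: carrier_AutoGroup)
  then have v: "?v \<in> words k" using auto_free_group(1) assms(2) by blast
  have "aut_product k \<tau>s ?v = w" using auto_inv_cancel(1)[OF f(1)] assms(2) by simp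
  then show ?thesis using f(2)[OF v] f(3)[OF v] by simp
qed


subsection \<open>Correctness of the algorithm\<close>

lemma set_extend_walks:
  "set (extend_walks E W) = set W \<union>
    {(u, v', vec_add r q) | u v q v' r. (u, v, q) \<in> set W \<and> (v, v', r) \<in> set E}"
  (is "_ = _ \<union> ?R")
proof -
  let ?U = "\<Union>w\<in>set W. \<Union>e\<in>set E.
    if fst e = fst (snd w) then {(fst w, fst (snd e), vec_add (snd (snd e)) (snd (snd w)))} else {}"
  have "set (if b then [c] else []) = (if b then {c} else {})" for b and c :: edge by simp
  then have "set (extend_walks E W) = set W \<union> ?U"
    by (simp only: extend_walks_def set_remdups set_append set_concat set_map image_image)
  moreover have "?U = ?R"
  proof (intro equalityI subsetI)
    fix t assume "t \<in> ?U"
    then obtain w e where we: "w \<in> set W" "e \<in> set E" "fst e = fst (snd w)"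
      "t = (fst w, fst (snd e), vec_add (snd (snd e)) (snd (snd w)))"
      by (auto split: if_splits)
    obtain u v q where w: "w = (u, v, q)" by (metis prod.collapse)
    obtain v'' v' r where e: "e = (v'', v', r)" by (metis prod.collapse)
    show "t \<in> ?R"
      using we unfolding w e by (intro CollectI exI[of _ u] exI[of _ v] exI[of _ q] exI[of _ v'] exI[of _ r]) simp
  next
    fix t assume "t \<in> ?R"
    then obtain u v q v' r where "(u, v, q) \<in> set W" "(v, v', r) \<in> set E" "t = (u, v', vec_add r q)"
      by blast
    then show "t \<in> ?U" by (intro UN_I[of "(u, v, q)"] UN_I[of "(v, v', r)"]) auto
  qed
  ultimately show ?thesis by simp
qed

text \<open>Following an edge prepends its letter to \<open>y\<close>, and additivity of gains makes
  the recorded sum the weight of the longer walk. Starting from single edges, each round raises the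
  admissible length by one.\<close>

lemma (in aut_pair) set_saturate:
  assumes E: "set E = {(u, take L (x # u), walk_vec f g M [x] u) | x u. length u = L \<and> x # u \<in> words k}"
    and L: "2 * M * M \<le> L" "1 \<le> L"
  shows "set (saturate fuel E) = {(u, take L (y @ u), walk_vec f g M y u) | y u.
    y \<noteq> [] \<and> length y \<le> Suc (length fuel) \<and> length u = L \<and> y @ u \<in> words k}"
proof (induction fuel)
  case Nil
  have "(u, take L (y @ u), walk_vec f g M y u) \<in> set E"
    if y: "y \<noteq> []" "length y \<le> Suc 0" and u: "length u = L" "y @ u \<in> words k" for y u
  proof -
    obtain x where x: "y = [x]" using y by (cases y) auto
    then show ?thesis unfolding E using u by (intro CollectI exI[of _ x] exI[of _ u]) simp
  qed
  moreover have "\<exists>y. (u, take L (x # u), walk_vec f g M [x] u) = (u, take L (y @ u), walk_vec f g M y u)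
      \<and> y \<noteq> [] \<and> length y \<le> Suc 0 \<and> y @ u \<in> words k" if "x # u \<in> words k" for x u
    using that by (intro exI[of _ "[x]"]) simp
  ultimately show ?case unfolding saturate_def using E by fastforce
next
  case (Cons a fuel)
  let ?S = "\<lambda>n. {(u, take L (y @ u), walk_vec f g M y u) | y u.
    y \<noteq> [] \<and> length y \<le> n \<and> length u = L \<and> y @ u \<in> words k}"
  \<comment> \<open>The stored window \<open>take L (y @ u)\<close> alone decides whether
    \<open>x\<close> may be prepended and by how much the weight changes.\<close>
  have step: "x # y @ u \<in> words k \<and> walk_vec f g M (x # y) u =
      vec_add (walk_vec f g M [x] (take L (y @ u))) (walk_vec f g M y u) \<and>
      take L (x # take L (y @ u)) = take L (x # y @ u)"
    if "length u = L" "y @ u \<in> words k" "x # take L (y @ u) \<in> words k" for x y u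
  proof -
    have ne: "take L (y @ u) \<noteq> []" "y @ u \<noteq> []" using that(1) L(2) by auto
    have "take L (take L (y @ u)) = take L (y @ u)" by (simp only: take_take min.idem)
    moreover have "[x] @ take L (y @ u) \<in> words k"
      using that(3) by (simp only: append_Cons append_Nil)
    ultimately have "[x] @ y @ u \<in> words k" using words_replace_tail that(2) L(2) ne by blast
    then have w: "x # y @ u \<in> words k" by simp
    then show ?thesis
      using gain_append[of "[x]" y u L] aut_pair.gain_append[OF swapped, of "[x]" y u L] that(1) L
      by (cases L) (auto simp: walk_vec_def vec_add_def min_def)
  qed
  have sat: "saturate (a # fuel) E = extend_walks E (saturate fuel E)" by (simp add: saturate_def)
  have "set (extend_walks E (saturate fuel E)) \<subseteq> ?S (Suc (Suc (length fuel)))"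
  proof
    fix w assume "w \<in> set (extend_walks E (saturate fuel E))"
    then consider "w \<in> ?S (Suc (length fuel))"
      | u v q v' r where "(u, v, q) \<in> ?S (Suc (length fuel))" "(v, v', r) \<in> set E" "w = (u, v', vec_add r q)"
      unfolding set_extend_walks Cons.IH by blast
    then show "w \<in> ?S (Suc (Suc (length fuel)))"
    proof cases
      case 1
      then show ?thesis by fastforce
    next
      case 2
      from 2(1) obtain y where y: "v = take L (y @ u)" "q = walk_vec f g M y u" "y \<noteq> []"
        "length y \<le> Suc (length fuel)" "length u = L" "y @ u \<in> words k" by auto
      from 2(2) obtain x where x: "v' = take L (x # v)" "r = walk_vec f g M [x] v" "x # v \<in> words k"
        unfolding E by auto
      note s = step[OF y(5,6) x(3)[unfolded y(1)]]
      have "w = (u, take L ((x # y) @ u), walk_vec f g M (x # y) u)"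
        using s 2(3) x y by simp
      then show ?thesis using s y by (intro CollectI exI[of _ "x # y"] exI[of _ u]) simp
    qed
  qed
  moreover have "?S (Suc (Suc (length fuel))) \<subseteq> set (extend_walks E (saturate fuel E))"
  proof
    fix w assume "w \<in> ?S (Suc (Suc (length fuel)))"
    then obtain y u where w: "w = (u, take L (y @ u), walk_vec f g M y u)" "y \<noteq> []"
      "length y \<le> Suc (Suc (length fuel))" "length u = L" "y @ u \<in> words k" by auto
    show "w \<in> set (extend_walks E (saturate fuel E))"
    proof (cases "length y \<le> Suc (length fuel)")
      case True
      then have "w \<in> ?S (Suc (length fuel))" using w by blast
      then show ?thesis unfolding set_extend_walks Cons.IH by blast
    next
      case False
      obtain x y' where y: "y = x # y'" using w(2) by (cases y) blast+
      with False have ne: "y' \<noteq> []" by auto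
      have yu: "y' @ u \<in> words k" using w(5) y by (simp add: words_Cons_iff)
      have "(x # take L (y' @ u)) @ drop L (y' @ u) \<in> words k"
        using w(5) unfolding y by (simp del: take_append drop_append)
      then have xw: "x # take L (y' @ u) \<in> words k" by (rule words_appendD(1))
      have q: "(u, take L (y' @ u), walk_vec f g M y' u) \<in> set (saturate fuel E)"
        unfolding Cons.IH using w(3,4) yu ne unfolding y by auto
      have r: "(take L (y' @ u), take L (x # take L (y' @ u)), walk_vec f g M [x] (take L (y' @ u)))
          \<in> set E"
        unfolding E using xw w(4) by (intro CollectI exI[of _ x] exI[of _ "take L (y' @ u)"]) simp
      note s = step[OF w(4) yu xw]
      have "(u, take L (x # take L (y' @ u)),
          vec_add (walk_vec f g M [x] (take L (y' @ u))) (walk_vec f g M y' u))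
          \<in> set (extend_walks E (saturate fuel E))"
        unfolding set_extend_walks using q r by blast
      then show ?thesis
        unfolding w(1) y append_Cons s[THEN conjunct2, THEN conjunct1]
          s[THEN conjunct2, THEN conjunct2] .
    qed
  qed
  ultimately show ?case unfolding sat by simp
qed

lemma (in aut_pair) set_closed_list:
  assumes "set W = {(u, take L (y @ u), walk_vec f g M y u) | y u.
    y \<noteq> [] \<and> length y \<le> N \<and> length u = L \<and> y @ u \<in> words k}"
  shows "set (closed_list W) = closed_vecs k L N f g M"
proof -
  have "closed_list W = map (snd \<circ> snd) (filter (\<lambda>w. fst w = fst (snd w)) W)"
    by (simp add: closed_list_def o_def)
  then have "set (closed_list W) = {q. \<exists>u. (u, u, q) \<in> set W}" by force
  also have "\<dots> = closed_vecs k L N f g M"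
  proof (intro equalityI subsetI)
    fix q assume "q \<in> {q. \<exists>u. (u, u, q) \<in> set W}"
    then obtain y u where "q = walk_vec f g M y u" "take L (y @ u) = u"
      "y \<noteq> []" "length y \<le> N" "length u = L" "y @ u \<in> words k"
      unfolding assms by auto
    then show "q \<in> closed_vecs k L N f g M"
      unfolding closed_vecs_def closed_walk_def by blast
  next
    fix q assume "q \<in> closed_vecs k L N f g M"
    then obtain y u where y: "q = walk_vec f g M y u" "y \<noteq> []" "length y \<le> N" "length u = L"
      "y @ u \<in> words k" and u: "take L (y @ u) = u"
      unfolding closed_vecs_def closed_walk_def by blast
    have "(u, take L (y @ u), q) \<in> set W" unfolding assms using y by blast
    then show "q \<in> {q. \<exists>u. (u, u, q) \<in> set W}" unfolding u by blast
  qed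
  finally show ?thesis .
qed

lemma set_candidate_list: "set (candidate_list S) = candidates (set S)"
  by (auto simp: candidate_list_def candidates_def)

lemma min_ratio_least:
  assumes "S \<noteq> []" "\<And>v. v \<in> set S \<Longrightarrow> 0 < fst v"
  shows "0 < snd (min_ratio S) \<and>
    (\<exists>v\<in>set S. real (fst (min_ratio S)) / real (snd (min_ratio S)) = ratio v) \<and>
    (\<forall>v\<in>set S. real (fst (min_ratio S)) / real (snd (min_ratio S)) \<le> ratio v)"
  using assms
proof (induction S)
  case (Cons v S)
  obtain n a b where v: "v = (n, a, b)" by (metis prod_cases3)
  have n: "0 < n" using Cons.prems(2)[of v] v by simp
  obtain p q where pq: "min_ratio S = (p, q)" by (metis surj_pair)
  have step: "min_ratio (v # S) = (if max a b * q \<le> p * n then (max a b, n) else (p, q))"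
    using pq by (simp add: min_ratio_def less_ratio_def Let_def v)
  show ?case
  proof (cases "S = []")
    case True
    then have "p = 1" "q = 0" using pq by (auto simp: min_ratio_def)
    then have "min_ratio (v # S) = (max a b, n)" using step by simp
    then show ?thesis using n True by (simp add: v ratio_def)
  next
    case False
    then have IH: "0 < q" "\<exists>v\<in>set S. real p / real q = ratio v" "\<forall>v\<in>set S. real p / real q \<le> ratio v"
      using Cons pq by auto
    have iff: "max a b * q \<le> p * n \<longleftrightarrow> ratio v \<le> real p / real q"
      using n IH(1) unfolding v ratio_def
      by (simp add: divide_le_eq pos_le_divide_eq del: of_nat_max flip: of_nat_mult)
    show ?thesis
    proof (cases "max a b * q \<le> p * n")
      case True
      then have "ratio v \<le> real p / real q" using iff by simp
      then have "\<forall>w\<in>set (v # S). ratio v \<le> ratio w" using IH(3) by auto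
      moreover have "real (max a b) / real n = ratio v" by (simp add: v ratio_def)
      ultimately show ?thesis using True n unfolding step by auto
    next
      case False
      then have "real p / real q \<le> ratio v" using iff by simp
      then show ?thesis using False IH unfolding step by auto
    qed
  qed
qed simp

lemma answer_correct:
  assumes k: "k \<ge> 2" and ds: "list_all2 (is_nielsen k) ds \<tau>s"
    and \<phi>: "\<phi> \<in> carrier (Out (free_group k))" "aut_product k \<tau>s \<in> \<phi>"
  obtains p q where "0 < q" "lambda0 k \<phi> = real p / real q"
    "answer k ds = ((p, q), strictly_hyperbolic k \<phi>)"
proof -
  define f where "f = aut_product k \<tau>s"
  define g where "g = inv\<^bsub>AutoGroup (free_group k)\<^esub> f"
  define M where "M = image_bound ds"
  define L where "L = window ds"
  have M: "M = 2 ^ length ds" by (simp add: M_def image_bound_eq)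
  have L: "L = 2 * M * M" by (simp add: L_def M_def window_def)
  have F: "f w = nielsens_apply False ds w" and G: "g w = nielsens_apply True (rev ds) w"
    if "w \<in> words k" for w
    using aut_product_apply(2)[OF ds that] aut_product_inverse[OF ds that] by (simp_all add: f_def g_def)
  have letter: "[x] \<in> words k" if "fst x < k" for x using that by (simp add: words_Cons_iff)
  interpret out_pair k M f g \<phi>
    unfolding g_def
  proof (rule out_pair_inverse[OF k _ \<phi>(1)])
    show "M \<ge> 1" by (simp add: M)
    show "f \<in> \<phi>" using \<phi>(2) by (simp add: f_def)
    fix x :: letter assume "fst x < k"
    then show "length (f [x]) \<le> M" "length ((inv\<^bsub>AutoGroup (free_group k)\<^esub> f) [x]) \<le> M"
      using F[OF letter] G[OF letter] length_nielsens_apply[of False ds "[x]"]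
        length_nielsens_apply[of True "rev ds" "[x]"]
      by (simp_all add: M g_def)
  qed
  have L1: "1 \<le> L" using M_square by (simp add: L)
  have E: "set (edges k ds) =
      {(u, take L (x # u), walk_vec f g M [x] u) | x u. length u = L \<and> x # u \<in> words k}"
  proof -
    have edge: "word_edge ds (x # u) = (u, take L (x # u), walk_vec f g M [x] u)"
      if "length u = L" "x # u \<in> words k" for x u
    proof -
      have u: "u \<in> words k" using that(2) by (simp add: words_Cons_iff)
      show ?thesis
        using that(1) F[OF that(2)] F[OF u] G[OF that(2)] G[OF u]
        by (simp add: word_edge_def walk_vec_def gain_def M_def butlast_conv_take)
    qed
    have mem: "x # u \<in> set (all_words k (Suc L)) \<and> reduce (x # u) = x # u \<longleftrightarrow>
        length u = L \<and> x # u \<in> words k" for x u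
    proof -
      have "reduce (x # u) = x # u \<longleftrightarrow> reduced (x # u)" by (metis reduced_reduce reduce_reduced)
      then show ?thesis by (auto simp: set_all_words words_def)
    qed
    have "set (edges k ds) = {word_edge ds e | e. e \<in> set (all_words k (Suc L)) \<and> reduce e = e}"
      by (auto simp: edges_def L_def)
    also have "\<dots> = {word_edge ds (x # u) | x u. x # u \<in> set (all_words k (Suc L)) \<and> reduce (x # u) = x # u}"
    proof -
      have "\<exists>x u. e = x # u" if "e \<in> set (all_words k (Suc L))" for e
      proof -
        have "length e = Suc L" using that unfolding set_all_words by blast
        then show ?thesis by (metis length_Suc_conv)
      qed
      then show ?thesis by blast
    qed
    also have "\<dots> = {(u, take L (x # u), walk_vec f g M [x] u) | x u. length u = L \<and> x # u \<in> words k}"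
      unfolding mem using edge by (auto 0 4) metis
    finally show ?thesis .
  qed
  define W where "W = saturate (all_words k (Suc L)) (edges k ds)"
  \<comment> \<open>Single edges have length 1 and each element of the fuel allows one letter more.
    The fuel has \<open>(2 * k) ^ Suc L\<close> elements, beyond the \<open>(2 * k) ^ L\<close>
    letters at which walks begin to split.\<close>
  define N where "N = Suc (length (all_words k (Suc L)))"
  have "set (closed_list W) = closed_vecs k L N f g M"
    unfolding W_def N_def by (rule set_closed_list[OF set_saturate[OF E]]) (use L L1 in auto)
  then have cand: "set (candidate_list (closed_list W)) = candidates (closed_vecs k L N f g M)"
    by (simp add: set_candidate_list)
  have N: "(2 * k) ^ L \<le> N"
  proof -
    have "(2 * k) ^ L \<le> (2 * k) ^ Suc L" using k by (intro power_increasing) auto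
    then show ?thesis unfolding N_def length_all_words by (rule le_SucI)
  qed
  obtain v where v: "v \<in> candidates (closed_vecs k L N f g M)" "lambda0 k \<phi> + real M = ratio v"
    using lambda0_eq_candidate[OF _ N finite_closed_vecs] L by auto
  define r where "r = min_ratio (candidate_list (closed_list W))"
  have ne: "candidate_list (closed_list W) \<noteq> []" using v(1) cand by auto
  have pos: "0 < fst w" if "w \<in> set (candidate_list (closed_list W))" for w
    using that by (auto simp: candidate_list_def)
  note r = min_ratio_least[OF ne pos, folded r_def, unfolded cand]
  have q: "0 < snd r" using r by blast
  have eq: "real (fst r) / real (snd r) = lambda0 k \<phi> + real M"
  proof (rule antisym)
    show "real (fst r) / real (snd r) \<le> lambda0 k \<phi> + real M" using r v by metis
    obtain w where "w \<in> candidates (closed_vecs k L N f g M)" "real (fst r) / real (snd r) = ratio w"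
      using r by blast
    then show "lambda0 k \<phi> + real M \<le> real (fst r) / real (snd r)"
      using lambda0_le_candidate[of L w N] L by simp
  qed
  define p where "p = fst r - M * snd r"
  have fr: "real (fst r) = (lambda0 k \<phi> + real M) * real (snd r)"
    using eq q by (simp add: divide_eq_eq)
  \<comment> \<open>Nonnegativity of the infimum ensures that the subtraction in \<open>p\<close>
    does not truncate.\<close>
  have "real (M * snd r) \<le> real (fst r)"
    unfolding fr using lambda0_nonneg by (simp add: algebra_simps)
  then have "M * snd r \<le> fst r" by (simp only: of_nat_le_iff)
  then have "real p = real (fst r) - real M * real (snd r)" by (simp add: p_def of_nat_diff)
  then have p: "real p = lambda0 k \<phi> * real (snd r)" unfolding fr by (simp add: algebra_simps)
  then have lam: "lambda0 k \<phi> = real p / real (snd r)" using q by simp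
  have "strictly_hyperbolic k \<phi> \<longleftrightarrow> lambda0 k \<phi> > 1"
    using strictly_hyperbolic_iff[OF _ \<phi>(1)] k by simp
  also have "\<dots> \<longleftrightarrow> snd r < p" unfolding lam using q by (simp add: less_divide_eq)
  finally have "answer k ds = ((p, snd r), strictly_hyperbolic k \<phi>)"
    by (simp add: answer_def Let_def r_def p_def W_def L_def M_def)
  with q lam show thesis by (rule that)
qed

section \<open>The doubly exponential bound\<close>

lemma sz_nielsen_list:
  assumes "list_all2 (is_nielsen k) ds \<tau>s"
  shows "sz ds \<le> 2 + length ds * (2 * k + 10)"
proof (rule sz_list_le)
  fix d assume "d \<in> set ds"
  then obtain \<tau> where "is_nielsen k d \<tau>" using assms
    by (metis in_set_conv_nth list_all2_conv_all_nth)
  moreover have "size (enc_nat n) = n" for n by (induction n) auto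
  ultimately show "sz d \<le> 2 * k + 10"
    by (cases d) (auto simp: sz_def enc_nielsen_def)
qed simp

text \<open>The window is \<open>2 * 4 ^ t\<close>, so the number of words is already doubly
  exponential, and the input size is absorbed in the constants. With \<open>a = 2 * k + 12\<close>
  the final constant is \<open>Suc a + 2\<close>.\<close>

lemma algorithm_measure_le:
  assumes "sz ds \<le> 2 + length ds * (2 * k + 10)"
  shows "algorithm_measure k ds \<le> 2 ^ 2 ^ ((2 * k + 15) * (length ds + 1))"
proof -
  define t where "t = length ds"
  define a where "a = 2 * k + 12"
  have w: "Suc (window ds) \<le> 4 ^ (t + 1)" "t \<le> window ds"
  proof -
    have "(2 :: nat) ^ t * 2 ^ t = 4 ^ t" by (simp flip: power_mult_distrib)
    then have w: "window ds = 2 * 4 ^ t" by (simp add: window_def image_bound_eq t_def)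
    have "(1 :: nat) \<le> 4 ^ t" by simp
    then show "Suc (window ds) \<le> 4 ^ (t + 1)" unfolding w by simp
    have "t < 2 ^ t" by (rule less_exp)
    also have "(2 :: nat) ^ t \<le> 4 ^ t" by (rule power_mono) auto
    finally show "t \<le> window ds" unfolding w by simp
  qed
  have "(2 * k + 2) ^ Suc (window ds) \<le> (2 ^ a) ^ Suc (window ds)"
  proof (rule power_mono)
    have "2 * k + 2 \<le> a" by (simp add: a_def)
    also have "a \<le> 2 ^ a" by (rule less_imp_le[OF less_exp])
    finally show "2 * k + 2 \<le> 2 ^ a" .
  qed simp
  then have 1: "(2 * k + 2) ^ Suc (window ds) \<le> 2 ^ (a * Suc (window ds))" by (simp only: power_mult)
  have "sz ds \<le> 2 + t * (2 * k + 10)" using assms by (simp add: t_def)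
  also have "\<dots> \<le> 2 ^ t * a"
  proof -
    have "t * (2 * k + 10) \<le> 2 ^ t * (2 * k + 10)" by (rule mult_le_mono1[OF less_imp_le[OF less_exp]])
    moreover have "(2 :: nat) \<le> 2 ^ t * 2" by simp
    moreover have "2 ^ t * a = 2 ^ t * (2 * k + 10) + 2 ^ t * 2" by (simp add: a_def algebra_simps)
    ultimately show ?thesis by linarith
  qed
  also have "\<dots> \<le> 2 ^ t * 2 ^ a" by (rule mult_le_mono2[OF less_imp_le[OF less_exp]])
  also have "\<dots> = 2 ^ (t + a)" by (rule power_add[symmetric])
  also have "\<dots> \<le> 2 ^ (a * Suc (window ds))"
  proof (rule power_increasing)
    have "t \<le> 1 * window ds" using w(2) by simp
    also have "\<dots> \<le> a * window ds" by (rule mult_le_mono1) (simp add: a_def)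
    finally show "t + a \<le> a * Suc (window ds)" by simp
  qed simp
  finally have 2: "sz ds \<le> 2 ^ (a * Suc (window ds))" .
  have "algorithm_measure k ds \<le> 2 ^ Suc (a * Suc (window ds))"
    using 1 2 by (simp add: algorithm_measure_def)
  also have "\<dots> \<le> 2 ^ 2 ^ ((2 * k + 15) * (t + 1))"
  proof (rule power_increasing)
    have "Suc (a * Suc (window ds)) \<le> Suc a * Suc (window ds)" by simp
    also have "\<dots> \<le> 2 ^ Suc a * 4 ^ (t + 1)"
      by (rule mult_le_mono[OF less_imp_le[OF less_exp] w(1)])
    also have "(4 :: nat) ^ (t + 1) = 2 ^ (2 * (t + 1))" by (simp add: power_mult)
    also have "2 ^ Suc a * 2 ^ (2 * (t + 1)) = (2 :: nat) ^ (Suc a + 2 * (t + 1))"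
      by (rule power_add[symmetric])
    also have "\<dots> \<le> 2 ^ ((2 * k + 15) * (t + 1))"
    proof (rule power_increasing)
      have "Suc a \<le> Suc a * (t + 1)" by simp
      then have "Suc a + 2 * (t + 1) \<le> (Suc a + 2) * (t + 1)" by (simp only: add_mult_distrib)
      then show "Suc a + 2 * (t + 1) \<le> (2 * k + 15) * (t + 1)" by (simp add: a_def)
    qed simp
    finally show "Suc (a * Suc (window ds)) \<le> 2 ^ ((2 * k + 15) * (t + 1))" .
  qed simp
  finally show ?thesis by (simp add: t_def)
qed

theorem theorem6p2:
  fixes k :: nat
  assumes "k \<ge> 2"
  shows
    "(\<forall>\<phi>\<in>carrier (Out (free_group k)). strictly_hyperbolic k \<phi> \<longleftrightarrow> lambda0 k \<phi> > 1) \<and>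
     (\<forall>\<phi>\<in>carrier (Out (free_group k)). lambda0 k \<phi> \<in> \<rat>) \<and>
     (\<exists>(P :: program) (C :: nat).
        \<forall>ds \<tau>s \<phi>. list_all2 (is_nielsen k) ds \<tau>s \<and>
          \<phi> \<in> carrier (Out (free_group k)) \<and> aut_product k \<tau>s \<in> \<phi> \<longrightarrow>
          (\<exists>p q n. q > 0 \<and> lambda0 k \<phi> = real p / real q \<and>
             computes P (enc_list (map enc_nielsen ds))
               (enc_answer p q (strictly_hyperbolic k \<phi>)) n \<and>
             n \<le> 2 ^ (2 ^ (C * (length ds + 1)))))"
proof -
  obtain P c where P: "\<And>ds. \<exists>n\<le>algorithm_measure k ds ^ c. computes P (enc ds) (enc (answer k ds)) n"
    using feas_computes[OF feas_answer] by blast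
  \<comment> \<open>Raising to the power \<open>c\<close> multiplies the inner exponential by
    \<open>c\<close>, which is at most \<open>2 ^ (c * (length ds + 1))\<close>; this adds
    \<open>c\<close> to the constant.\<close>
  define C where "C = c + (2 * k + 15)"
  have main: "\<exists>p q n. q > 0 \<and> lambda0 k \<phi> = real p / real q \<and>
      computes P (enc_list (map enc_nielsen ds)) (enc_answer p q (strictly_hyperbolic k \<phi>)) n \<and>
      n \<le> 2 ^ (2 ^ (C * (length ds + 1)))"
    if ds: "list_all2 (is_nielsen k) ds \<tau>s" and \<phi>: "\<phi> \<in> carrier (Out (free_group k))"
      "aut_product k \<tau>s \<in> \<phi>" for ds \<tau>s \<phi>
  proof -
    obtain p q where pq: "0 < q" "lambda0 k \<phi> = real p / real q"
      "answer k ds = ((p, q), strictly_hyperbolic k \<phi>)"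
      by (rule answer_correct[OF assms ds \<phi>])
    obtain n where n: "n \<le> algorithm_measure k ds ^ c" "computes P (enc ds) (enc (answer k ds)) n"
      using P[of ds] by blast
    have "enc ds = enc_list (map enc_nielsen ds)" by (simp add: enc_list_def enc_nielsen_def)
    moreover have "enc (answer k ds) = enc_answer p q (strictly_hyperbolic k \<phi>)"
      by (simp add: pq(3) enc_answer_def enc_nat_eq enc_bool_eq)
    moreover have "n \<le> 2 ^ (2 ^ (C * (length ds + 1)))"
    proof -
      let ?b = "(2 * k + 15) * (length ds + 1)"
      have "n \<le> (2 ^ 2 ^ ?b) ^ c"
        using n(1) power_mono[OF algorithm_measure_le[OF sz_nielsen_list[OF ds]], of c] by simp
      also have "\<dots> = 2 ^ (2 ^ ?b * c)" by (simp only: power_mult)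
      also have "\<dots> \<le> 2 ^ (2 ^ (C * (length ds + 1)))"
      proof (rule power_increasing)
        have "2 ^ ?b * c \<le> 2 ^ ?b * 2 ^ (c * (length ds + 1))"
        proof (rule mult_le_mono2)
          have "c \<le> c * (length ds + 1)" by simp
          also have "\<dots> \<le> 2 ^ (c * (length ds + 1))" by (rule less_imp_le[OF less_exp])
          finally show "c \<le> 2 ^ (c * (length ds + 1))" .
        qed
        also have "\<dots> = 2 ^ (?b + c * (length ds + 1))" by (rule power_add[symmetric])
        also have "?b + c * (length ds + 1) = C * (length ds + 1)" by (simp add: C_def algebra_simps)
        finally show "2 ^ ?b * c \<le> 2 ^ (C * (length ds + 1))" .
      qed simp
      finally show ?thesis .
    qed
    ultimately show ?thesis using n(2) pq by (intro exI[of _ p] exI[of _ q] exI[of _ n]) simp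
  qed
  show ?thesis
  proof (intro conjI)
    show "\<forall>\<phi>\<in>carrier (Out (free_group k)). strictly_hyperbolic k \<phi> \<longleftrightarrow> lambda0 k \<phi> > 1"
      using strictly_hyperbolic_iff[of k] assms by simp
    show "\<forall>\<phi>\<in>carrier (Out (free_group k)). lambda0 k \<phi> \<in> \<rat>"
      using lambda0_rational[OF assms] by blast
  qed (rule exI[of _ P], rule exI[of _ C], intro allI impI, elim conjE, rule main)
qed

end
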